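(* Let $X$ be a $T_0$ topological space, and let $\alpha\colon\mathcal V_{\mathrm p}X\to X$ be a function. If $(X,\alpha)$ is a $\mathcal V_{\mathrm p}$-algebra, then $X$, with the operations $x+y=\alpha(\delta_x+\delta_y)$ and $r\cdot x=\alpha(r\delta_x)$ ($x,y\in X$, $r\in\mathbb R_+$), is a weakly locally convex sober topological cone, and $\alpha$ is a linear continuous function that maps every point-continuous valuation to one of its barycentres, and every Dirac mass $\delta_x$ to its standard barycentre $x$. Conversely, for every weakly locally convex sober topological cone $C$, there exists a (unique) continuous linear map $\alpha\colon\mathcal V_{\mathrm p}C\to C$ that sends each Dirac mass $\delta_x$ to its standard barycentre $x$. Then the pair $(C,\alpha)$ is a $\mathcal V_{\mathrm p}$-algebra.
   Context: $\mathbb R_+=[0,\infty)$ and $\overline{\mathbb R}_+=[0,\infty]$, both with the Scott topology (proper nonempty opens are the sets of elements $>r$, $r\in\mathbb R_+$). $\mathbf{TOP}_0$ is the category of $T_0$ topological spaces and continuous maps. Valuations. A valuation on a space $X$ with lattice of opens $\mathcal OX$ is a map $\mu\colon\mathcal OX\to\overline{\mathbb R}_+$ with $\mu(\emptyset)=0$, $\mu(U)\le\mu(V)$ if $U\subseteq V$, and $\mu(U)+\mu(V)=\mu(U\cup V)+\mu(U\cap V)$. The point topology on $\mathcal OX$ has subbasic opens $\mathcal O(x)=\{U\in\mathcal OX\mid x\in U\}$, $x\in X$. A point-continuous valuation is a valuation that is continuous from $\mathcal OX$ with the point topology to $\overline{\mathbb R}_+$. The Dirac mass $\delta_x$ ($\delta_x(U)=1$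 if $x\in U$, and $0$ otherwise) is point-continuous. Linear combinations of valuations are formed pointwise. $\mathcal V_{\mathrm p}X$ is the set of point-continuous valuations on $X$ with the (weak) topology generated by the subbasic sets $\{\mu\mid\mu(U)>r\}$, $U\in\mathcal OX$, $r\in\mathbb R_+$; it is a cone under pointwise operations. For continuous $h\colon X\to\overline{\mathbb R}_+$ (i.e. $h$ lower semi-continuous), $\int h\,d\mu=\int_0^\infty\mu(h^{-1}((r,\infty]))\,dr$ (Riemann integral). The monad. $\mathcal V_{\mathrm p}$ is a monad on $\mathbf{TOP}_0$, with $\mathcal V_{\mathrm p}f(\mu)(V)=\mu(f^{-1}(V))$, unit $\eta_X(x)=\delta_x$, and multiplication $m_X(\varpi)(U)=\int_{\mu\in\mathcal V_{\mathrm p}X}\mu(U)\,d\varpi$ for $\varpi\in\mathcal V_{\mathrm p}\mathcal V_{\mathrm p}X$. A $\mathcal V_{\mathrm p}$-algebra is a pair $(X,\alpha)$ of a $T_0$ space $X$ and a continuous map $\alpha\colon\mathcal V_{\mathrm p}X\to X$ with $\alpha\circ\eta_X=\mathrm{id}_X$ and $\alpha\circ m_X=\alpha\circ\mathcal V_{\mathrm p}\alpha$. Cones. A cone is a commutative monoid $(C,+,0)$ with a scalar multiplication $\mathbb R_+\times C\to C$ such that $r(x+y)=rx+ry$, $(r+s)x=rx+sx$, $(rs)x=r(sx)$, $1x=x$, $0x=0$, $r0=0$. A topological cone is a cone with a $T_0$ topology making $+$ and scalar multiplication jointly continuous. A map $f$ between cones is linear if $f(rx+sy)=rf(x)+sf(y)$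 for all $r,s\in\mathbb R_+$; $\overline{\mathbb R}_+$ is a cone with $0\cdot\infty=0$. A subset $A$ of a cone is convex if $ra+(1-r)b\in A$ for all $a,b\in A$, $r\in[0,1]$. A cone with a $T_0$ topology is weakly locally convex if for every point $x$, every open neighbourhood of $x$ contains a convex (not necessarily open) neighbourhood of $x$. A (Choquet) barycentre of a valuation $\nu$ on a topological cone $C$ is a point $b\in C$ such that $\Lambda(b)=\int\Lambda\,d\nu$ for every linear lower semi-continuous map $\Lambda\colon C\to\overline{\mathbb R}_+$. *)

theory Defs
  imports "HOL-Analysis.Analysis"
begin

section \<open>The Scott topologies on \<open>[0,\<infinity>]\<close> and \<open>[0,\<infinity>)\<close>\<close>

definition scott_ennreal :: "ennreal topology" where
  "scott_ennreal = topology (\<lambda>U. U = {} \<or> U = UNIV \<or> (\<exists>r\<ge>0::real. U = {ennreal r<..}))"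

definition scott_nnreal :: "real topology" where
  "scott_nnreal = topology (\<lambda>U. U = {} \<or> U = {0..} \<or> (\<exists>r\<ge>0. U = {r<..}))"

lemma openin_scott_ennreal:
  "openin scott_ennreal U \<longleftrightarrow> U = {} \<or> U = UNIV \<or> (\<exists>r\<ge>0::real. U = {ennreal r<..})"
proof -
  let ?P = "\<lambda>U. U = {} \<or> U = UNIV \<or> (\<exists>r\<ge>0::real. U = {ennreal r<..})"
  have "?P (S \<inter> T)" if S: "?P S" and T: "?P T" for S T
  proof -
    consider "S = {} \<or> T = {}" | "S = UNIV" | "T = UNIV"
      | r s where "0 \<le> r" "0 \<le> s" "S = {ennreal r<..}" "T = {ennreal s<..}"
      using S T by blast
    then show ?thesis
    proof cases
      case 4
      then have "S \<inter> T = {ennreal (max r s)<..}"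
        by (auto simp: max_def intro: le_less_trans[OF ennreal_leI])
          (meson ennreal_leI le_less_trans linear)
      then show ?thesis using 4(1) by (meson max.coboundedI1)
    qed (use S T in auto)
  qed
  moreover have "?P (\<Union>\<K>)" if K: "\<forall>S\<in>\<K>. ?P S" for \<K>
  proof (cases "UNIV \<in> \<K> \<or> \<Union>\<K> = {}")
    case True then show ?thesis by auto
  next
    case False
    define R where "R = {r. 0 \<le> r \<and> {ennreal r<..} \<in> \<K>}"
    have "R \<noteq> {}" using False K unfolding R_def by auto
    have bdd: "bdd_below R" by (auto simp: R_def intro!: bdd_belowI[of _ 0])
    have "\<Union>\<K> = {ennreal (Inf R)<..}"
    proof (intro set_eqI iffI)
      fix x assume "x \<in> \<Union>\<K>"
      then obtain r where r: "r \<in> R" "ennreal r < x" using K False unfolding R_def by auto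
      have "ennreal (Inf R) \<le> ennreal r" using bdd r by (intro ennreal_leI cInf_lower)
      with r show "x \<in> {ennreal (Inf R)<..}" by auto
    next
      fix x assume x: "x \<in> {ennreal (Inf R)<..}"
      have "\<exists>r\<in>R. ennreal r < x"
      proof (cases x)
        case (real t)
        have "Inf R < t"
          using x real by (metis ennreal_leI greaterThan_iff linorder_not_le)
        then obtain r where "r \<in> R" "r < t" using cInf_lessD \<open>R \<noteq> {}\<close> by blast
        then show ?thesis using real by (auto intro!: bexI[of _ r] simp: R_def ennreal_less_iff)
      next
        case top then show ?thesis using \<open>R \<noteq> {}\<close> by auto
      qed
      then show "x \<in> \<Union>\<K>" unfolding R_def by auto
    qed
    moreover have "0 \<le> Inf R"
      using \<open>R \<noteq> {}\<close> by (intro cInf_greatest) (auto simp: R_def)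
    ultimately show ?thesis by blast
  qed
  ultimately have "istopology ?P" unfolding istopology_def by blast
  then show ?thesis unfolding scott_ennreal_def by (simp add: topology_inverse')
qed

lemma openin_scott_nnreal:
  "openin scott_nnreal U \<longleftrightarrow> U = {} \<or> U = {0..} \<or> (\<exists>r\<ge>0. U = {r<..})"
proof -
  let ?P = "\<lambda>U. U = {} \<or> U = {0..} \<or> (\<exists>r\<ge>0::real. U = {r<..})"
  have "?P (S \<inter> T)" if S: "?P S" and T: "?P T" for S T
  proof -
    have sub: "U \<subseteq> {0..}" if "?P U" for U using that by (elim disjE exE conjE) auto
    consider "S = {} \<or> T = {}" | "S = {0..}" | "T = {0..}"
      | r s where "0 \<le> r" "0 \<le> s" "S = {r<..}" "T = {s<..}"
      using S T by blast
    then show ?thesis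
    proof cases
      case 1 then show ?thesis by auto
    next
      case 2 then show ?thesis using T sub[OF T] by (simp add: Int_absorb1)
    next
      case 3 then show ?thesis using S sub[OF S] by (simp add: Int_absorb2)
    next
      case 4
      then have "S \<inter> T = {max r s<..}" by auto
      then show ?thesis using 4(1) by (meson max.coboundedI1)
    qed
  qed
  moreover have "?P (\<Union>\<K>)" if K: "\<forall>S\<in>\<K>. ?P S" for \<K>
  proof (cases "{0..} \<in> \<K> \<or> \<Union>\<K> = {}")
    case True
    moreover have "S \<subseteq> {0..}" if "S \<in> \<K>" for S
      using bspec[OF K that] by (elim disjE exE conjE) auto
    ultimately show ?thesis by blast
  next
    case False
    define R where "R = {r. 0 \<le> r \<and> {r<..} \<in> \<K>}"
    have "R \<noteq> {}" using False K unfolding R_def by auto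
    have bdd: "bdd_below R" by (auto simp: R_def intro!: bdd_belowI[of _ 0])
    have "\<Union>\<K> = {Inf R<..}"
    proof (intro set_eqI iffI)
      fix x assume "x \<in> \<Union>\<K>"
      then obtain r where r: "r \<in> R" "r < x" using K False unfolding R_def by auto
      then show "x \<in> {Inf R<..}" using cInf_lower[OF r(1) bdd] by auto
    next
      fix x assume x: "x \<in> {Inf R<..}"
      then obtain r where "r \<in> R" "r < x" using cInf_lessD \<open>R \<noteq> {}\<close> by (metis greaterThan_iff)
      then show "x \<in> \<Union>\<K>" unfolding R_def by auto
    qed
    moreover have "0 \<le> Inf R"
      using \<open>R \<noteq> {}\<close> by (intro cInf_greatest) (auto simp: R_def)
    ultimately show ?thesis by blast
  qed
  ultimately have "istopology ?P" unfolding istopology_def by blast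
  then show ?thesis unfolding scott_nnreal_def by (simp add: topology_inverse')
qed

lemma topspace_scott_ennreal [simp]: "topspace scott_ennreal = UNIV"
  by (metis openin_scott_ennreal openin_subset top.extremum_unique)

lemma topspace_scott_nnreal [simp]: "topspace scott_nnreal = {0..}"
proof
  have "U \<subseteq> {0..}" if "openin scott_nnreal U" for U
    using that unfolding openin_scott_nnreal by (elim disjE exE conjE) auto
  then show "topspace scott_nnreal \<subseteq> {0..}" using openin_topspace by blast
  show "{0..} \<subseteq> topspace scott_nnreal" by (rule openin_subset) (simp add: openin_scott_nnreal)
qed


section \<open>Point-continuous valuations\<close>

text \<open>A map \<open>\<O>X \<rightarrow> [0,\<infinity>]\<close> is represented by a function on all sets that vanishes outside the
  open sets, so that equality of valuations is equality of functions.\<close>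

definition valuation :: "'a topology \<Rightarrow> ('a set \<Rightarrow> ennreal) \<Rightarrow> bool" where
  "valuation X \<mu> \<longleftrightarrow>
     (\<forall>U. \<not> openin X U \<longrightarrow> \<mu> U = 0) \<and>
     \<mu> {} = 0 \<and>
     (\<forall>U V. openin X U \<and> openin X V \<and> U \<subseteq> V \<longrightarrow> \<mu> U \<le> \<mu> V) \<and>
     (\<forall>U V. openin X U \<and> openin X V \<longrightarrow> \<mu> U + \<mu> V = \<mu> (U \<union> V) + \<mu> (U \<inter> V))"

text \<open>Here and in \<open>Vp\<close> the whole space has to be inserted into the subbasis: it need not be the
  union of the other subbasic sets, and \<open>topology_generated_by\<close> takes that union as its carrier.\<close>

definition point_topology :: "'a topology \<Rightarrow> 'a set topology" where
  "point_topology X =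
     topology_generated_by
       (insert {U. openin X U} {{U. openin X U \<and> x \<in> U} | x. x \<in> topspace X})"

definition point_continuous_valuation :: "'a topology \<Rightarrow> ('a set \<Rightarrow> ennreal) \<Rightarrow> bool" where
  "point_continuous_valuation X \<mu> \<longleftrightarrow>
     valuation X \<mu> \<and> continuous_map (point_topology X) scott_ennreal \<mu>"

definition Vp :: "'a topology \<Rightarrow> ('a set \<Rightarrow> ennreal) topology" where
  "Vp X =
     topology_generated_by
       (insert {\<mu>. point_continuous_valuation X \<mu>}
          {{\<mu>. point_continuous_valuation X \<mu> \<and> ennreal r < \<mu> U} | U r. openin X U \<and> 0 \<le> r})"

definition dirac :: "'a topology \<Rightarrow> 'a \<Rightarrow> 'a set \<Rightarrow> ennreal" where
  "dirac X x = (\<lambda>U. if openin X U \<and> x \<in> U then 1 else 0)"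

definition val_add :: "('a set \<Rightarrow> ennreal) \<Rightarrow> ('a set \<Rightarrow> ennreal) \<Rightarrow> 'a set \<Rightarrow> ennreal" where
  "val_add \<mu> \<nu> = (\<lambda>U. \<mu> U + \<nu> U)"

definition val_scale :: "real \<Rightarrow> ('a set \<Rightarrow> ennreal) \<Rightarrow> 'a set \<Rightarrow> ennreal" where
  "val_scale r \<mu> = (\<lambda>U. ennreal r * \<mu> U)"

text \<open>The integrand \<open>r \<mapsto> \<mu>(h\<^sup>-\<^sup>1((r,\<infinity>]))\<close> is antitone with values in \<open>[0,\<infinity>]\<close>, and the
  integral over \<open>[0,\<infinity>)\<close> of such a function is the limit of its Riemann sums; see
  \<open>val_integral_eq_Riemann\<close> below.\<close>

definition val_integral :: "'a topology \<Rightarrow> ('a \<Rightarrow> ennreal) \<Rightarrow> ('a set \<Rightarrow> ennreal) \<Rightarrow> ennreal" where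
  "val_integral X h \<mu> =
     (\<integral>\<^sup>+r\<in>{0..}. \<mu> {x \<in> topspace X. ennreal r < h x} \<partial>lborel)"

lemma topspace_point_topology [simp]: "topspace (point_topology X) = {U. openin X U}"
  unfolding point_topology_def topology_generated_by_topspace by auto

lemma topspace_Vp [simp]: "topspace (Vp X) = {\<mu>. point_continuous_valuation X \<mu>}"
  unfolding Vp_def topology_generated_by_topspace by auto

lemma dirac_in_Vp:
  assumes "x \<in> topspace X"
  shows "dirac X x \<in> topspace (Vp X)"
proof -
  have "valuation X (dirac X x)"
    unfolding valuation_def dirac_def by (auto simp: openin_Un openin_Int)
  moreover have "continuous_map (point_topology X) scott_ennreal (dirac X x)"
  proof (unfold continuous_map_def, intro conjI allI impI)
    fix W assume "openin scott_ennreal W"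
    have up: "1 \<in> W" if "0 \<in> W"
      using that \<open>openin scott_ennreal W\<close> by (auto simp: openin_scott_ennreal)
    have "{U \<in> topspace (point_topology X). dirac X x U \<in> W} =
        (if 0 \<in> W then {U. openin X U} else if 1 \<in> W then {U. openin X U \<and> x \<in> U} else {})"
      using up by (auto simp: dirac_def split: if_splits)
    also have "openin (point_topology X) \<dots>"
      using assms by (auto simp: point_topology_def intro!: topology_generated_by_Basis)
    finally show "openin (point_topology X) {U \<in> topspace (point_topology X). dirac X x U \<in> W}" .
  qed auto
  ultimately show ?thesis by (simp add: point_continuous_valuation_def)
qed

lemma nn_integral_antimono_eq_Riemann:
  fixes f :: "real \<Rightarrow> ennreal"
  assumes f: "antimono f"
  shows "(\<integral>\<^sup>+r\<in>{0..}. f r \<partial>lborel) =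
         (SUP n. \<Sum>k=1..n * 2 ^ n. f (real k / 2 ^ n) * ennreal (1 / 2 ^ n))"
    (is "?I = (SUP n. ?S n)")
proof (rule antisym)
  define J where "J n i = {real i / 2 ^ n <.. real (Suc i) / 2 ^ n}" for n i
  have J_meas [measurable]: "J n i \<in> sets borel" for n i by (simp add: J_def)
  have emJ: "emeasure lborel (J n i) = ennreal (1 / 2 ^ n)" for n i
    by (simp add: J_def divide_right_mono field_simps)
  have J_uniq: "i = j" if "x \<in> J n i" "x \<in> J n j" for x n i j
  proof -
    have "real i < real (Suc j)" "real j < real (Suc i)"
      using that by (auto simp: J_def field_simps)
    then show ?thesis by linarith
  qed
  have J_ex: "\<exists>i. x \<in> J n i \<and> i < m" if "0 < x" "x \<le> real m / 2 ^ n" for x n m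
  proof -
    let ?c = "\<lceil>x * 2 ^ n\<rceil>"
    have c: "0 < ?c" using that by simp
    define i where "i = nat (?c - 1)"
    have "real i = of_int ?c - 1" using c by (simp add: i_def)
    then have *: "real i < x * 2 ^ n" "x * 2 ^ n \<le> real i + 1" by linarith+
    moreover have "x * 2 ^ n \<le> real m" using that by (simp add: field_simps)
    ultimately have "real i < real m" by linarith
    with * show ?thesis by (intro exI[of _ i]) (auto simp: J_def field_simps)
  qed
  have meas [measurable]: "f \<in> borel_measurable borel"
  proof (rule borel_measurableI_greater)
    fix a
    have "is_interval {x. a < f x}"
      unfolding is_interval_1 by (auto intro: less_le_trans[OF _ antimonoD[OF f]])
    then have "{x. a < f x} \<in> sets borel" by (rule real_interval_borel_measurable)
    then show "{x \<in> space borel. a < f x} \<in> sets borel" by simp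
  qed
  show "(SUP n. ?S n) \<le> ?I"
  proof (rule SUP_least)
    fix n
    have "?S n = (\<Sum>i<n * 2 ^ n. f (real (Suc i) / 2 ^ n) * emeasure lborel (J n i))"
      unfolding emJ
      by (rule sum.reindex_bij_witness[of _ Suc "\<lambda>k. k - 1"]) auto
    also have "\<dots> = (\<integral>\<^sup>+x. (\<Sum>i<n * 2 ^ n. f (real (Suc i) / 2 ^ n) * indicator (J n i) x) \<partial>lborel)"
      by (subst nn_integral_sum) (auto simp: nn_integral_cmult_indicator)
    also have "\<dots> \<le> ?I"
    proof (rule nn_integral_mono)
      fix x :: real
      show "(\<Sum>i<n * 2 ^ n. f (real (Suc i) / 2 ^ n) * indicator (J n i) x) \<le> f x * indicator {0..} x"
      proof (cases "\<exists>j. x \<in> J n j")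
        case True
        then obtain j where j: "x \<in> J n j" by blast
        then have "indicator (J n i) x = (if i = j then 1 else 0 :: ennreal)" for i
          using J_uniq by (auto simp: indicator_def)
        then have "(\<Sum>i<n * 2 ^ n. f (real (Suc i) / 2 ^ n) * indicator (J n i) x)
            = (\<Sum>i<n * 2 ^ n. if i = j then f (real (Suc i) / 2 ^ n) else 0)"
          by (intro sum.cong) auto
        also have "\<dots> \<le> f (real (Suc j) / 2 ^ n)" by (simp add: sum.delta)
        also have "\<dots> \<le> f x" using j by (intro antimonoD[OF f]) (auto simp: J_def)
        also have "0 \<le> real j / 2 ^ n" by simp
        then have "0 \<le> x" using j unfolding J_def by (metis greaterThanAtMost_iff less_imp_le order_trans)
        then have "f x = f x * indicator {0..} x" by simp
        finally show ?thesis .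
      qed auto
    qed
    finally show "?S n \<le> ?I" .
  qed
  define A where "A n = {1 / 2 ^ n <.. real n}" for n
  have A_meas [measurable]: "A n \<in> sets borel" for n by (simp add: A_def)
  have pow: "(1 :: real) / 2 ^ n \<le> 1 / 2 ^ m" if "m \<le> n" for m n :: nat
    using that by (simp add: field_simps power_increasing)
  have A_mono: "A m \<subseteq> A n" if "m \<le> n" for m n
    using that pow[OF that] by (auto simp: A_def)
  have A_lim: "(SUP n. f x * indicator (A n) x) = f x * indicator {0<..} x" for x
  proof (cases "0 < x")
    case True
    obtain m where m: "(1 / 2) ^ m < x" using real_arch_pow_inv[of x "1 / 2"] True by auto
    obtain k where k: "x \<le> real k" using real_arch_simple by blast
    have "x \<in> A (max m k)"
      using m k pow[of m "max m k"] by (auto simp: A_def power_one_over)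
    then have "f x \<le> (SUP n. f x * indicator (A n) x)"
      by (intro SUP_upper2[of "max m k"]) auto
    moreover have "(SUP n. f x * indicator (A n) x) \<le> f x"
      by (intro SUP_least) (auto simp: indicator_def)
    ultimately show ?thesis using True by simp
  next
    case False
    have "x \<notin> A n" for n
    proof
      assume "x \<in> A n"
      then have "1 / 2 ^ n < x" by (simp add: A_def)
      moreover have "(0 :: real) < 1 / 2 ^ n" by simp
      ultimately show False using False by linarith
    qed
    then show ?thesis using False by simp
  qed
  have "?I = (\<integral>\<^sup>+x. f x * indicator {0<..} x \<partial>lborel)"
    using AE_lborel_singleton[of "0 :: real"]
    by (intro nn_integral_cong_AE) (auto elim!: eventually_mono simp: indicator_def)
  also have "\<dots> = (\<integral>\<^sup>+x. (SUP n. f x * indicator (A n) x) \<partial>lborel)"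
    by (simp add: A_lim)
  also have "\<dots> = (SUP n. \<integral>\<^sup>+x. f x * indicator (A n) x \<partial>lborel)"
  proof (rule nn_integral_monotone_convergence_SUP)
    show "incseq (\<lambda>n x. f x * indicator (A n) x)"
      using A_mono by (auto simp: incseq_def le_fun_def indicator_def) 
  qed simp
  also have "\<dots> \<le> (SUP n. ?S n)"
  proof (rule SUP_mono)
    fix n
    have "(\<integral>\<^sup>+x. f x * indicator (A n) x \<partial>lborel)
        \<le> (\<integral>\<^sup>+x. (\<Sum>k=1..n * 2 ^ n. f (real k / 2 ^ n) * indicator (J n k) x) \<partial>lborel)"
    proof (rule nn_integral_mono)
      fix x :: real
      show "f x * indicator (A n) x \<le> (\<Sum>k=1..n * 2 ^ n. f (real k / 2 ^ n) * indicator (J n k) x)"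
      proof (cases "x \<in> A n")
        case True
        then have x: "1 / 2 ^ n < x" "x \<le> real (n * 2 ^ n) / 2 ^ n" by (auto simp: A_def)
        moreover have "(0 :: real) < 1 / 2 ^ n" by simp
        ultimately have "0 < x" by linarith
        then obtain i where i: "x \<in> J n i" "i < n * 2 ^ n" using J_ex x(2) by blast
        have "i \<noteq> 0" using i(1) x(1) by (cases "i = 0") (auto simp: J_def)
        then have mem: "i \<in> {1..n * 2 ^ n}" using i(2) by auto
        have "f x \<le> f (real i / 2 ^ n) * indicator (J n i) x"
          using i(1) antimonoD[OF f, of "real i / 2 ^ n" x] by (auto simp: J_def)
        also have "\<dots> \<le> (\<Sum>k=1..n * 2 ^ n. f (real k / 2 ^ n) * indicator (J n k) x)"
          using mem by (intro member_le_sum) auto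
        finally show ?thesis using True by simp
      qed auto
    qed
    also have "\<dots> = (\<Sum>k=1..n * 2 ^ n. f (real k / 2 ^ n) * emeasure lborel (J n k))"
      by (subst nn_integral_sum) (auto simp: nn_integral_cmult_indicator)
    also have "\<dots> = ?S n" by (simp add: emJ)
    finally show "\<exists>m\<in>UNIV. (\<integral>\<^sup>+x. f x * indicator (A n) x \<partial>lborel) \<le> ?S m" by blast
  qed
  finally show "?I \<le> (SUP n. ?S n)" .
qed

corollary val_integral_eq_Riemann:
  assumes "valuation X \<mu>" "continuous_map X scott_ennreal h"
  shows "val_integral X h \<mu> =
         (SUP n. \<Sum>k=1..n * 2 ^ n.
            \<mu> {x \<in> topspace X. ennreal (real k / 2 ^ n) < h x} * ennreal (1 / 2 ^ n))"
  unfolding val_integral_def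
proof (rule nn_integral_antimono_eq_Riemann, rule antimonoI)
  have op: "openin X {x \<in> topspace X. ennreal r < h x}" for r
  proof -
    have "openin scott_ennreal {ennreal (max r 0)<..}"
      unfolding openin_scott_ennreal by (metis max.cobounded2)
    then have "openin scott_ennreal {ennreal r<..}"
      by (cases "0 \<le> r") (simp_all add: ennreal_neg)
    then have "openin X {x \<in> topspace X. h x \<in> {ennreal r<..}}"
      using assms(2) unfolding continuous_map_def by blast
    then show ?thesis by simp
  qed
  have mono: "\<mu> U \<le> \<mu> V" if "openin X U" "openin X V" "U \<subseteq> V" for U V
    using assms(1) that unfolding valuation_def by simp
  fix r s :: real
  assume "r \<le> s"
  then have "ennreal r \<le> ennreal s" by (rule ennreal_leI)
  then have "{x \<in> topspace X. ennreal s < h x} \<subseteq> {x \<in> topspace X. ennreal r < h x}"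
    by (auto intro: le_less_trans)
  then show "\<mu> {x \<in> topspace X. ennreal s < h x} \<le> \<mu> {x \<in> topspace X. ennreal r < h x}"
    by (intro mono op)
qed


section \<open>The monad and its algebras\<close>

definition Vp_map :: "'a topology \<Rightarrow> 'b topology \<Rightarrow> ('a \<Rightarrow> 'b) \<Rightarrow> ('a set \<Rightarrow> ennreal) \<Rightarrow> 'b set \<Rightarrow> ennreal" where
  "Vp_map X Y f \<mu> = (\<lambda>V. if openin Y V then \<mu> {x \<in> topspace X. f x \<in> V} else 0)"

definition Vp_mult :: "'a topology \<Rightarrow> (('a set \<Rightarrow> ennreal) set \<Rightarrow> ennreal) \<Rightarrow> 'a set \<Rightarrow> ennreal" where
  "Vp_mult X \<omega> = (\<lambda>U. if openin X U then val_integral (Vp X) (\<lambda>\<mu>. \<mu> U) \<omega> else 0)"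

definition Vp_algebra :: "'a topology \<Rightarrow> (('a set \<Rightarrow> ennreal) \<Rightarrow> 'a) \<Rightarrow> bool" where
  "Vp_algebra X \<alpha> \<longleftrightarrow>
     t0_space X \<and>
     continuous_map (Vp X) X \<alpha> \<and>
     (\<forall>x\<in>topspace X. \<alpha> (dirac X x) = x) \<and>
     (\<forall>\<omega>\<in>topspace (Vp (Vp X)). \<alpha> (Vp_mult X \<omega>) = \<alpha> (Vp_map (Vp X) X \<alpha> \<omega>))"


section \<open>Sober spaces\<close>

definition irreducible_closed :: "'a topology \<Rightarrow> 'a set \<Rightarrow> bool" where
  "irreducible_closed X F \<longleftrightarrow>
     closedin X F \<and> F \<noteq> {} \<and>
     (\<forall>A B. closedin X A \<and> closedin X B \<and> F \<subseteq> A \<union> B \<longrightarrow> F \<subseteq> A \<or> F \<subseteq> B)"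

definition sober_space :: "'a topology \<Rightarrow> bool" where
  "sober_space X \<longleftrightarrow>
     (\<forall>F. irreducible_closed X F \<longrightarrow> (\<exists>!x. x \<in> topspace X \<and> F = X closure_of {x}))"


section \<open>Topological cones\<close>

locale abstract_cone =
  fixes C :: "'a set"
    and add :: "'a \<Rightarrow> 'a \<Rightarrow> 'a"
    and zero :: 'a
    and smul :: "real \<Rightarrow> 'a \<Rightarrow> 'a"
  assumes add_closed: "\<lbrakk>x \<in> C; y \<in> C\<rbrakk> \<Longrightarrow> add x y \<in> C"
    and zero_closed: "zero \<in> C"
    and smul_closed: "\<lbrakk>0 \<le> r; x \<in> C\<rbrakk> \<Longrightarrow> smul r x \<in> C"
    and add_assoc: "\<lbrakk>x \<in> C; y \<in> C; z \<in> C\<rbrakk> \<Longrightarrow> add (add x y) z = add x (add y z)"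
    and add_commute: "\<lbrakk>x \<in> C; y \<in> C\<rbrakk> \<Longrightarrow> add x y = add y x"
    and add_zero: "x \<in> C \<Longrightarrow> add zero x = x"
    and smul_add_right: "\<lbrakk>0 \<le> r; x \<in> C; y \<in> C\<rbrakk> \<Longrightarrow> smul r (add x y) = add (smul r x) (smul r y)"
    and smul_add_left: "\<lbrakk>0 \<le> r; 0 \<le> s; x \<in> C\<rbrakk> \<Longrightarrow> smul (r + s) x = add (smul r x) (smul s x)"
    and smul_smul: "\<lbrakk>0 \<le> r; 0 \<le> s; x \<in> C\<rbrakk> \<Longrightarrow> smul (r * s) x = smul r (smul s x)"
    and smul_one: "x \<in> C \<Longrightarrow> smul 1 x = x"
    and smul_zero_left: "x \<in> C \<Longrightarrow> smul 0 x = zero"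
    and smul_zero_right: "0 \<le> r \<Longrightarrow> smul r zero = zero"

definition topological_cone ::
  "'a topology \<Rightarrow> ('a \<Rightarrow> 'a \<Rightarrow> 'a) \<Rightarrow> 'a \<Rightarrow> (real \<Rightarrow> 'a \<Rightarrow> 'a) \<Rightarrow> bool" where
  "topological_cone C add zero smul \<longleftrightarrow>
     abstract_cone (topspace C) add zero smul \<and>
     t0_space C \<and>
     continuous_map (prod_topology C C) C (\<lambda>(x, y). add x y) \<and>
     continuous_map (prod_topology scott_nnreal C) C (\<lambda>(r, x). smul r x)"

definition cone_convex :: "('a \<Rightarrow> 'a \<Rightarrow> 'a) \<Rightarrow> (real \<Rightarrow> 'a \<Rightarrow> 'a) \<Rightarrow> 'a set \<Rightarrow> bool" where
  "cone_convex add smul A \<longleftrightarrow>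
     (\<forall>a\<in>A. \<forall>b\<in>A. \<forall>r\<in>{0..1}. add (smul r a) (smul (1 - r) b) \<in> A)"

definition weakly_locally_convex ::
  "'a topology \<Rightarrow> ('a \<Rightarrow> 'a \<Rightarrow> 'a) \<Rightarrow> (real \<Rightarrow> 'a \<Rightarrow> 'a) \<Rightarrow> bool" where
  "weakly_locally_convex C add smul \<longleftrightarrow>
     (\<forall>x U. openin C U \<and> x \<in> U \<longrightarrow>
        (\<exists>A V. cone_convex add smul A \<and> openin C V \<and> x \<in> V \<and> V \<subseteq> A \<and> A \<subseteq> U))"

definition wlc_sober_topological_cone ::
  "'a topology \<Rightarrow> ('a \<Rightarrow> 'a \<Rightarrow> 'a) \<Rightarrow> 'a \<Rightarrow> (real \<Rightarrow> 'a \<Rightarrow> 'a) \<Rightarrow> bool" where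
  "wlc_sober_topological_cone C add zero smul \<longleftrightarrow>
     topological_cone C add zero smul \<and> weakly_locally_convex C add smul \<and> sober_space C"

definition linear_between ::
  "'a set \<Rightarrow> ('a \<Rightarrow> 'a \<Rightarrow> 'a) \<Rightarrow> (real \<Rightarrow> 'a \<Rightarrow> 'a) \<Rightarrow>
   'b set \<Rightarrow> ('b \<Rightarrow> 'b \<Rightarrow> 'b) \<Rightarrow> (real \<Rightarrow> 'b \<Rightarrow> 'b) \<Rightarrow> ('a \<Rightarrow> 'b) \<Rightarrow> bool" where
  "linear_between C addC scaleC D addD scaleD f \<longleftrightarrow>
     f \<in> C \<rightarrow> D \<and>
     (\<forall>x\<in>C. \<forall>y\<in>C. \<forall>r\<ge>0. \<forall>s\<ge>0.
        f (addC (scaleC r x) (scaleC s y)) = addD (scaleD r (f x)) (scaleD s (f y)))"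

abbreviation linear_functional ::
  "'a set \<Rightarrow> ('a \<Rightarrow> 'a \<Rightarrow> 'a) \<Rightarrow> (real \<Rightarrow> 'a \<Rightarrow> 'a) \<Rightarrow> ('a \<Rightarrow> ennreal) \<Rightarrow> bool" where
  "linear_functional C add smul \<equiv>
     linear_between C add smul UNIV (+) (\<lambda>r t. ennreal r * t)"

abbreviation linear_on_Vp ::
  "'a topology \<Rightarrow> ('a \<Rightarrow> 'a \<Rightarrow> 'a) \<Rightarrow> (real \<Rightarrow> 'a \<Rightarrow> 'a) \<Rightarrow> (('a set \<Rightarrow> ennreal) \<Rightarrow> 'a) \<Rightarrow> bool" where
  "linear_on_Vp X add smul \<equiv>
     linear_between (topspace (Vp X)) val_add val_scale (topspace X) add smul"

definition barycentre ::
  "'a topology \<Rightarrow> ('a \<Rightarrow> 'a \<Rightarrow> 'a) \<Rightarrow> (real \<Rightarrow> 'a \<Rightarrow> 'a) \<Rightarrow> ('a set \<Rightarrow> ennreal) \<Rightarrow> 'a \<Rightarrow> bool" where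
  "barycentre C add smul \<nu> b \<longleftrightarrow>
     b \<in> topspace C \<and>
     (\<forall>\<Lambda>. linear_functional (topspace C) add smul \<Lambda> \<and> continuous_map C scott_ennreal \<Lambda>
        \<longrightarrow> \<Lambda> b = val_integral C \<Lambda> \<nu>)"

end

theory Submission
  imports Defs
begin

text \<open>The key fact is a density theorem: if a point-continuous valuation \<open>\<nu>\<close> lies in an open subset of
  \<open>Vp X\<close>, then so does some simple valuation below \<open>\<nu>\<close>. Hence linear continuous maps out of \<open>Vp X\<close>
  into a \<open>T\<^sub>0\<close> space are determined by their values on Dirac masses. This uniqueness principle yields the
  additivity of the integral, the barycentre property of algebras and the algebra laws of a linear
  retraction. For an algebra, the cone structure is inherited from \<open>Vp X\<close> along \<open>\<alpha>\<close>. For a weakly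
  locally convex sober cone, the barycentre \<open>\<Sum> r\<^sub>i x\<^sub>i\<close> of a simple valuation depends continuously on it,
  by a transportation argument, and the barycentre of \<open>\<nu>\<close> is the generic point of the closure of the
  barycentres of the simple valuations below \<open>\<nu>\<close>.\<close>

section \<open>Lower semicontinuous maps and neighbourhoods\<close>

text \<open>Valuations may be infinite, so differences are not freely available. Truncating at a
  finite level restores real arithmetic but turns modularity into submodularity; that inequality is
  exactly what keeps greedily chosen weights below the given valuation. Subtraction occurs only for
  open sets of finite measure, and infinite measure leaves room for scaling.

  Approximation from below matters, not mere density: open sets of \<open>Vp X\<close> are upward
  closed, so an open condition met by a simple valuation below \<nu> is also met by \<nu>. No
  directedness of these simple valuations is established, hence no supremum is formed; two open
  conditions are met by one simple valuation, which is irreducibility, and sobriety turns this into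
  a point.

  On a cone, the inequalities r < \<mu>(U) that describe neighbourhoods in \<open>Vp C\<close> play
  the part of Hall's condition. Scott openness supplies slack: the scalars in a finite sum can be
  lowered slightly without leaving an open set, which makes Hall's condition strict and hence
  open.\<close>

lemma continuous_map_scott_ennreal_iff:
  "continuous_map Y scott_ennreal f \<longleftrightarrow>
     (\<forall>r\<ge>0. openin Y {y \<in> topspace Y. ennreal r < f y})" (is "?L \<longleftrightarrow> ?R")
proof
  assume L: ?L
  show ?R
  proof (intro allI impI)
    fix r :: real assume "0 \<le> r"
    then have "openin scott_ennreal {ennreal r<..}" by (auto simp: openin_scott_ennreal)
    then have "openin Y {y \<in> topspace Y. f y \<in> {ennreal r<..}}"
      using L unfolding continuous_map_def by blast
    then show "openin Y {y \<in> topspace Y. ennreal r < f y}" by simp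
  qed
next
  assume R: ?R
  show ?L unfolding continuous_map_def
  proof (intro conjI allI impI)
    fix W assume "openin scott_ennreal W"
    then consider "W = {}" | "W = UNIV" | r where "0 \<le> r" "W = {ennreal r<..}"
      unfolding openin_scott_ennreal by blast
    then show "openin Y {y \<in> topspace Y. f y \<in> W}" by cases (use R in auto)
  qed auto
qed

lemma openin_lsc:
  assumes "continuous_map Y scott_ennreal f"
  shows "openin Y {y \<in> topspace Y. ennreal r < f y}"
proof (cases "0 \<le> r")
  case True then show ?thesis using assms continuous_map_scott_ennreal_iff by blast
next
  case False
  then have "ennreal r = ennreal 0" by (simp add: ennreal_neg)
  then show ?thesis using assms continuous_map_scott_ennreal_iff by (metis order_refl)
qed

text \<open>A superlevel set of a sum thereby becomes a union of intersections of superlevel sets at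
  nonnegative levels. The first two alternatives cover a vanishing summand, below which no
  nonnegative level lies strictly.\<close>

lemma ennreal_less_add_iff:
  fixes x y :: ennreal
  assumes "0 \<le> r"
  shows "ennreal r < x + y \<longleftrightarrow> ennreal r < x \<or> ennreal r < y \<or>
     (\<exists>a b. 0 \<le> a \<and> 0 \<le> b \<and> r \<le> a + b \<and> ennreal a < x \<and> ennreal b < y)" (is "?L \<longleftrightarrow> ?R")
proof
  assume L: ?L
  show ?R
  proof (cases x)
    case (real u)
    show ?thesis
    proof (cases y)
      case (real v)
      have uv: "r < u + v" using L \<open>x = ennreal u\<close> real \<open>0 \<le> u\<close>
        by (simp add: ennreal_less_iff assms flip: ennreal_plus)
      show ?thesis
      proof (cases "u = 0 \<or> v = 0")
        case True
        then show ?thesis using uv \<open>x = ennreal u\<close> real by (auto simp: ennreal_less_iff assms)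
      next
        case False
        \<comment> \<open>Each summand gives up half of the excess over \<open>r\<close>; truncation
          at 0 only raises the levels, and strictness survives because \<open>u\<close> and
          \<open>v\<close> are positive.\<close>
        define d where "d = (u + v - r) / 2"
        have d: "d > 0" using uv by (simp add: d_def)
        define a b where "a = max 0 (u - d)" and "b = max 0 (v - d)"
        have "0 \<le> a" "0 \<le> b" "a < u" "b < v" "r \<le> a + b"
          using False d \<open>0 \<le> u\<close> \<open>0 \<le> v\<close> by (auto simp: a_def b_def d_def max_def field_simps)
        then show ?thesis using \<open>x = ennreal u\<close> real
          by (metis ennreal_less_iff)
      qed
    next
      case top then show ?thesis by simp
    qed
  next
    case top then show ?thesis by simp
  qed
next
  assume ?R
  then consider "ennreal r < x" | "ennreal r < y"
    | a b where "0 \<le> a" "0 \<le> b" "r \<le> a + b" "ennreal a < x" "ennreal b < y" by blast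
  then show ?L
  proof cases
    case 1 then show ?thesis by (metis add.right_neutral add_left_mono less_le_trans zero_le)
  next
    case 2 then show ?thesis by (metis add.left_neutral add_right_mono less_le_trans zero_le)
  next
    case 3
    then have "ennreal r \<le> ennreal a + ennreal b" by (simp flip: ennreal_plus add: ennreal_leI)
    also have "\<dots> < x + y" using 3 by (intro add_strict_mono)
    finally show ?thesis .
  qed
qed

lemma lsc_add:
  assumes f: "continuous_map Y scott_ennreal f" and g: "continuous_map Y scott_ennreal g"
  shows "continuous_map Y scott_ennreal (\<lambda>y. f y + g y)"
  unfolding continuous_map_scott_ennreal_iff
proof (intro allI impI)
  fix r :: real assume r: "0 \<le> r"
  let ?A = "\<lambda>a. {y \<in> topspace Y. ennreal a < f y}" and ?B = "\<lambda>b. {y \<in> topspace Y. ennreal b < g y}"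
  have "{y \<in> topspace Y. ennreal r < f y + g y}
     = ?A r \<union> ?B r \<union> \<Union>{?A a \<inter> ?B b | a b. 0 \<le> a \<and> 0 \<le> b \<and> r \<le> a + b}"
    unfolding ennreal_less_add_iff[OF r] by blast
  moreover have "openin Y \<dots>"
    using openin_lsc[OF f] openin_lsc[OF g] by (intro openin_Un openin_Union) auto
  ultimately show "openin Y {y \<in> topspace Y. ennreal r < f y + g y}" by simp
qed

lemma lsc_const: "continuous_map Y scott_ennreal (\<lambda>y. c)"
  by (auto simp: continuous_map_const)

lemma lsc_cmult:
  assumes f: "continuous_map Y scott_ennreal f"
  shows "continuous_map Y scott_ennreal (\<lambda>y. ennreal c * f y)"
proof (cases "c \<le> 0")
  case True
  then show ?thesis by (simp add: ennreal_neg lsc_const)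
next
  case False
  then have *: "ennreal r < ennreal c * t \<longleftrightarrow> ennreal (r / c) < t" if "0 \<le> r" for r t
  proof (cases t)
    case (real u)
    then show ?thesis using that False
      by (simp add: ennreal_mult'[symmetric] ennreal_less_iff field_simps)
  next
    case top then show ?thesis using False by (simp add: ennreal_mult_top)
  qed
  show ?thesis unfolding continuous_map_scott_ennreal_iff using openin_lsc[OF f] by (simp add: *)
qed

lemma lsc_sum:
  assumes "\<And>i. i \<in> I \<Longrightarrow> continuous_map Y scott_ennreal (f i)"
  shows "continuous_map Y scott_ennreal (\<lambda>y. \<Sum>i\<in>I. f i y)"
  using assms by (induction I rule: infinite_finite_induct) (auto simp: lsc_const intro!: lsc_add)

section \<open>Finite neighbourhood conditions in the point topology\<close>

lemma point_topology_nhd: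
  assumes W: "openin (point_topology X) W" and "U \<in> W"
  shows "\<exists>F. finite F \<and> F \<subseteq> U \<and> (\<forall>V. openin X V \<and> F \<subseteq> V \<longrightarrow> V \<in> W)"
proof -
  have "generate_topology_on
     (insert {U. openin X U} {{U. openin X U \<and> x \<in> U} | x. x \<in> topspace X}) W"
    using W unfolding point_topology_def openin_topology_generated_by_iff .
  then have "\<forall>U\<in>W. \<exists>F. finite F \<and> F \<subseteq> U \<and> (\<forall>V. openin X V \<and> F \<subseteq> V \<longrightarrow> V \<in> W)"
  proof induction
    case (Int a b)
    show ?case
    proof
      fix U assume "U \<in> a \<inter> b"
      then obtain F G where "finite F" "F \<subseteq> U" "\<forall>V. openin X V \<and> F \<subseteq> V \<longrightarrow> V \<in> a"
        "finite G" "G \<subseteq> U" "\<forall>V. openin X V \<and> G \<subseteq> V \<longrightarrow> V \<in> b" using Int by (metis IntD1 IntD2)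
      then show "\<exists>F. finite F \<and> F \<subseteq> U \<and> (\<forall>V. openin X V \<and> F \<subseteq> V \<longrightarrow> V \<in> a \<inter> b)"
        by (intro exI[of _ "F \<union> G"]) auto
    qed
  next
    case (UN K)
    show ?case
    proof
      fix U assume "U \<in> \<Union>K"
      then obtain k where "k \<in> K" "U \<in> k" by blast
      then obtain F where "finite F" "F \<subseteq> U" "\<forall>V. openin X V \<and> F \<subseteq> V \<longrightarrow> V \<in> k" using UN by meson
      then show "\<exists>F. finite F \<and> F \<subseteq> U \<and> (\<forall>V. openin X V \<and> F \<subseteq> V \<longrightarrow> V \<in> \<Union>K)"
        using \<open>k \<in> K\<close> by blast
    qed
  next
    case (Basis s)
    then consider "s = {U. openin X U}" | x where "s = {U. openin X U \<and> x \<in> U}" by blast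
    then show ?case
    proof cases
      case 1 then show ?thesis by (auto intro!: exI[of _ "{}"])
    next
      case 2 then show ?thesis by (auto intro!: exI[of _ "{x}"])
    qed
  qed simp
  then show ?thesis using \<open>U \<in> W\<close> by blast
qed

lemma openin_point_topology_superset:
  assumes "finite F" "F \<subseteq> topspace X"
  shows "openin (point_topology X) {U. openin X U \<and> F \<subseteq> U}"
  using assms
proof (induction F)
  case empty
  then show ?case by (auto simp: point_topology_def intro!: topology_generated_by_Basis)
next
  case (insert x F)
  have "openin (point_topology X) {U. openin X U \<and> x \<in> U}"
    unfolding point_topology_def by (rule topology_generated_by_Basis) (use insert in auto)
  then have "openin (point_topology X) ({U. openin X U \<and> x \<in> U} \<inter> {U. openin X U \<and> F \<subseteq> U})"
    using insert by (intro openin_Int) auto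
  moreover have "\<dots> = {U. openin X U \<and> insert x F \<subseteq> U}" by auto
  ultimately show ?case by simp
qed

text \<open>Basic neighbourhoods of \<open>U\<close> in the point topology consist of the open
  supersets of a finite subset of \<open>U\<close>. This gives the working form of point-continuity:
  finitely many points of \<open>U\<close> force a lower bound on the mass of every open set around
  them.\<close>

lemma continuous_map_point_topology_iff:
  "continuous_map (point_topology X) scott_ennreal \<mu> \<longleftrightarrow>
     (\<forall>U r. openin X U \<and> 0 \<le> r \<and> ennreal r < \<mu> U \<longrightarrow>
        (\<exists>F. finite F \<and> F \<subseteq> U \<and> (\<forall>V. openin X V \<and> F \<subseteq> V \<longrightarrow> ennreal r < \<mu> V)))" (is "?L \<longleftrightarrow> ?R")
proof
  assume L: ?L
  show ?R
  proof (intro allI impI, elim conjE)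
    fix U r assume "openin X U" "0 \<le> r" "ennreal r < \<mu> U"
    then have "U \<in> {U \<in> topspace (point_topology X). ennreal r < \<mu> U}" by simp
    from point_topology_nhd[OF openin_lsc[OF L, of r] this]
    show "\<exists>F. finite F \<and> F \<subseteq> U \<and> (\<forall>V. openin X V \<and> F \<subseteq> V \<longrightarrow> ennreal r < \<mu> V)"
      by simp
  qed
next
  assume R: ?R
  show ?L unfolding continuous_map_scott_ennreal_iff
  proof (intro allI impI)
    fix r :: real assume "0 \<le> r"
    have "\<exists>T. openin (point_topology X) T \<and> U \<in> T \<and> T \<subseteq> {U \<in> topspace (point_topology X). ennreal r < \<mu> U}"
      if U: "U \<in> {U \<in> topspace (point_topology X). ennreal r < \<mu> U}" for U
    proof -
      obtain F where F: "finite F" "F \<subseteq> U" "\<forall>V. openin X V \<and> F \<subseteq> V \<longrightarrow> ennreal r < \<mu> V"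
        using R[rule_format, of U r] U \<open>0 \<le> r\<close> by auto
      have "F \<subseteq> topspace X" using F U openin_subset by fastforce
      then show ?thesis using F U openin_point_topology_superset[OF F(1)]
        by (intro exI[of _ "{U. openin X U \<and> F \<subseteq> U}"]) auto
    qed
    then show "openin (point_topology X) {U \<in> topspace (point_topology X). ennreal r < \<mu> U}"
      using openin_subopen by blast
  qed
qed

section \<open>Valuations and their linear combinations\<close>

lemma valuation_mono: "valuation X \<mu> \<Longrightarrow> openin X U \<Longrightarrow> openin X V \<Longrightarrow> U \<subseteq> V \<Longrightarrow> \<mu> U \<le> \<mu> V"
  by (simp add: valuation_def)

lemma valuation_modular:
  "valuation X \<mu> \<Longrightarrow> openin X U \<Longrightarrow> openin X V \<Longrightarrow> \<mu> U + \<mu> V = \<mu> (U \<union> V) + \<mu> (U \<inter> V)"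
  by (simp add: valuation_def)

lemma valuation_empty: "valuation X \<mu> \<Longrightarrow> \<mu> {} = 0"
  by (simp add: valuation_def)

lemma valuation_not_open: "valuation X \<mu> \<Longrightarrow> \<not> openin X U \<Longrightarrow> \<mu> U = 0"
  by (simp add: valuation_def)

lemma point_continuous_valuation_nhd:
  assumes "point_continuous_valuation X \<mu>" "openin X U" "0 \<le> r" "ennreal r < \<mu> U"
  shows "\<exists>F. finite F \<and> F \<subseteq> U \<and> (\<forall>V. openin X V \<and> F \<subseteq> V \<longrightarrow> ennreal r < \<mu> V)"
  using assms unfolding point_continuous_valuation_def continuous_map_point_topology_iff by blast

lemma valuation_lin:
  assumes "valuation X \<mu>" "valuation X \<nu>"
  shows "valuation X (\<lambda>U. ennreal r * \<mu> U + ennreal s * \<nu> U)"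
  unfolding valuation_def
proof (intro conjI allI impI; (elim conjE)?)
  fix U V assume UV: "openin X U" "openin X V"
  have "ennreal r * \<mu> U + ennreal s * \<nu> U + (ennreal r * \<mu> V + ennreal s * \<nu> V)
      = ennreal r * (\<mu> U + \<mu> V) + ennreal s * (\<nu> U + \<nu> V)"
    by (simp add: algebra_simps)
  also have "\<dots> = ennreal r * (\<mu> (U \<union> V) + \<mu> (U \<inter> V)) + ennreal s * (\<nu> (U \<union> V) + \<nu> (U \<inter> V))"
    using UV assms by (simp add: valuation_modular[of X])
  also have "\<dots> = ennreal r * \<mu> (U \<union> V) + ennreal s * \<nu> (U \<union> V) +
      (ennreal r * \<mu> (U \<inter> V) + ennreal s * \<nu> (U \<inter> V))"
    by (simp add: algebra_simps)
  finally show "ennreal r * \<mu> U + ennreal s * \<nu> U + (ennreal r * \<mu> V + ennreal s * \<nu> V) = \<dots>" .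
qed (use assms in \<open>auto simp: valuation_def intro!: add_mono mult_left_mono\<close>)

lemma point_continuous_valuation_lin:
  assumes "point_continuous_valuation X \<mu>" "point_continuous_valuation X \<nu>"
  shows "point_continuous_valuation X (val_add (val_scale r \<mu>) (val_scale s \<nu>))"
  using assms valuation_lin[of X \<mu> \<nu> r s]
  unfolding point_continuous_valuation_def val_add_def val_scale_def
  by (auto intro: lsc_add lsc_cmult)

lemma val_scale_one [simp]: "val_scale 1 \<mu> = \<mu>"
  by (simp add: val_scale_def)

lemma point_continuous_valuation_add:
  assumes "point_continuous_valuation X \<mu>" "point_continuous_valuation X \<nu>"
  shows "point_continuous_valuation X (val_add \<mu> \<nu>)"
  using point_continuous_valuation_lin[OF assms, of 1 1] by simp

lemma point_continuous_valuation_scale: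
  assumes "point_continuous_valuation X \<mu>"
  shows "point_continuous_valuation X (val_scale r \<mu>)"
  using point_continuous_valuation_lin[OF assms assms, of r 0] by (simp add: val_add_def val_scale_def)

lemma point_continuous_valuation_dirac: "x \<in> topspace X \<Longrightarrow> point_continuous_valuation X (dirac X x)"
  using dirac_in_Vp by fastforce

section \<open>The weak topology on valuations\<close>

lemma openin_Vp_subbasic:
  "openin X U \<Longrightarrow> 0 \<le> r \<Longrightarrow> openin (Vp X) {\<mu>. point_continuous_valuation X \<mu> \<and> ennreal r < \<mu> U}"
  unfolding Vp_def by (rule topology_generated_by_Basis) auto

lemma Vp_nhd:
  assumes W: "openin (Vp X) W" and "\<nu> \<in> W"
  shows "\<exists>P. finite P \<and> (\<forall>(U, r)\<in>P. openin X U \<and> 0 \<le> r \<and> ennreal r < \<nu> U) \<and>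
     (\<forall>\<mu>. point_continuous_valuation X \<mu> \<and> (\<forall>(U, r)\<in>P. ennreal r < \<mu> U) \<longrightarrow> \<mu> \<in> W)"
proof -
  define Q where "Q W \<nu> P \<longleftrightarrow> finite P \<and> (\<forall>(U, r)\<in>P. openin X U \<and> 0 \<le> r \<and> ennreal r < \<nu> U) \<and>
     (\<forall>\<mu>. point_continuous_valuation X \<mu> \<and> (\<forall>(U, r)\<in>P. ennreal r < \<mu> U) \<longrightarrow> \<mu> \<in> W)"
    for W \<nu> P
  have Q_Int: "Q (a \<inter> b) \<nu> (F \<union> G)" if "Q a \<nu> F" "Q b \<nu> G" for a b \<nu> F G
    using that unfolding Q_def by (simp add: ball_Un)
  have Q_mono: "Q b \<nu> F" if "Q a \<nu> F" "a \<subseteq> b" for a b \<nu> F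
    using that unfolding Q_def by blast
  have "generate_topology_on (insert {\<mu>. point_continuous_valuation X \<mu>}
          {{\<mu>. point_continuous_valuation X \<mu> \<and> ennreal r < \<mu> U} | U r. openin X U \<and> 0 \<le> r}) W"
    using W unfolding Vp_def openin_topology_generated_by_iff .
  then have "\<forall>\<nu>\<in>W. \<exists>P. Q W \<nu> P"
  proof induction
    case (Int a b)
    then show ?case using Q_Int by (meson IntD1 IntD2)
  next
    case (UN K)
    then show ?case using Q_mono by (meson Union_upper UnionE)
  next
    case (Basis s)
    then consider "s = {\<mu>. point_continuous_valuation X \<mu>}"
      | U r where "openin X U" "0 \<le> r" "s = {\<mu>. point_continuous_valuation X \<mu> \<and> ennreal r < \<mu> U}" by blast
    then show ?case
    proof cases
      case 1 then show ?thesis by (auto simp: Q_def intro!: exI[of _ "{}"])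
    next
      case 2 then show ?thesis by (auto simp: Q_def intro!: exI[of _ "{(U, r)}"])
    qed
  qed simp
  then show ?thesis using \<open>\<nu> \<in> W\<close> unfolding Q_def by blast
qed

text \<open>All basic conditions r < \<mu>(U) are preserved by increasing \<mu>. This is the way
  back from a simple valuation below \<nu> to \<nu> itself.\<close>

lemma Vp_upward_closed:
  assumes W: "openin (Vp X) W" and "\<mu> \<in> W" "\<mu> \<le> \<nu>" "point_continuous_valuation X \<nu>"
  shows "\<nu> \<in> W"
proof -
  obtain P where P: "\<forall>(U, r)\<in>P. openin X U \<and> 0 \<le> r \<and> ennreal r < \<mu> U"
    "\<forall>\<nu>. point_continuous_valuation X \<nu> \<and> (\<forall>(U, r)\<in>P. ennreal r < \<nu> U) \<longrightarrow> \<nu> \<in> W"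
    using Vp_nhd[OF W \<open>\<mu> \<in> W\<close>] by blast
  have "\<forall>(U, r)\<in>P. ennreal r < \<nu> U"
    using P(1) \<open>\<mu> \<le> \<nu>\<close> by (auto dest: le_funD intro: less_le_trans)
  then show ?thesis using P(2) assms(4) by blast
qed

lemma openin_Vp_finite:
  assumes "finite P" "\<And>U r. (U, r) \<in> P \<Longrightarrow> openin X U \<and> 0 \<le> r"
  shows "openin (Vp X) {\<mu>. point_continuous_valuation X \<mu> \<and> (\<forall>(U, r)\<in>P. ennreal r < \<mu> U)}"
  using assms
proof (induction P)
  case empty
  then show ?case unfolding Vp_def by (auto intro!: topology_generated_by_Basis)
next
  case (insert p P)
  obtain U r where p: "p = (U, r)" by (cases p)
  have "openin (Vp X) ({\<mu>. point_continuous_valuation X \<mu> \<and> ennreal r < \<mu> U} \<inter>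
      {\<mu>. point_continuous_valuation X \<mu> \<and> (\<forall>(U, r)\<in>P. ennreal r < \<mu> U)})"
    using insert p by (intro openin_Int openin_Vp_subbasic) auto
  moreover have "\<dots> = {\<mu>. point_continuous_valuation X \<mu> \<and> (\<forall>(U, r)\<in>insert p P. ennreal r < \<mu> U)}"
    using p by auto
  ultimately show ?case by simp
qed

lemma lsc_eval: "openin X U \<Longrightarrow> continuous_map (Vp X) scott_ennreal (\<lambda>\<mu>. \<mu> U)"
  unfolding continuous_map_scott_ennreal_iff by (simp add: openin_Vp_subbasic)

lemma continuous_map_into_Vp:
  assumes "\<And>y. y \<in> topspace Y \<Longrightarrow> point_continuous_valuation X (f y)"
    and "\<And>U. openin X U \<Longrightarrow> continuous_map Y scott_ennreal (\<lambda>y. f y U)"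
  shows "continuous_map Y (Vp X) f"
  unfolding Vp_def
proof (rule continuous_on_generated_topo)
  fix W assume "W \<in> insert {\<mu>. point_continuous_valuation X \<mu>}
          {{\<mu>. point_continuous_valuation X \<mu> \<and> ennreal r < \<mu> U} | U r. openin X U \<and> 0 \<le> r}"
  then consider "W = {\<mu>. point_continuous_valuation X \<mu>}"
    | U r where "openin X U" "0 \<le> r" "W = {\<mu>. point_continuous_valuation X \<mu> \<and> ennreal r < \<mu> U}" by blast
  then show "openin Y (f -` W \<inter> topspace Y)"
  proof cases
    case 1
    then have "f -` W \<inter> topspace Y = topspace Y" using assms(1) by auto
    then show ?thesis by simp
  next
    case 2
    then have "f -` W \<inter> topspace Y = {y \<in> topspace Y. ennreal r < f y U}" using assms(1) by auto
    then show ?thesis using openin_lsc[OF assms(2)] 2 by simp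
  qed
qed (use assms(1) in auto)

lemma t0_space_eqI:
  assumes "t0_space Y" "x \<in> topspace Y" "y \<in> topspace Y"
    and "\<And>W. openin Y W \<Longrightarrow> x \<in> W \<longleftrightarrow> y \<in> W"
  shows "x = y"
  using assms unfolding t0_space_def by blast

section \<open>Simple valuations\<close>

text \<open>Real weights of finite support parametrise the simple valuations, so that linear
  combinations are formed pointwise on weights and subtraction remains possible.\<close>

definition weight :: "'a topology \<Rightarrow> ('a \<Rightarrow> real) \<Rightarrow> bool" where
  "weight X w \<longleftrightarrow> (\<forall>x. 0 \<le> w x) \<and> finite {x. w x \<noteq> 0} \<and> {x. w x \<noteq> 0} \<subseteq> topspace X"

text \<open>The sum runs over the support inside \<open>U\<close>, because a sum over an infinite
  set is 0 by convention.\<close>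

definition mass :: "('a \<Rightarrow> real) \<Rightarrow> 'a set \<Rightarrow> real" where
  "mass w U = sum w {x \<in> U. w x \<noteq> 0}"

definition simple_val :: "'a topology \<Rightarrow> ('a \<Rightarrow> real) \<Rightarrow> 'a set \<Rightarrow> ennreal" where
  "simple_val X w = (\<lambda>U. if openin X U then ennreal (mass w U) else 0)"

lemma mass_superset:
  assumes "finite G" "{x. w x \<noteq> 0} \<subseteq> G"
  shows "mass w U = sum w (G \<inter> U)"
  unfolding mass_def using assms by (intro sum.mono_neutral_left) auto

lemma mass_nonneg: "weight X w \<Longrightarrow> 0 \<le> mass w U"
  unfolding mass_def weight_def by (intro sum_nonneg) auto

lemma mass_mono: "weight X w \<Longrightarrow> U \<subseteq> V \<Longrightarrow> mass w U \<le> mass w V"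
  unfolding mass_def weight_def by (rule sum_mono2) (auto elim: finite_subset[rotated])

lemma weight_lin:
  assumes "weight X w" "weight X v" "0 \<le> r" "0 \<le> s"
  shows "weight X (\<lambda>x. r * w x + s * v x)"
proof -
  have "{x. r * w x + s * v x \<noteq> 0} \<subseteq> {x. w x \<noteq> 0} \<union> {x. v x \<noteq> 0}" by auto
  then show ?thesis using assms unfolding weight_def
    by (auto intro: finite_subset[of _ "{x. w x \<noteq> 0} \<union> {x. v x \<noteq> 0}"])
qed

lemma mass_lin:
  assumes "weight X w" "weight X v"
  shows "mass (\<lambda>x. r * w x + s * v x) U = r * mass w U + s * mass v U"
proof -
  let ?G = "{x. w x \<noteq> 0} \<union> {x. v x \<noteq> 0}"
  have G: "finite ?G" using assms by (auto simp: weight_def)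
  have "mass (\<lambda>x. r * w x + s * v x) U = (\<Sum>x\<in>?G \<inter> U. r * w x + s * v x)"
    by (rule mass_superset[OF G]) auto
  also have "\<dots> = r * sum w (?G \<inter> U) + s * sum v (?G \<inter> U)"
    by (simp add: sum.distrib sum_distrib_left)
  also have "sum w (?G \<inter> U) = mass w U" by (rule mass_superset[OF G, symmetric]) auto
  also have "sum v (?G \<inter> U) = mass v U" by (rule mass_superset[OF G, symmetric]) auto
  finally show ?thesis .
qed

lemma simple_val_lin:
  assumes "weight X w" "weight X v" "0 \<le> r" "0 \<le> s"
  shows "simple_val X (\<lambda>x. r * w x + s * v x) = val_add (val_scale r (simple_val X w)) (val_scale s (simple_val X v))"
  using assms mass_nonneg[OF assms(1)] mass_nonneg[OF assms(2)]
  by (auto simp: simple_val_def val_add_def val_scale_def mass_lin[OF assms(1,2)] ennreal_mult)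

lemma weight_zero: "weight X (\<lambda>x. 0)"
  by (simp add: weight_def)

lemma mass_zero [simp]: "mass (\<lambda>x. 0) U = 0"
  by (simp add: mass_def)

lemma simple_val_zero: "simple_val X (\<lambda>x. 0) = (\<lambda>U. 0)"
  by (auto simp: simple_val_def)

lemma weight_point: "x \<in> topspace X \<Longrightarrow> 0 \<le> r \<Longrightarrow> weight X (\<lambda>y. if y = x then r else 0)"
  by (auto simp: weight_def)

lemma mass_point: "mass (\<lambda>y. if y = x then r else 0) U = (if x \<in> U then r else 0)"
  by (subst mass_superset[of "{x}"]) auto

lemma simple_val_point:
  "simple_val X (\<lambda>y. if y = x then 1 else 0) = dirac X x"
  by (auto simp: simple_val_def dirac_def mass_point)

lemma point_continuous_valuation_simple_val:
  assumes w: "weight X w"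
  shows "point_continuous_valuation X (simple_val X w)"
proof -
  have S: "finite {x. w x \<noteq> 0}" using w by (simp add: weight_def)
  have eq: "mass w U = sum w ({x. w x \<noteq> 0} \<inter> U)" for U by (rule mass_superset[OF S order_refl])
  have "mass w U + mass w V = mass w (U \<union> V) + mass w (U \<inter> V)" for U V
    using sum.union_inter[of "{x. w x \<noteq> 0} \<inter> U" "{x. w x \<noteq> 0} \<inter> V" w] S
    by (simp add: eq Int_Un_distrib Int_left_commute Int_assoc)
  then have "valuation X (simple_val X w)"
    using mass_nonneg[OF w] mass_mono[OF w]
    by (auto simp: valuation_def simple_val_def ennreal_leI mass_def[of _ "{}"] simp flip: ennreal_plus)
  moreover have "continuous_map (point_topology X) scott_ennreal (simple_val X w)"
    unfolding continuous_map_point_topology_iff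
  proof (intro allI impI, elim conjE)
    fix U r assume U: "openin X U" "ennreal r < simple_val X w U"
    \<comment> \<open>The finitely many support points inside \<open>U\<close> carry its whole mass,
      so they serve as witness for every level \<open>r\<close>.\<close>
    show "\<exists>F. finite F \<and> F \<subseteq> U \<and> (\<forall>V. openin X V \<and> F \<subseteq> V \<longrightarrow> ennreal r < simple_val X w V)"
    proof (intro exI[of _ "{x \<in> U. w x \<noteq> 0}"] conjI allI impI; (elim conjE)?)
      fix V assume V: "openin X V" "{x \<in> U. w x \<noteq> 0} \<subseteq> V"
      have "mass w U = mass w (U \<inter> V)" unfolding mass_def using V by (intro sum.cong) auto
      also have "\<dots> \<le> mass w V" by (rule mass_mono[OF w]) simp
      finally have "simple_val X w U \<le> simple_val X w V" using U V by (simp add: simple_val_def ennreal_leI)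
      then show "ennreal r < simple_val X w V" using U by simp
    qed (use S in \<open>auto elim: finite_subset[rotated]\<close>)
  qed
  ultimately show ?thesis by (simp add: point_continuous_valuation_def)
qed

section \<open>Density of the simple valuations\<close>

text \<open>The greedy algorithm: a new point \<open>x\<close> receives the increment \<open>f (insert x G) - f G\<close>.\<close>

lemma submodular_base:
  fixes f :: "'a set \<Rightarrow> real"
  assumes mono: "\<And>A B. A \<subseteq> B \<Longrightarrow> B \<subseteq> S \<Longrightarrow> f A \<le> f B"
    and sub: "\<And>A B. A \<subseteq> S \<Longrightarrow> B \<subseteq> S \<Longrightarrow> f (A \<union> B) + f (A \<inter> B) \<le> f A + f B"
    and f0: "f {} = 0"
    and G: "finite G" "G \<subseteq> S"
  shows "\<exists>w. (\<forall>x. 0 \<le> w x) \<and> (\<forall>x. x \<notin> G \<longrightarrow> w x = 0) \<and> (\<forall>A\<subseteq>G. sum w A \<le> f A) \<and> sum w G = f G"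
  using G
proof (induction G)
  case empty
  then show ?case by (intro exI[of _ "\<lambda>x. 0"]) (auto simp: f0)
next
  case (insert x G)
  then obtain w where w: "\<forall>x. 0 \<le> w x" "\<forall>x. x \<notin> G \<longrightarrow> w x = 0" "\<forall>A\<subseteq>G. sum w A \<le> f A" "sum w G = f G"
    by auto
  define d where "d = f (insert x G) - f G"
  define v where "v = w(x := d)"
  have d: "0 \<le> d" using mono[of G "insert x G"] insert by (auto simp: d_def)
  have vw: "sum v A = sum w A" if "x \<notin> A" for A
    unfolding v_def using that by (intro sum.cong) auto
  have "sum v A \<le> f A" if A: "A \<subseteq> insert x G" for A
  proof (cases "x \<in> A")
    case True
    have AS: "A \<subseteq> S" using A insert.prems by auto
    have AG: "A \<union> G = insert x G" using A True by auto
    have fin: "finite A" using A insert by (meson finite.insertI finite_subset)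
    have "sum v A = d + sum w (A - {x})"
      using True fin vw[of "A - {x}"] by (simp add: sum.remove v_def)
    also have "\<dots> \<le> d + f (A - {x})" using w(3)[rule_format, of "A - {x}"] A by auto
    also have "A - {x} = A \<inter> G" using A True insert by auto
    \<comment> \<open>Diminishing increments: as \<open>A \<union> G = insert x G\<close>,
      submodularity for \<open>A\<close> and \<open>G\<close> bounds the increment of
      \<open>x\<close> over \<open>G\<close> by its increment over
      \<open>A \<inter> G\<close>.\<close>
    also have "d + f (A \<inter> G) \<le> f A"
      using sub[of A G] AS insert.prems AG by (simp add: d_def)
    finally show ?thesis .
  next
    case False
    then show ?thesis using A w(3) vw by (metis subset_insert)
  qed
  moreover have "sum v (insert x G) = f (insert x G)"
    using insert vw[of G] w(4) by (simp add: v_def d_def)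
  ultimately show ?case using w d by (intro exI[of _ v]) (auto simp: v_def)
qed

text \<open>\<open>ennreal\<close> sends negative reals to 0, so \<open>ennreal r < x\<close> fails
  for x = 0 and negative \<open>r\<close>. The first disjunct makes negative bounds vacuous, which
  is needed to split a bound on a sum one of whose summands is 0.\<close>

abbreviation less_ext :: "real \<Rightarrow> ennreal \<Rightarrow> bool" where
  "less_ext r x \<equiv> r < 0 \<or> ennreal r < x"

lemma less_ext_add:
  assumes "less_ext r (x + y)"
  obtains a b where "less_ext a x" "less_ext b y" "r \<le> a + b"
proof (cases "r < 0")
  case True
  then show thesis using that[of "r / 2" "r / 2"] by auto
next
  case False
  have between: "\<exists>a. r < a \<and> ennreal a < z" if "ennreal r < z" for z
  proof (cases z)
    case (real t)
    then show ?thesis using that False by (intro exI[of _ "(r + t) / 2"]) (auto simp: ennreal_less_iff)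
  next
    case top then show ?thesis by (intro exI[of _ "r + 1"]) auto
  qed
  have "0 \<le> r" "ennreal r < x + y" using False assms by auto
  then consider "ennreal r < x" | "ennreal r < y"
    | a b where "0 \<le> a" "0 \<le> b" "r \<le> a + b" "ennreal a < x" "ennreal b < y"
    unfolding ennreal_less_add_iff[OF \<open>0 \<le> r\<close>] by blast
  then show thesis
  proof cases
    case 1
    \<comment> \<open>The bound on \<open>x\<close> is raised above \<open>r\<close>, so that the
      remainder \<open>r - a\<close> is negative and holds vacuously for \<open>y\<close>, even if
      \<open>y\<close> is 0.\<close>
    then obtain a where "r < a" "ennreal a < x" using between by blast
    then show thesis using that[of a "r - a"] by auto
  next
    case 2
    then obtain a where "r < a" "ennreal a < y" using between by blast
    then show thesis using that[of "r - a" a] by auto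
  next
    case 3 then show thesis using that[of a b] by blast
  qed
qed

text \<open>Point-continuity yields a finite set \<open>F\<close> on which to place mass. The
  valuation, truncated at a level \<open>R\<close> and extended to arbitrary sets by outer
  approximation, is a real monotone submodular function; greedy weights on \<open>F\<close> stay
  below it and exhaust its value at \<open>F\<close>, which is at least \<open>R\<close>.\<close>

lemma simple_below_single:
  assumes \<nu>: "point_continuous_valuation X \<nu>" and D: "openin X D" and r: "less_ext r (\<nu> D)"
  shows "\<exists>w. weight X w \<and> simple_val X w \<le> \<nu> \<and> r < mass w D"
proof (cases "r < 0")
  case True
  then show ?thesis by (intro exI[of _ "\<lambda>x. 0"]) (auto simp: weight_zero simple_val_zero le_fun_def)
next
  case False
  have val: "valuation X \<nu>" using \<nu> by (simp add: point_continuous_valuation_def)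
  \<comment> \<open>The gap between \<open>r\<close> and \<open>R\<close> turns the final bound
    \<open>R \<le> f F\<close> into the required strict one.\<close>
  have "\<exists>R>r. ennreal R < \<nu> D"
  proof (cases "\<nu> D")
    case (real t)
    then show ?thesis using r False by (intro exI[of _ "(r + t) / 2"]) (auto simp: ennreal_less_iff)
  next
    case top then show ?thesis by (intro exI[of _ "r + 1"]) auto
  qed
  then obtain R where R: "r < R" "ennreal R < \<nu> D" by blast
  have "0 \<le> R" using R False by simp
  obtain F where F: "finite F" "F \<subseteq> D" "\<forall>V. openin X V \<and> F \<subseteq> V \<longrightarrow> ennreal R < \<nu> V"
    using point_continuous_valuation_nhd[OF \<nu> D \<open>0 \<le> R\<close> R(2)] by blast
  \<comment> \<open>\<open>m\<close> is the truncated valuation as a real number. Passing to the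
    infimum over open supersets extends it beyond open sets, since the greedy construction evaluates
    arbitrary subsets of \<open>F\<close>.\<close>
  define m where "m V = enn2real (min (ennreal R) (\<nu> V))" for V
  define \<O> where "\<O> A = {V. openin X V \<and> A \<subseteq> V}" for A
  define f where "f A = Inf (m ` \<O> A)" for A
  have em: "ennreal (m V) = min (ennreal R) (\<nu> V)" for V
    unfolding m_def by (rule ennreal_enn2real) (auto simp: min_less_iff_disj less_top)
  have m0: "0 \<le> m V" for V by (simp add: m_def)
  have m_le: "ennreal (m V) \<le> \<nu> V" for V by (simp add: em)
  have m_mono: "m U \<le> m V" if "openin X U" "openin X V" "U \<subseteq> V" for U V
    unfolding m_def by (rule enn2real_mono)
      (use valuation_mono[OF val that] in \<open>auto simp: min_less_iff_disj intro: min.coboundedI2\<close>)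
  have m_mod: "m (U \<union> V) + m (U \<inter> V) \<le> m U + m V" if U: "openin X U" and V: "openin X V" for U V
  proof -
    have UV: "openin X (U \<union> V)" "openin X (U \<inter> V)" using U V by auto
    have mono: "m U \<le> m (U \<union> V)" "m V \<le> m (U \<union> V)" "m (U \<inter> V) \<le> m U" "m (U \<inter> V) \<le> m V"
      using UV U V by (auto intro!: m_mono)
    have mR: "m W \<le> R" for W using \<open>0 \<le> R\<close> em[of W] by (metis ennreal_le_iff min.cobounded1)
    have small: "\<nu> W = ennreal (m W)" if "m W < R" for W
      using em[of W] that by (metis min_def ennreal_less_iff m0 less_irrefl)
    show ?thesis
    \<comment> \<open>If one of the two values is cut off at \<open>R\<close>, so is that of the
      union, and the intersection is bounded by the other set. Otherwise both are true values of
      \<nu>, and modularity applies, with truncation only lowering the left-hand side.\<close>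
    proof (cases "m U = R \<or> m V = R")
      case True
      then show ?thesis using mono mR[of "U \<union> V"] mR[of U] mR[of V] by auto
    next
      case False
      then have *: "m U < R" "m V < R" using mR by (auto simp: less_le)
      have "ennreal (m (U \<union> V) + m (U \<inter> V)) \<le> \<nu> (U \<union> V) + \<nu> (U \<inter> V)"
        using m_le m0 by (simp add: add_mono)
      also have "\<dots> = \<nu> U + \<nu> V" using valuation_modular[OF val U V] by simp
      also have "\<dots> = ennreal (m U + m V)" using small[OF *(1)] small[OF *(2)] m0 by simp
      finally show ?thesis using m0 by (subst (asm) ennreal_le_iff) auto
    qed
  qed
  have bdd: "bdd_below (m ` \<O> A)" for A using m0 by (auto intro!: bdd_belowI[of _ 0])
  have ne: "\<O> A \<noteq> {}" if "A \<subseteq> topspace X" for A using that by (auto simp: \<O>_def)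
  have f_le: "f A \<le> m V" if "openin X V" "A \<subseteq> V" for A V
    unfolding f_def using that by (intro cInf_lower bdd) (auto simp: \<O>_def)
  have f_mono: "f A \<le> f B" if "A \<subseteq> B" "B \<subseteq> topspace X" for A B
    unfolding f_def using that ne by (intro cInf_superset_mono bdd) (auto simp: \<O>_def)
  have f_sub: "f (A \<union> B) + f (A \<inter> B) \<le> f A + f B" if AB: "A \<subseteq> topspace X" "B \<subseteq> topspace X" for A B
  proof -
    let ?c = "f (A \<union> B) + f (A \<inter> B)"
    have "?c - f A \<le> m V" if V: "V \<in> \<O> B" for V
    proof -
      have "?c - m V \<le> m U" if "U \<in> \<O> A" for U
        using that V m_mod[of U V] f_le[of "U \<union> V" "A \<union> B"] f_le[of "U \<inter> V" "A \<inter> B"]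
        by (force simp: \<O>_def)
      then have "?c - m V \<le> f A" unfolding f_def using ne[OF AB(1)] by (intro cInf_greatest) auto
      then show ?thesis by simp
    qed
    then have "?c - f A \<le> f B" unfolding f_def using ne[OF AB(2)] by (intro cInf_greatest) auto
    then show ?thesis by simp
  qed
  have f0: "f {} = 0"
  proof (rule antisym)
    show "f {} \<le> 0" using f_le[of "{}" "{}"] valuation_empty[OF val] by (simp add: m_def)
    show "0 \<le> f {}" unfolding f_def using m0 ne by (intro cInf_greatest) auto
  qed
  have FX: "F \<subseteq> topspace X" using F D openin_subset by blast
  obtain w where w: "\<forall>x. 0 \<le> w x" "\<forall>x. x \<notin> F \<longrightarrow> w x = 0" "\<forall>A\<subseteq>F. sum w A \<le> f A" "sum w F = f F"
    using submodular_base[of "topspace X" f F] f_mono f_sub f0 F(1) FX by blast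
  have supp: "{x. w x \<noteq> 0} \<subseteq> F" using w by auto
  have wt: "weight X w" using w(1) supp FX F(1) by (auto simp: weight_def intro: finite_subset)
  have mass: "mass w U = sum w (F \<inter> U)" for U using mass_superset[OF F(1) supp] .
  have "simple_val X w U \<le> \<nu> U" for U
  proof (cases "openin X U")
    case True
    have "mass w U \<le> m U" unfolding mass using w(3)[rule_format, of "F \<inter> U"] f_le[OF True, of "F \<inter> U"] by auto
    then have "ennreal (mass w U) \<le> \<nu> U" using m_le[of U] by (meson ennreal_leI order_trans)
    then show ?thesis using True by (simp add: simple_val_def)
  qed (simp add: simple_val_def)
  moreover have "r < mass w D"
  proof -
    \<comment> \<open>By the choice of \<open>F\<close>, every open superset of \<open>F\<close> has
      measure above \<open>R\<close>, so its truncated value is \<open>R\<close>.\<close>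
    have "R \<le> f F" unfolding f_def
    proof (rule cInf_greatest)
      fix x assume "x \<in> m ` \<O> F"
      then obtain V where V: "x = m V" "openin X V" "F \<subseteq> V" by (auto simp: \<O>_def)
      then have "ennreal R \<le> ennreal (m V)" using F(3) em[of V] by (auto simp: min_def less_imp_le)
      then show "R \<le> x" using V m0 by (simp add: ennreal_le_iff)
    qed (use ne[OF FX] in auto)
    also have "\<dots> = mass w D" using w(4) F(2) by (simp add: mass Int_absorb2)
    finally show ?thesis using R by simp
  qed
  ultimately show ?thesis using wt by (auto simp: le_fun_def)
qed


lemma ennreal_cancel_right:
  fixes x y z :: ennreal
  assumes "z < top"
  shows "x + z = y + z \<longleftrightarrow> x = y"
  using assms ennreal_add_left_cancel[of z x y] by (auto simp: add.commute)

section \<open>Splitting a valuation along an open set\<close>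

lemma valuation_restrict:
  assumes \<nu>: "point_continuous_valuation X \<nu>" and V: "openin X V"
  shows "point_continuous_valuation X (\<lambda>A. if openin X A then \<nu> (A \<inter> V) else 0)" (is "point_continuous_valuation X ?\<mu>")
proof -
  have val: "valuation X \<nu>" using \<nu> by (simp add: point_continuous_valuation_def)
  have "valuation X ?\<mu>"
    unfolding valuation_def
  proof (intro conjI allI impI; (elim conjE)?)
    fix A B assume AB: "openin X A" "openin X B"
    then show "?\<mu> A + ?\<mu> B = ?\<mu> (A \<union> B) + ?\<mu> (A \<inter> B)"
      using valuation_modular[OF val, of "A \<inter> V" "B \<inter> V"] V
      by (simp add: openin_Int openin_Un Int_Un_distrib2 Int_assoc Int_left_commute)
  next
    fix A B assume "openin X A" "openin X B" "A \<subseteq> B"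
    then show "?\<mu> A \<le> ?\<mu> B"
      using valuation_mono[OF val, of "A \<inter> V" "B \<inter> V"] V by (auto simp: openin_Int)
  qed (auto simp: valuation_empty[OF val])
  moreover have "continuous_map (point_topology X) scott_ennreal ?\<mu>"
    unfolding continuous_map_point_topology_iff
  proof (intro allI impI, elim conjE)
    fix U r assume U: "openin X U" "0 \<le> r" "ennreal r < ?\<mu> U"
    then obtain F where F: "finite F" "F \<subseteq> U \<inter> V" "\<forall>W. openin X W \<and> F \<subseteq> W \<longrightarrow> ennreal r < \<nu> W"
      using point_continuous_valuation_nhd[OF \<nu> openin_Int[OF U(1) V] U(2)] by auto
    then show "\<exists>F. finite F \<and> F \<subseteq> U \<and> (\<forall>W. openin X W \<and> F \<subseteq> W \<longrightarrow> ennreal r < ?\<mu> W)"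
      using V by (intro exI[of _ F]) (auto simp: openin_Int)
  qed
  ultimately show ?thesis by (simp add: point_continuous_valuation_def)
qed

text \<open>This is the part of \<nu> outside \<open>V\<close>; modularity makes it complementary to
  the restriction to \<open>V\<close>. Finiteness of \<nu>(V) allows cancellation, so its modularity
  follows from that of \<nu> at sets \<open>A \<union> V\<close>.\<close>

lemma valuation_remainder:
  assumes \<nu>: "point_continuous_valuation X \<nu>" and V: "openin X V" and fin: "\<nu> V < top"
  shows "point_continuous_valuation X (\<lambda>A. if openin X A then \<nu> (A \<union> V) - \<nu> V else 0)" (is "point_continuous_valuation X ?\<mu>")
proof -
  have val: "valuation X \<nu>" using \<nu> by (simp add: point_continuous_valuation_def)
  have dec: "\<nu> (A \<union> V) = ?\<mu> A + \<nu> V" if "openin X A" for A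
    using that valuation_mono[OF val V, of "A \<union> V"] V by (simp add: diff_add_cancel_ennreal openin_Un)
  have "valuation X ?\<mu>"
    unfolding valuation_def
  proof (intro conjI allI impI; (elim conjE)?)
    fix A B assume AB: "openin X A" "openin X B"
    have "A \<inter> B \<union> V = (A \<union> V) \<inter> (B \<union> V)" "A \<union> B \<union> V = (A \<union> V) \<union> (B \<union> V)" by auto
    then have "(?\<mu> A + \<nu> V) + (?\<mu> B + \<nu> V) = (?\<mu> (A \<union> B) + \<nu> V) + (?\<mu> (A \<inter> B) + \<nu> V)"
      using valuation_modular[OF val, of "A \<union> V" "B \<union> V"] AB V dec[of A] dec[of B]
        dec[of "A \<union> B"] dec[of "A \<inter> B"]
      by (metis openin_Int openin_Un)
    then have "(?\<mu> A + ?\<mu> B) + (\<nu> V + \<nu> V) = (?\<mu> (A \<union> B) + ?\<mu> (A \<inter> B)) + (\<nu> V + \<nu> V)"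
      by (simp only: ac_simps)
    then show "?\<mu> A + ?\<mu> B = ?\<mu> (A \<union> B) + ?\<mu> (A \<inter> B)"
      using fin by (simp add: ennreal_cancel_right)
  next
    fix A B assume "openin X A" "openin X B" "A \<subseteq> B"
    then show "?\<mu> A \<le> ?\<mu> B"
      using valuation_mono[OF val, of "A \<union> V" "B \<union> V"] V
      by (auto simp: openin_Un intro!: ennreal_minus_mono)
  qed (use fin in \<open>auto simp: ennreal_minus_eq_0\<close>)
  moreover have "continuous_map (point_topology X) scott_ennreal ?\<mu>"
    unfolding continuous_map_point_topology_iff
  proof (intro allI impI, elim conjE)
    fix U r assume U: "openin X U" "0 \<le> r" "ennreal r < ?\<mu> U"
    obtain v where v: "0 \<le> v" "\<nu> V = ennreal v" using fin by (cases "\<nu> V") auto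
    have iff: "ennreal r < ?\<mu> W \<longleftrightarrow> ennreal (r + v) < \<nu> (W \<union> V)" if "openin X W" for W
      using dec[OF that] v U(2) by (cases "?\<mu> W") (auto simp: ennreal_less_iff simp flip: ennreal_plus)
    then obtain F where F: "finite F" "F \<subseteq> U \<union> V" "\<forall>W. openin X W \<and> F \<subseteq> W \<longrightarrow> ennreal (r + v) < \<nu> W"
      using point_continuous_valuation_nhd[OF \<nu> openin_Un[OF U(1) V], of "r + v"] U v by auto
    \<comment> \<open>Points of \<open>F\<close> inside \<open>V\<close> need not be covered by
      \<open>W\<close>, because \<nu> is evaluated at \<open>W \<union> V\<close>; removing them
      also puts the witness inside \<open>U\<close>.\<close>
    have "ennreal r < ?\<mu> W" if W: "openin X W" "F - V \<subseteq> W" for W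
      unfolding iff[OF W(1)] using F(3)[rule_format, of "W \<union> V"] W V by (auto simp: openin_Un)
    then show "\<exists>F. finite F \<and> F \<subseteq> U \<and> (\<forall>W. openin X W \<and> F \<subseteq> W \<longrightarrow> ennreal r < ?\<mu> W)"
      using F by (intro exI[of _ "F - V"]) auto
  qed
  ultimately show ?thesis by (simp add: point_continuous_valuation_def)
qed

lemma simple_val_convex_le:
  assumes "weight X w" "weight X v" "simple_val X w \<le> \<nu>" "simple_val X v \<le> \<nu>" "0 \<le> e" "e \<le> 1"
  shows "simple_val X (\<lambda>x. (1 - e) * w x + e * v x) \<le> \<nu>"
proof (rule le_funI)
  fix U
  have "simple_val X (\<lambda>x. (1 - e) * w x + e * v x) U
      = ennreal (1 - e) * simple_val X w U + ennreal e * simple_val X v U"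
    using assms by (simp add: simple_val_lin val_add_def val_scale_def)
  also have "\<dots> \<le> ennreal (1 - e) * \<nu> U + ennreal e * \<nu> U"
    using assms by (intro add_mono mult_left_mono) (auto dest: le_funD)
  also have "\<dots> = (ennreal (1 - e) + ennreal e) * \<nu> U" by (simp add: distrib_right)
  also have "ennreal (1 - e) + ennreal e = 1" using assms by (simp flip: ennreal_plus)
  finally show "simple_val X (\<lambda>x. (1 - e) * w x + e * v x) U \<le> \<nu> U" by simp
qed

text \<open>Induction on the number of sets. A set \<open>V\<close> of finite measure splits \<open>\<nu>\<close> into the part inside
  \<open>V\<close> and the rest; for a set of infinite measure, a small multiple of a simple valuation with
  large mass on \<open>V\<close> is mixed in.\<close>

lemma simple_below_aux:
  assumes "finite I" "point_continuous_valuation X \<nu>" "openin X D"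
    and "\<And>i. i \<in> I \<Longrightarrow> openin X (U i) \<and> U i \<subseteq> D \<and> less_ext (r i) (\<nu> (U i))"
    and "less_ext r0 (\<nu> D)"
  shows "\<exists>w. weight X w \<and> simple_val X w \<le> \<nu> \<and> r0 < mass w D \<and> (\<forall>i\<in>I. r i < mass w (U i))"
  using assms
proof (induction I arbitrary: \<nu> D U r r0)
  case empty
  then show ?case using simple_below_single[OF empty.prems(1,2,4)] by simp
next
  case (insert j I)
  note \<nu> = insert.prems(1)
  have val: "valuation X \<nu>" using \<nu> by (simp add: point_continuous_valuation_def)
  let ?V = "U j"
  have V: "openin X ?V" "?V \<subseteq> D" and rj: "less_ext (r j) (\<nu> ?V)" using insert.prems(3) by auto
  have UI: "openin X (U i)" "U i \<subseteq> D" "less_ext (r i) (\<nu> (U i))" if "i \<in> I" for i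
    using insert.prems(3) that by auto
  show ?case
  proof (cases "\<nu> ?V = top")
    case True
    obtain w where w: "weight X w" "simple_val X w \<le> \<nu>" "r0 < mass w D" "\<forall>i\<in>I. r i < mass w (U i)"
      using insert.IH[OF \<nu> insert.prems(2) _ insert.prems(4), of U r] UI by blast
    \<comment> \<open>As \<open>e\<close> tends to 0 from the right, \<open>(1 - e) * b\<close>
      tends to \<open>b\<close>, so finitely many strict lower bounds survive the mixing for some
      positive \<open>e\<close>.\<close>
    have ev: "\<forall>\<^sub>F e in at_right (0::real). a < (1 - e) * b" if "a < b" for a b :: real
    proof -
      have "((\<lambda>e. (1 - e) * b) \<longlongrightarrow> (1 - 0) * b) (at_right 0)" by (intro tendsto_intros)
      then show ?thesis using order_tendstoD(1)[of _ "(1 - 0) * b" _ a] that by simp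
    qed
    have "\<forall>\<^sub>F e in at_right (0::real). 0 < e \<and> e < 1 \<and> r0 < (1 - e) * mass w D \<and>
        (\<forall>i\<in>I. r i < (1 - e) * mass w (U i))"
      using w insert.hyps ev
      by (intro eventually_conj eventually_ball_finite)
        (auto intro: eventually_at_right_less eventually_at_rightI[of 0 1])
    then obtain e where e: "0 < e" "e < 1" "r0 < (1 - e) * mass w D"
      "\<forall>i\<in>I. r i < (1 - e) * mass w (U i)"
      using eventually_happens[of _ "at_right (0::real)"] by auto
    \<comment> \<open>Infinite measure of \<open>?V\<close> permits any finite mass there; the bound
      \<open>r j / e\<close> compensates for the later scaling by \<open>e\<close>.\<close>
    obtain v where v: "weight X v" "simple_val X v \<le> \<nu>" "r j / e < mass v ?V"
      using simple_below_single[OF \<nu> V(1), of "r j / e"] True by auto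
    let ?u = "\<lambda>x. (1 - e) * w x + e * v x"
    have m: "mass ?u A = (1 - e) * mass w A + e * mass v A" for A by (rule mass_lin[OF w(1) v(1)])
    have nn: "0 \<le> (1 - e) * mass w A" "0 \<le> e * mass v A" for A
      using e mass_nonneg[OF w(1)] mass_nonneg[OF v(1)] by auto
    have "r0 < mass ?u D" using e(3) nn(2)[of D] unfolding m by linarith
    moreover have "r i < mass ?u (U i)" if "i \<in> I" for i
      using e(4)[rule_format, OF that] nn(2)[of "U i"] unfolding m by linarith
    moreover have "r j < mass ?u ?V"
      using v(3) e nn(1)[of ?V] unfolding m by (simp add: field_simps)
    ultimately show ?thesis using e
      by (intro exI[of _ ?u]) (auto intro!: weight_lin w v simple_val_convex_le)
  next
    case False
    define \<mu>1 where "\<mu>1 = (\<lambda>A. if openin X A then \<nu> (A \<inter> ?V) else 0)"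
    define \<mu>2 where "\<mu>2 = (\<lambda>A. if openin X A then \<nu> (A \<union> ?V) - \<nu> ?V else 0)"
    have fin: "\<nu> ?V < top" using False by (simp add: less_top)
    have p1: "point_continuous_valuation X \<mu>1" unfolding \<mu>1_def by (rule valuation_restrict[OF \<nu> V(1)])
    have p2: "point_continuous_valuation X \<mu>2" unfolding \<mu>2_def by (rule valuation_remainder[OF \<nu> V(1) fin])
    have split: "\<nu> A = \<mu>1 A + \<mu>2 A" if A: "openin X A" for A
    proof -
      have "\<nu> A + \<nu> ?V = \<nu> (A \<union> ?V) + \<nu> (A \<inter> ?V)" by (rule valuation_modular[OF val A V(1)])
      also have "\<nu> (A \<union> ?V) = \<mu>2 A + \<nu> ?V"
        using valuation_mono[OF val V(1), of "A \<union> ?V"] A V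
        by (simp add: \<mu>2_def diff_add_cancel_ennreal openin_Un)
      finally have "\<nu> A + \<nu> ?V = (\<mu>1 A + \<mu>2 A) + \<nu> ?V" using A by (simp add: \<mu>1_def ac_simps)
      then show ?thesis using fin by (simp add: ennreal_cancel_right)
    qed
    have "\<forall>i. \<exists>a b. i \<in> I \<longrightarrow> less_ext a (\<mu>1 (U i)) \<and> less_ext b (\<mu>2 (U i)) \<and> r i \<le> a + b"
      using UI less_ext_add split by metis
    then obtain a b where ab: "less_ext (a i) (\<mu>1 (U i))" "less_ext (b i) (\<mu>2 (U i))" "r i \<le> a i + b i"
      if "i \<in> I" for i by metis
    obtain a0 b0 where ab0: "less_ext a0 (\<mu>1 D)" "less_ext b0 (\<mu>2 D)" "r0 \<le> a0 + b0"
      using less_ext_add[of r0 "\<mu>1 D" "\<mu>2 D"] insert.prems(2,4) split by metis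
    have m1D: "\<mu>1 D = \<nu> ?V" "\<mu>1 ?V = \<nu> ?V" using insert.prems(2) V by (auto simp: \<mu>1_def Int_absorb1)
    have m1I: "\<mu>1 (U i \<inter> ?V) = \<mu>1 (U i)" if "i \<in> I" for i
      using UI[OF that] V by (simp add: \<mu>1_def openin_Int Int_assoc)
    \<comment> \<open>\<open>\<mu>1\<close> is concentrated on \<open>?V\<close>, so
      \<open>?V\<close> takes over the role of \<open>D\<close> and leaves the index set: the
      maximum covers both the share \<open>a0\<close> of the bound on \<open>D\<close> and the full
      bound for \<open>j\<close>. The induction hypothesis for \<open>I\<close> is then
      enough.\<close>
    have "\<exists>w. weight X w \<and> simple_val X w \<le> \<mu>1 \<and> max a0 (r j) < mass w ?V \<and> (\<forall>i\<in>I. a i < mass w (U i \<inter> ?V))"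
      using ab UI V rj ab0(1) m1D m1I
      by (intro insert.IH p1) (auto simp: max_def)
    then obtain w where w: "weight X w" "simple_val X w \<le> \<mu>1" "a0 < mass w ?V" "r j < mass w ?V"
      "\<forall>i\<in>I. a i < mass w (U i \<inter> ?V)" by auto
    \<comment> \<open>The bound for \<open>j\<close> is already met by \<open>w\<close> alone, so
      only the shares for \<open>D\<close> and \<open>I\<close> are left for the remainder.\<close>
    have "\<exists>v. weight X v \<and> simple_val X v \<le> \<mu>2 \<and> b0 < mass v D \<and> (\<forall>i\<in>I. b i < mass v (U i))"
      using ab UI insert.prems(2) ab0 by (intro insert.IH p2) auto
    then obtain v where v: "weight X v" "simple_val X v \<le> \<mu>2" "b0 < mass v D" "\<forall>i\<in>I. b i < mass v (U i)"
      by blast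
    let ?u = "\<lambda>x. 1 * w x + 1 * v x"
    have m: "mass ?u A = mass w A + mass v A" for A using mass_lin[OF w(1) v(1), of 1 1] by simp
    have u: "weight X ?u" by (rule weight_lin[OF w(1) v(1)]) auto
    have "simple_val X ?u \<le> \<nu>"
    proof (rule le_funI)
      fix A
      show "simple_val X ?u A \<le> \<nu> A"
      proof (cases "openin X A")
        case True
        have "simple_val X ?u A = simple_val X w A + simple_val X v A"
          using simple_val_lin[OF w(1) v(1), of 1 1] by (simp add: val_add_def)
        also have "\<dots> \<le> \<mu>1 A + \<mu>2 A" using w(2) v(2) by (intro add_mono) (auto dest: le_funD)
        finally show ?thesis using split[OF True] by simp
      qed (simp add: simple_val_def)
    qed
    moreover have "r0 < mass ?u D"
      using mass_mono[OF w(1) V(2)] w(3) v(3) ab0(3) unfolding m by linarith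
    moreover have "r i < mass ?u (U i)" if "i \<in> I" for i
      using mass_mono[OF w(1), of "U i \<inter> ?V" "U i"] w(5) v(4) ab(3)[OF that] that unfolding m by force
    moreover have "r j < mass ?u ?V" using w(4) mass_nonneg[OF v(1), of ?V] unfolding m by linarith
    ultimately show ?thesis using u by (intro exI[of _ ?u]) auto
  qed
qed

theorem simple_below_in_open:
  assumes W: "openin (Vp X) W" and "\<nu> \<in> W"
  shows "\<exists>w. weight X w \<and> simple_val X w \<le> \<nu> \<and> simple_val X w \<in> W"
proof -
  have \<nu>: "point_continuous_valuation X \<nu>" using assms openin_subset by fastforce
  have val: "valuation X \<nu>" using \<nu> by (simp add: point_continuous_valuation_def)
  obtain P where P: "finite P" "\<forall>(U, r)\<in>P. openin X U \<and> 0 \<le> r \<and> ennreal r < \<nu> U"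
    "\<forall>\<mu>. point_continuous_valuation X \<mu> \<and> (\<forall>(U, r)\<in>P. ennreal r < \<mu> U) \<longrightarrow> \<mu> \<in> W"
    using Vp_nhd[OF assms] by blast
  \<comment> \<open>The whole space serves as the containing set \<open>D\<close>; its bound -1 is
    negative and hence vacuous.\<close>
  have "\<exists>w. weight X w \<and> simple_val X w \<le> \<nu> \<and> -1 < mass w (topspace X) \<and> (\<forall>p\<in>P. snd p < mass w (fst p))"
    using P \<nu> by (intro simple_below_aux) (use openin_subset in fastforce)+
  then obtain w where w: "weight X w" "simple_val X w \<le> \<nu>" "\<forall>p\<in>P. snd p < mass w (fst p)" by blast
  have "simple_val X w \<in> W"
    using P(2,3) w point_continuous_valuation_simple_val[OF w(1)]
    by (fastforce simp: simple_val_def ennreal_less_iff)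
  then show ?thesis using w by blast
qed

section \<open>Uniqueness of linear continuous maps\<close>

text \<open>An open set containing f(\<nu>) contains the value of \<open>f\<close> at some simple
  valuation below \<nu>, which is also the value of \<open>g\<close> there; upward closure of the
  preimage under \<open>g\<close> then returns to \<nu>. So the two values have the same open
  neighbourhoods.\<close>

lemma eq_on_simple_imp_eq:
  assumes f: "continuous_map (Vp X) Y f" and g: "continuous_map (Vp X) Y g" and Y: "t0_space Y"
    and eq: "\<And>w. weight X w \<Longrightarrow> f (simple_val X w) = g (simple_val X w)"
    and \<nu>: "point_continuous_valuation X \<nu>"
  shows "f \<nu> = g \<nu>"
proof (rule t0_space_eqI[OF Y])
  show "f \<nu> \<in> topspace Y" "g \<nu> \<in> topspace Y"
    using \<nu> continuous_map_image_subset_topspace[OF f] continuous_map_image_subset_topspace[OF g] by auto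
  have *: "k \<nu> \<in> W" if h: "continuous_map (Vp X) Y h" and k: "continuous_map (Vp X) Y k"
    and W: "openin Y W" "h \<nu> \<in> W" and hk: "\<And>w. weight X w \<Longrightarrow> h (simple_val X w) = k (simple_val X w)"
    for h k W
  proof -
    have oh: "openin (Vp X) {\<mu> \<in> topspace (Vp X). h \<mu> \<in> W}"
      and ok: "openin (Vp X) {\<mu> \<in> topspace (Vp X). k \<mu> \<in> W}"
      using h k W(1) unfolding continuous_map_def by blast+
    have "\<nu> \<in> {\<mu> \<in> topspace (Vp X). h \<mu> \<in> W}" using \<nu> W(2) by simp
    from simple_below_in_open[OF oh this]
    obtain w where w: "weight X w" "simple_val X w \<le> \<nu>" "h (simple_val X w) \<in> W" by blast
    have "simple_val X w \<in> {\<mu> \<in> topspace (Vp X). k \<mu> \<in> W}"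
      using w hk[OF w(1)] point_continuous_valuation_simple_val[OF w(1)] by simp
    from Vp_upward_closed[OF ok this w(2) \<nu>] show ?thesis by simp
  qed
  show "f \<nu> \<in> W \<longleftrightarrow> g \<nu> \<in> W" if "openin Y W" for W
    using *[OF f g that _ eq] *[OF g f that _ eq[symmetric]] by blast
qed

text \<open>The redundant factor in \<open>1 * w y\<close> keeps the step an instance of the linear
  combinations in \<open>simple_val_lin\<close>, and so of the linearity of maps on
  \<open>Vp X\<close>.\<close>

lemma weight_induct [consumes 1, case_names zero add]:
  assumes w: "weight X w" and zero: "P (\<lambda>x. 0)"
    and step: "\<And>w x r. weight X w \<Longrightarrow> P w \<Longrightarrow> x \<in> topspace X \<Longrightarrow> 0 \<le> r \<Longrightarrow>
      P (\<lambda>y. 1 * w y + r * (if y = x then 1 else 0))"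
  shows "P w"
proof -
  have "\<forall>w. weight X w \<and> {x. w x \<noteq> 0} \<subseteq> F \<longrightarrow> P w" if "finite F" for F
    using that
  proof (induction F)
    case empty
    have "w = (\<lambda>x. 0)" if "{x. w x \<noteq> 0} \<subseteq> {}" for w :: "'a \<Rightarrow> real" using that by auto
    then show ?case using zero by blast
  next
    case (insert x F)
    show ?case
    proof (intro allI impI, elim conjE)
      fix w assume w: "weight X w" "{y. w y \<noteq> 0} \<subseteq> insert x F"
      show "P w"
      proof (cases "w x = 0")
        case True
        then show ?thesis using w insert.IH by blast
      next
        case False
        let ?v = "w(x := 0)"
        have "weight X ?v" using w(1) by (auto simp: weight_def elim: finite_subset[rotated])
        moreover have "{y. ?v y \<noteq> 0} \<subseteq> F" using w(2) by auto
        moreover have "x \<in> topspace X" "0 \<le> w x" using w(1) False by (auto simp: weight_def)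
        ultimately have "P (\<lambda>y. 1 * ?v y + w x * (if y = x then 1 else 0))"
          using step[of ?v x "w x"] insert.IH by blast
        moreover have "(\<lambda>y. 1 * ?v y + w x * (if y = x then 1 else 0)) = w" by auto
        ultimately show ?thesis by simp
      qed
    qed
  qed
  then show ?thesis using w unfolding weight_def by blast
qed

lemma simple_val_step:
  assumes "weight X w" "x \<in> topspace X" "0 \<le> r"
  shows "simple_val X (\<lambda>y. 1 * w y + r * (if y = x then 1 else 0))
     = val_add (val_scale 1 (simple_val X w)) (val_scale r (dirac X x))"
  using simple_val_lin[OF assms(1) weight_point[OF assms(2), of 1], of 1 r] assms(3)
  by (simp add: simple_val_point)

lemma linear_betweenD:
  assumes "linear_between C addC scaleC D addD scaleD f" "x \<in> C" "y \<in> C" "0 \<le> r" "0 \<le> s"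
  shows "f (addC (scaleC r x) (scaleC s y)) = addD (scaleD r (f x)) (scaleD s (f y))"
  using assms unfolding linear_between_def by blast

lemma linear_eq_on_simple:
  assumes f: "linear_between (topspace (Vp X)) val_add val_scale D addD scaleD f"
    and g: "linear_between (topspace (Vp X)) val_add val_scale D addD scaleD g"
    and eq: "\<And>x. x \<in> topspace X \<Longrightarrow> f (dirac X x) = g (dirac X x)"
    and ne: "topspace X \<noteq> {}" and w: "weight X w"
  shows "f (simple_val X w) = g (simple_val X w)"
  using w
proof (induction rule: weight_induct)
  case zero
  \<comment> \<open>Linearity is postulated for binary combinations only; the zero valuation is
    reached as such a combination with coefficients 0, which takes a point whose Dirac mass can be
    used.\<close>
  obtain x where x: "x \<in> topspace X" using ne by blast
  have "simple_val X (\<lambda>x. 0) = val_add (val_scale 0 (dirac X x)) (val_scale 0 (dirac X x))"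
    by (simp add: simple_val_zero val_add_def val_scale_def)
  then show ?case
    using linear_betweenD[OF f] linear_betweenD[OF g] eq[OF x] dirac_in_Vp[OF x] by simp
next
  case (add w x r)
  have "simple_val X w \<in> topspace (Vp X)" "dirac X x \<in> topspace (Vp X)"
    using point_continuous_valuation_simple_val[OF add.hyps(1)] dirac_in_Vp[OF add.hyps(2)] by auto
  then show ?case
    unfolding simple_val_step[OF add.hyps(1,2,3)]
    using linear_betweenD[OF f, of "simple_val X w" "dirac X x" 1 r]
      linear_betweenD[OF g, of "simple_val X w" "dirac X x" 1 r] add.IH eq[OF add.hyps(2)] add.hyps(3)
    by (simp del: val_scale_one)
qed

theorem linear_continuous_unique:
  assumes "linear_between (topspace (Vp X)) val_add val_scale D addD scaleD f"
    and "linear_between (topspace (Vp X)) val_add val_scale D addD scaleD g"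
    and "continuous_map (Vp X) Y f" "continuous_map (Vp X) Y g" "t0_space Y"
    and "\<And>x. x \<in> topspace X \<Longrightarrow> f (dirac X x) = g (dirac X x)"
    and "topspace X \<noteq> {}" and "point_continuous_valuation X \<nu>"
  shows "f \<nu> = g \<nu>"
  using eq_on_simple_imp_eq[OF assms(3-5) _ assms(8)] linear_eq_on_simple[OF assms(1,2,6,7)] by blast

lemma t0_space_scott_ennreal: "t0_space scott_ennreal"
  unfolding t0_space_def
proof (intro ballI impI)
  fix x y :: ennreal assume "x \<noteq> y"
  have *: "\<exists>U. openin scott_ennreal U \<and> x \<notin> U \<and> y \<in> U" if "x < y" for x y
  proof -
    have "x \<noteq> top" using that by auto
    then obtain r where "r \<ge> 0" "x = ennreal r" by (cases x) auto
    then show ?thesis using that by (intro exI[of _ "{ennreal r<..}"]) (auto simp: openin_scott_ennreal)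
  qed
  consider "x < y" | "y < x" using \<open>x \<noteq> y\<close> by force
  then show "\<exists>U. openin scott_ennreal U \<and> (x \<notin> U) = (y \<in> U)"
    by cases (use *[of x y] *[of y x] in blast)+
qed

section \<open>Integration\<close>

abbreviation lsc :: "'a topology \<Rightarrow> ('a \<Rightarrow> ennreal) \<Rightarrow> bool" where
  "lsc X h \<equiv> continuous_map X scott_ennreal h"

section \<open>Elementary properties of the integral\<close>

lemma antimono_superlevel:
  assumes "valuation X \<mu>" "lsc X h"
  shows "antimono (\<lambda>r. \<mu> {x \<in> topspace X. ennreal r < h x})"
proof (rule antimonoI)
  fix r s :: real assume "r \<le> s"
  then have "{x \<in> topspace X. ennreal s < h x} \<subseteq> {x \<in> topspace X. ennreal r < h x}"
    by (auto intro: le_less_trans ennreal_leI)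
  then show "\<mu> {x \<in> topspace X. ennreal s < h x} \<le> \<mu> {x \<in> topspace X. ennreal r < h x}"
    by (intro valuation_mono[OF assms(1)] openin_lsc[OF assms(2)])
qed

lemma borel_measurable_superlevel:
  assumes "valuation X \<mu>" "lsc X h"
  shows "(\<lambda>r. \<mu> {x \<in> topspace X. ennreal r < h x}) \<in> borel_measurable borel"
proof (rule borel_measurableI_greater)
  fix a
  have "is_interval {r. a < \<mu> {x \<in> topspace X. ennreal r < h x}}"
    unfolding is_interval_1 by (auto intro: less_le_trans[OF _ antimonoD[OF antimono_superlevel[OF assms]]])
  then show "{r \<in> space borel. a < \<mu> {x \<in> topspace X. ennreal r < h x}} \<in> sets borel"
    using real_interval_borel_measurable by simp
qed

lemma val_integral_cong:
  assumes "\<And>x. x \<in> topspace X \<Longrightarrow> h x = k x"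
  shows "val_integral X h \<mu> = val_integral X k \<mu>"
proof -
  have "{x \<in> topspace X. ennreal r < h x} = {x \<in> topspace X. ennreal r < k x}" for r using assms by auto
  then show ?thesis by (simp add: val_integral_def)
qed

lemma val_integral_mono:
  assumes "valuation X \<mu>" "lsc X h" "lsc X k" "\<And>x. x \<in> topspace X \<Longrightarrow> h x \<le> k x"
  shows "val_integral X h \<mu> \<le> val_integral X k \<mu>"
  unfolding val_integral_def
  by (intro nn_integral_mono mult_right_mono valuation_mono[OF assms(1)] openin_lsc assms)
    (auto dest: assms(4) intro: less_le_trans)

lemma val_integral_mono_valuation: "\<mu> \<le> \<nu> \<Longrightarrow> val_integral X h \<mu> \<le> val_integral X h \<nu>"
  unfolding val_integral_def by (intro nn_integral_mono mult_right_mono) (auto dest: le_funD)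

lemma val_integral_zero:
  assumes "valuation X \<mu>" "\<And>x. x \<in> topspace X \<Longrightarrow> h x = 0"
  shows "val_integral X h \<mu> = 0"
proof -
  have "{x \<in> topspace X. ennreal r < h x} = {}" for r using assms(2) by auto
  then show ?thesis unfolding val_integral_def by (simp only: valuation_empty[OF assms(1)]) simp
qed

lemma val_integral_zero_valuation: "val_integral X h (\<lambda>U. 0) = 0"
  by (simp add: val_integral_def)

lemma val_integral_lin:
  assumes "valuation X \<mu>" "valuation X \<nu>" "lsc X h"
  shows "val_integral X h (val_add (val_scale r \<mu>) (val_scale s \<nu>))
    = ennreal r * val_integral X h \<mu> + ennreal s * val_integral X h \<nu>"
proof -
  let ?f = "\<lambda>\<mu> t. \<mu> {x \<in> topspace X. ennreal t < h x} * indicator {0..} t"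
  have [measurable]: "(\<lambda>t. \<mu> {x \<in> topspace X. ennreal t < h x}) \<in> borel_measurable borel"
    "(\<lambda>t. \<nu> {x \<in> topspace X. ennreal t < h x}) \<in> borel_measurable borel"
    using borel_measurable_superlevel assms by auto
  have "val_integral X h (val_add (val_scale r \<mu>) (val_scale s \<nu>))
      = (\<integral>\<^sup>+t. ennreal r * ?f \<mu> t + ennreal s * ?f \<nu> t \<partial>lborel)"
    by (simp add: val_integral_def val_add_def val_scale_def algebra_simps)
  also have "\<dots> = ennreal r * (\<integral>\<^sup>+t. ?f \<mu> t \<partial>lborel) + ennreal s * (\<integral>\<^sup>+t. ?f \<nu> t \<partial>lborel)"
    by (simp add: nn_integral_add nn_integral_cmult)
  finally show ?thesis by (simp add: val_integral_def)
qed

lemma linear_val_integral: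
  assumes "lsc X h"
  shows "linear_between (topspace (Vp X)) val_add val_scale UNIV (+) (\<lambda>r t. ennreal r * t) (val_integral X h)"
  using assms by (auto simp: linear_between_def point_continuous_valuation_def val_integral_lin)

lemma lsc_SUP:
  assumes "\<And>i. i \<in> I \<Longrightarrow> lsc Y (f i)"
  shows "lsc Y (\<lambda>y. SUP i\<in>I. f i y)"
  unfolding continuous_map_scott_ennreal_iff
proof (intro allI impI)
  fix r :: real
  have "{y \<in> topspace Y. ennreal r < (SUP i\<in>I. f i y)} = (\<Union>i\<in>I. {y \<in> topspace Y. ennreal r < f i y})"
    by (auto simp: less_SUP_iff)
  then show "openin Y {y \<in> topspace Y. ennreal r < (SUP i\<in>I. f i y)}"
    using openin_lsc[OF assms] by auto
qed

text \<open>The dyadic Riemann sums present the integral as a supremum of finite nonnegative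
  combinations of evaluations \<mu>(U), each of which is lower semicontinuous on
  \<open>Vp X\<close>.\<close>

lemma lsc_val_integral:
  assumes h: "lsc X h"
  shows "lsc (Vp X) (val_integral X h)"
proof -
  have "lsc (Vp X) (\<lambda>\<mu>. SUP n. \<Sum>k=1..n * 2 ^ n.
            ennreal (1 / 2 ^ n) * \<mu> {x \<in> topspace X. ennreal (real k / 2 ^ n) < h x})"
    by (intro lsc_SUP lsc_sum lsc_cmult lsc_eval openin_lsc[OF h])
  then show ?thesis
    by (rule continuous_map_eq)
      (use h in \<open>simp add: point_continuous_valuation_def val_integral_eq_Riemann mult.commute\<close>)
qed

text \<open>The integrand is the indicator function of the interval from 0 to \<open>h x\<close>,
  whose length is \<open>h x\<close>, also in the infinite case.\<close>

lemma val_integral_dirac: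
  assumes h: "lsc X h" and x: "x \<in> topspace X"
  shows "val_integral X h (dirac X x) = h x"
proof -
  have "val_integral X h (dirac X x) = (\<integral>\<^sup>+r. indicator {r. 0 \<le> r \<and> ennreal r < h x} r \<partial>lborel)"
    unfolding val_integral_def
    by (intro nn_integral_cong) (use openin_lsc[OF h] x in \<open>auto simp: dirac_def indicator_def\<close>)
  also have "\<dots> = h x"
  proof (cases "h x")
    case (real t)
    then have "{r. 0 \<le> r \<and> ennreal r < h x} = {0..<t}" by (auto simp: ennreal_less_iff)
    then show ?thesis using real by simp
  next
    case top
    then have "{r. 0 \<le> r \<and> ennreal r < h x} = {0..}" by auto
    moreover have "emeasure lborel {0::real..} = top"
    proof (rule ccontr)
      assume "emeasure lborel {0::real..} \<noteq> top"
      then obtain t where t: "0 \<le> t" "emeasure lborel {0::real..} = ennreal t"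
        by (cases "emeasure lborel {0::real..}") auto
      have "emeasure lborel {0..t + 1} \<le> emeasure lborel {0::real..}" by (intro emeasure_mono) auto
      then show False using t by (simp add: ennreal_le_iff)
    qed
    ultimately show ?thesis using top by simp
  qed
  finally show ?thesis .
qed

text \<open>Both sides are linear and continuous in the valuation and agree on Dirac masses.\<close>

lemma val_integral_add:
  assumes h: "lsc X h" and k: "lsc X k" and "topspace X \<noteq> {}" "point_continuous_valuation X \<nu>"
  shows "val_integral X (\<lambda>x. h x + k x) \<nu> = val_integral X h \<nu> + val_integral X k \<nu>"
proof (rule linear_continuous_unique[where X = X and Y = scott_ennreal
      and f = "val_integral X (\<lambda>x. h x + k x)" and g = "\<lambda>\<nu>. val_integral X h \<nu> + val_integral X k \<nu>"])
  show "linear_between (topspace (Vp X)) val_add val_scale UNIV (+) (\<lambda>r t. ennreal r * t)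
     (\<lambda>\<nu>. val_integral X h \<nu> + val_integral X k \<nu>)"
    using h k by (auto simp: linear_between_def point_continuous_valuation_def val_integral_lin algebra_simps)
  show "linear_between (topspace (Vp X)) val_add val_scale UNIV (+) (\<lambda>r t. ennreal r * t)
     (val_integral X (\<lambda>x. h x + k x))"
    by (intro linear_val_integral lsc_add h k)
  show "val_integral X (\<lambda>x. h x + k x) (dirac X x)
      = val_integral X h (dirac X x) + val_integral X k (dirac X x)" if "x \<in> topspace X" for x
    using that by (simp add: val_integral_dirac h k lsc_add)
qed (use assms in \<open>auto intro: lsc_val_integral lsc_add t0_space_scott_ennreal\<close>)

section \<open>Functoriality and multiplication\<close>

lemma point_continuous_valuation_Vp_map:
  assumes f: "continuous_map X Y f" and \<mu>: "point_continuous_valuation X \<mu>"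
  shows "point_continuous_valuation Y (Vp_map X Y f \<mu>)"
proof -
  have val: "valuation X \<mu>" using \<mu> by (simp add: point_continuous_valuation_def)
  let ?p = "\<lambda>V. {x \<in> topspace X. f x \<in> V}"
  have op: "openin X (?p V)" if "openin Y V" for V using f that by (auto simp: continuous_map_def)
  have p: "?p (A \<union> B) = ?p A \<union> ?p B" "?p (A \<inter> B) = ?p A \<inter> ?p B" for A B by auto
  have "valuation Y (Vp_map X Y f \<mu>)"
    unfolding valuation_def
  proof (intro conjI allI impI; (elim conjE)?)
    fix A B assume AB: "openin Y A" "openin Y B"
    then show "Vp_map X Y f \<mu> A + Vp_map X Y f \<mu> B = Vp_map X Y f \<mu> (A \<union> B) + Vp_map X Y f \<mu> (A \<inter> B)"
      using valuation_modular[OF val op[OF AB(1)] op[OF AB(2)]] unfolding p[symmetric]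
      by (simp add: Vp_map_def openin_Un openin_Int)
  next
    fix A B assume AB: "openin Y A" "openin Y B" "A \<subseteq> B"
    then show "Vp_map X Y f \<mu> A \<le> Vp_map X Y f \<mu> B"
      using valuation_mono[OF val op op, of A B] by (auto simp: Vp_map_def)
  qed (auto simp: Vp_map_def valuation_empty[OF val])
  moreover have "continuous_map (point_topology Y) scott_ennreal (Vp_map X Y f \<mu>)"
    unfolding continuous_map_point_topology_iff
  proof (intro allI impI, elim conjE)
    fix U r assume U: "openin Y U" "0 \<le> r" "ennreal r < Vp_map X Y f \<mu> U"
    then obtain F where F: "finite F" "F \<subseteq> ?p U" "\<forall>W. openin X W \<and> F \<subseteq> W \<longrightarrow> ennreal r < \<mu> W"
      using point_continuous_valuation_nhd[OF \<mu> op[OF U(1)] U(2)] by (auto simp: Vp_map_def)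
    have "ennreal r < Vp_map X Y f \<mu> W" if "openin Y W" "f ` F \<subseteq> W" for W
      using F(2) F(3)[rule_format, of "?p W"] op[OF that(1)] that by (auto simp: Vp_map_def)
    then show "\<exists>F. finite F \<and> F \<subseteq> U \<and> (\<forall>W. openin Y W \<and> F \<subseteq> W \<longrightarrow> ennreal r < Vp_map X Y f \<mu> W)"
      using F by (intro exI[of _ "f ` F"]) auto
  qed
  ultimately show ?thesis by (simp add: point_continuous_valuation_def)
qed

lemma continuous_map_Vp_map:
  assumes f: "continuous_map X Y f"
  shows "continuous_map (Vp X) (Vp Y) (Vp_map X Y f)"
proof (rule continuous_map_into_Vp)
  fix U assume U: "openin Y U"
  then have "openin X {x \<in> topspace X. f x \<in> U}" using f by (auto simp: continuous_map_def)
  from lsc_eval[OF this] show "lsc (Vp X) (\<lambda>\<mu>. Vp_map X Y f \<mu> U)" using U by (simp add: Vp_map_def)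
qed (use point_continuous_valuation_Vp_map[OF f] in auto)

lemma Vp_map_lin:
  "Vp_map X Y f (val_add (val_scale r \<mu>) (val_scale s \<nu>))
    = val_add (val_scale r (Vp_map X Y f \<mu>)) (val_scale s (Vp_map X Y f \<nu>))"
  by (auto simp: Vp_map_def val_add_def val_scale_def)

lemma Vp_map_dirac:
  assumes "continuous_map X Y f" "x \<in> topspace X"
  shows "Vp_map X Y f (dirac X x) = dirac Y (f x)"
  using assms by (auto simp: Vp_map_def dirac_def continuous_map_def)

lemma topspace_Vp_nonempty: "topspace (Vp X) \<noteq> {}"
  using point_continuous_valuation_simple_val[OF weight_zero, of X] by auto

text \<open>For a simple valuation the integral is a finite combination of the values \<mu>(U) of
  point-continuous \<mu>. This is the simple case of the point-continuity of
  \<open>Vp_mult\<close>.\<close>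

lemma lsc_integral_simple:
  assumes "weight (Vp X) w"
  shows "lsc (point_topology X) (\<lambda>U. val_integral (Vp X) (\<lambda>\<mu>. \<mu> U) (simple_val (Vp X) w))"
  using assms
proof (induction rule: weight_induct)
  case zero
  then show ?case by (simp add: simple_val_zero val_integral_zero_valuation lsc_const)
next
  case (add w \<mu> r)
  have "lsc (point_topology X) (\<lambda>U. val_integral (Vp X) (\<lambda>\<mu>. \<mu> U) (simple_val (Vp X) w) + ennreal r * \<mu> U)"
    using add by (intro lsc_add lsc_cmult) (auto simp: point_continuous_valuation_def)
  then show ?case
  proof (rule continuous_map_eq)
    fix U assume "U \<in> topspace (point_topology X)"
    then show "val_integral (Vp X) (\<lambda>\<mu>. \<mu> U) (simple_val (Vp X) w) + ennreal r * \<mu> U =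
        val_integral (Vp X) (\<lambda>\<mu>. \<mu> U) (simple_val (Vp X) (\<lambda>y. 1 * w y + r * (if y = \<mu> then 1 else 0)))"
      using add point_continuous_valuation_simple_val[OF add.hyps(1)] dirac_in_Vp[OF add.hyps(2)]
      unfolding simple_val_step[OF add.hyps(1,2,3)]
      by (simp add: val_integral_lin lsc_eval val_integral_dirac point_continuous_valuation_def del: val_scale_one)
  qed
qed

text \<open>Modularity comes from additivity of the integral over \<open>Vp X\<close>. For
  point-continuity, density replaces an exchange of limits: a simple valuation below \<omega>
  already has integral above \<open>r\<close>, and its finite witness serves for \<omega> by
  monotonicity.\<close>

lemma point_continuous_valuation_Vp_mult:
  assumes \<omega>: "point_continuous_valuation (Vp X) \<omega>"
  shows "point_continuous_valuation X (Vp_mult X \<omega>)"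
proof -
  have val: "valuation (Vp X) \<omega>" using \<omega> by (simp add: point_continuous_valuation_def)
  let ?I = "\<lambda>U. val_integral (Vp X) (\<lambda>\<mu>. \<mu> U)"
  have mod: "?I U \<omega> + ?I V \<omega> = ?I (U \<union> V) \<omega> + ?I (U \<inter> V) \<omega>" if "openin X U" "openin X V" for U V
  proof -
    have "?I U \<omega> + ?I V \<omega> = val_integral (Vp X) (\<lambda>\<mu>. \<mu> U + \<mu> V) \<omega>"
      using that \<omega> topspace_Vp_nonempty[of X] by (intro val_integral_add[symmetric] lsc_eval) auto
    also have "\<dots> = val_integral (Vp X) (\<lambda>\<mu>. \<mu> (U \<union> V) + \<mu> (U \<inter> V)) \<omega>"
      using that by (intro val_integral_cong) (auto simp: point_continuous_valuation_def valuation_modular)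
    also have "\<dots> = ?I (U \<union> V) \<omega> + ?I (U \<inter> V) \<omega>"
      using that \<omega> topspace_Vp_nonempty[of X] by (intro val_integral_add lsc_eval) auto
    finally show ?thesis .
  qed
  have "valuation X (Vp_mult X \<omega>)"
    unfolding valuation_def
  proof (intro conjI allI impI; (elim conjE)?)
    fix U V assume "openin X U" "openin X V"
    then show "Vp_mult X \<omega> U + Vp_mult X \<omega> V = Vp_mult X \<omega> (U \<union> V) + Vp_mult X \<omega> (U \<inter> V)"
      using mod[of U V] by (simp add: Vp_mult_def openin_Un openin_Int)
  next
    fix U V assume "openin X U" "openin X V" "U \<subseteq> V"
    then show "Vp_mult X \<omega> U \<le> Vp_mult X \<omega> V"
      by (auto simp: Vp_mult_def point_continuous_valuation_def
          intro!: val_integral_mono[OF val lsc_eval lsc_eval] valuation_mono)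
  next
    show "Vp_mult X \<omega> {} = 0"
      by (simp add: Vp_mult_def, rule val_integral_zero[OF val])
        (auto simp: point_continuous_valuation_def valuation_empty)
  qed (simp add: Vp_mult_def)
  moreover have "lsc (point_topology X) (Vp_mult X \<omega>)"
    unfolding continuous_map_point_topology_iff
  proof (intro allI impI, elim conjE)
    fix U r assume U: "openin X U" "0 \<le> r" "ennreal r < Vp_mult X \<omega> U"
    have "openin (Vp (Vp X)) {\<omega> \<in> topspace (Vp (Vp X)). ennreal r < ?I U \<omega>}"
      by (rule openin_lsc[OF lsc_val_integral[OF lsc_eval[OF U(1)]]])
    from simple_below_in_open[OF this, of \<omega>]
    have "\<exists>w. weight (Vp X) w \<and> simple_val (Vp X) w \<le> \<omega> \<and> ennreal r < ?I U (simple_val (Vp X) w)"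
      using U \<omega> by (simp add: Vp_mult_def) blast
    then obtain w where w: "weight (Vp X) w" "simple_val (Vp X) w \<le> \<omega>" "ennreal r < ?I U (simple_val (Vp X) w)"
      by blast
    from lsc_integral_simple[OF w(1)]
    obtain F where F: "finite F" "F \<subseteq> U"
      "\<forall>V. openin X V \<and> F \<subseteq> V \<longrightarrow> ennreal r < ?I V (simple_val (Vp X) w)"
      unfolding continuous_map_point_topology_iff using U w(3) by metis
    then show "\<exists>F. finite F \<and> F \<subseteq> U \<and> (\<forall>V. openin X V \<and> F \<subseteq> V \<longrightarrow> ennreal r < Vp_mult X \<omega> V)"
      using val_integral_mono_valuation[OF w(2)] by (intro exI[of _ F]) (auto simp: Vp_mult_def intro: less_le_trans)
  qed
  ultimately show ?thesis by (simp add: point_continuous_valuation_def)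
qed

lemma continuous_map_Vp_mult: "continuous_map (Vp (Vp X)) (Vp X) (Vp_mult X)"
proof (rule continuous_map_into_Vp)
  fix U assume U: "openin X U"
  from lsc_val_integral[OF lsc_eval[OF this]] show "lsc (Vp (Vp X)) (\<lambda>\<omega>. Vp_mult X \<omega> U)"
    using U by (simp add: Vp_mult_def)
qed (use point_continuous_valuation_Vp_mult in auto)

lemma Vp_mult_lin:
  assumes "point_continuous_valuation (Vp X) \<omega>" "point_continuous_valuation (Vp X) \<omega>'"
  shows "Vp_mult X (val_add (val_scale r \<omega>) (val_scale s \<omega>'))
    = val_add (val_scale r (Vp_mult X \<omega>)) (val_scale s (Vp_mult X \<omega>'))"
proof (rule ext)
  fix U
  show "Vp_mult X (val_add (val_scale r \<omega>) (val_scale s \<omega>')) U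
    = val_add (val_scale r (Vp_mult X \<omega>)) (val_scale s (Vp_mult X \<omega>')) U"
  proof (cases "openin X U")
    case True
    have "val_add (val_scale r (Vp_mult X \<omega>)) (val_scale s (Vp_mult X \<omega>')) U
        = ennreal r * Vp_mult X \<omega> U + ennreal s * Vp_mult X \<omega>' U"
      by (simp add: val_add_def val_scale_def)
    then show ?thesis using True assms
      by (simp add: Vp_mult_def val_integral_lin lsc_eval point_continuous_valuation_def)
  qed (simp add: Vp_mult_def val_add_def val_scale_def)
qed

lemma Vp_mult_dirac:
  assumes "point_continuous_valuation X \<mu>"
  shows "Vp_mult X (dirac (Vp X) \<mu>) = \<mu>"
  using assms by (auto simp: Vp_mult_def val_integral_dirac lsc_eval point_continuous_valuation_def valuation_not_open)

section \<open>From algebras to cones\<close>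

text \<open>An open set meets \<open>S\<close> exactly when it meets its closure, so the hypothesis
  on \<open>S\<close> makes the closure irreducible; a generic point of the closure has the required
  neighbourhoods.\<close>

lemma generic_point:
  assumes sober: "sober_space X" and S: "S \<subseteq> topspace X" "S \<noteq> {}"
    and irr: "\<And>U V. openin X U \<Longrightarrow> openin X V \<Longrightarrow> U \<inter> S \<noteq> {} \<Longrightarrow> V \<inter> S \<noteq> {} \<Longrightarrow> U \<inter> V \<inter> S \<noteq> {}"
  shows "\<exists>x\<in>topspace X. \<forall>U. openin X U \<longrightarrow> (x \<in> U \<longleftrightarrow> U \<inter> S \<noteq> {})"
proof -
  have meet: "U \<inter> (X closure_of S) \<noteq> {} \<longleftrightarrow> U \<inter> S \<noteq> {}" if "openin X U" for U
    using openin_Int_closure_of_eq_empty[OF that] by blast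
  have "irreducible_closed X (X closure_of S)"
    unfolding irreducible_closed_def
  proof (intro conjI allI impI; (elim conjE)?)
    show "X closure_of S \<noteq> {}" using S closure_of_subset by blast
    fix A B assume AB: "closedin X A" "closedin X B" "X closure_of S \<subseteq> A \<union> B"
    show "X closure_of S \<subseteq> A \<or> X closure_of S \<subseteq> B"
    proof (rule ccontr)
      assume "\<not> (X closure_of S \<subseteq> A \<or> X closure_of S \<subseteq> B)"
      then have "\<not> S \<subseteq> A" "\<not> S \<subseteq> B" using AB closure_of_minimal by blast+
      then have "(topspace X - A) \<inter> S \<noteq> {}" "(topspace X - B) \<inter> S \<noteq> {}" using S by auto
      then have "(topspace X - A) \<inter> (topspace X - B) \<inter> S \<noteq> {}" using AB by (intro irr) auto
      then show False using AB(3) S closure_of_subset by fastforce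
    qed
  qed auto
  then obtain x where x: "x \<in> topspace X" "X closure_of S = X closure_of {x}"
    using sober unfolding sober_space_def by blast
  have "x \<in> U \<longleftrightarrow> U \<inter> S \<noteq> {}" if "openin X U" for U
    using meet[OF that] openin_Int_closure_of_eq_empty[OF that, of "{x}"] x by auto
  then show ?thesis using x by blast
qed

lemma linear_between_cod:
  assumes "linear_between C addC scaleC D addD scaleD f" "x \<in> C"
  shows "f x \<in> D"
  using assms unfolding linear_between_def by blast

lemma linear_between_comp:
  assumes f: "linear_between (topspace (Vp X)) val_add val_scale D addD scaleD f"
    and g: "\<And>\<omega>. point_continuous_valuation Y \<omega> \<Longrightarrow> point_continuous_valuation X (g \<omega>)"
    and lin: "\<And>\<omega> \<omega>' r s. point_continuous_valuation Y \<omega> \<Longrightarrow> point_continuous_valuation Y \<omega>' \<Longrightarrow>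
      g (val_add (val_scale r \<omega>) (val_scale s \<omega>')) = val_add (val_scale r (g \<omega>)) (val_scale s (g \<omega>'))"
  shows "linear_between (topspace (Vp Y)) val_add val_scale D addD scaleD (\<lambda>\<omega>. f (g \<omega>))"
  unfolding linear_between_def
  by (auto simp: lin g linear_betweenD[OF f] linear_between_cod[OF f])

text \<open>Both sides of the multiplication law are linear and continuous on
  \<open>Vp (Vp C)\<close>. At the Dirac mass of \<mu> the left side flattens to \<beta>(\<mu>), and
  the right side is \<beta> of the Dirac mass at \<beta>(\<mu>), which is the same point by the unit
  law.\<close>

lemma linear_retraction_algebra:
  assumes C: "t0_space C" and cont: "continuous_map (Vp C) C \<beta>"
    and lin: "linear_on_Vp C add smul \<beta>" and unit: "\<And>x. x \<in> topspace C \<Longrightarrow> \<beta> (dirac C x) = x"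
  shows "Vp_algebra C \<beta>"
proof -
  have "\<beta> (Vp_mult C \<omega>) = \<beta> (Vp_map (Vp C) C \<beta> \<omega>)" if "\<omega> \<in> topspace (Vp (Vp C))" for \<omega>
  proof (rule linear_continuous_unique[where X = "Vp C" and Y = C and f = "\<lambda>\<omega>. \<beta> (Vp_mult C \<omega>)"
        and g = "\<lambda>\<omega>. \<beta> (Vp_map (Vp C) C \<beta> \<omega>)"])
    show "linear_between (topspace (Vp (Vp C))) val_add val_scale (topspace C) add smul (\<lambda>\<omega>. \<beta> (Vp_mult C \<omega>))"
      by (rule linear_between_comp[OF lin point_continuous_valuation_Vp_mult Vp_mult_lin])
    show "linear_between (topspace (Vp (Vp C))) val_add val_scale (topspace C) add smul
       (\<lambda>\<omega>. \<beta> (Vp_map (Vp C) C \<beta> \<omega>))"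
      by (rule linear_between_comp[OF lin point_continuous_valuation_Vp_map[OF cont] Vp_map_lin])
    show "continuous_map (Vp (Vp C)) C (\<lambda>\<omega>. \<beta> (Vp_mult C \<omega>))"
      using continuous_map_compose[OF continuous_map_Vp_mult cont] by (simp add: o_def)
    show "continuous_map (Vp (Vp C)) C (\<lambda>\<omega>. \<beta> (Vp_map (Vp C) C \<beta> \<omega>))"
      using continuous_map_compose[OF continuous_map_Vp_map[OF cont] cont] by (simp add: o_def)
    show "\<beta> (Vp_mult C (dirac (Vp C) \<mu>)) = \<beta> (Vp_map (Vp C) C \<beta> (dirac (Vp C) \<mu>))"
      if "\<mu> \<in> topspace (Vp C)" for \<mu>
      using that linear_between_cod[OF lin that] by (simp add: Vp_mult_dirac Vp_map_dirac[OF cont] unit)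
  qed (use C that topspace_Vp_nonempty in auto)
  then show ?thesis using assms by (simp add: Vp_algebra_def)
qed

section \<open>The structure carried by a fixed algebra\<close>

locale Vp_algebra_loc =
  fixes X :: "'a topology" and \<alpha> :: "('a set \<Rightarrow> ennreal) \<Rightarrow> 'a"
  assumes algebra: "Vp_algebra X \<alpha>"
begin

abbreviation "aplus \<equiv> (\<lambda>x y. \<alpha> (val_add (dirac X x) (dirac X y)))"
abbreviation "ascale \<equiv> (\<lambda>r x. \<alpha> (val_scale r (dirac X x)))"

lemma t0: "t0_space X"
  and cont: "continuous_map (Vp X) X \<alpha>"
  and unit: "\<And>x. x \<in> topspace X \<Longrightarrow> \<alpha> (dirac X x) = x"
  and mult: "\<And>\<omega>. \<omega> \<in> topspace (Vp (Vp X)) \<Longrightarrow> \<alpha> (Vp_mult X \<omega>) = \<alpha> (Vp_map (Vp X) X \<alpha> \<omega>)"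
  using algebra unfolding Vp_algebra_def by auto

lemma closed: "point_continuous_valuation X \<mu> \<Longrightarrow> \<alpha> \<mu> \<in> topspace X"
  using continuous_map_image_subset_topspace[OF cont] by auto

text \<open>The multiplication law is evaluated at a combination of the Dirac masses of \<mu> and
  \<nu> in \<open>Vp (Vp X)\<close>: multiplication flattens it, while the image under \<alpha>
  replaces \<mu> and \<nu> by the Dirac masses of their values. All linearity of \<alpha> stems from
  this identity.\<close>

lemma \<alpha>_lin_dirac:
  assumes \<mu>: "point_continuous_valuation X \<mu>" and \<nu>: "point_continuous_valuation X \<nu>"
  shows "\<alpha> (val_add (val_scale r \<mu>) (val_scale s \<nu>))
    = \<alpha> (val_add (val_scale r (dirac X (\<alpha> \<mu>))) (val_scale s (dirac X (\<alpha> \<nu>))))"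
proof -
  have d: "point_continuous_valuation (Vp X) (dirac (Vp X) \<mu>)" "point_continuous_valuation (Vp X) (dirac (Vp X) \<nu>)"
    using \<mu> \<nu> by (auto intro!: point_continuous_valuation_dirac)
  let ?\<omega> = "val_add (val_scale r (dirac (Vp X) \<mu>)) (val_scale s (dirac (Vp X) \<nu>))"
  have "\<alpha> (Vp_mult X ?\<omega>) = \<alpha> (Vp_map (Vp X) X \<alpha> ?\<omega>)"
    using point_continuous_valuation_lin[OF d] by (intro mult) simp
  then show ?thesis
    using \<mu> \<nu> by (simp add: Vp_mult_lin[OF d] Vp_map_lin Vp_mult_dirac Vp_map_dirac[OF cont])
qed

lemma \<alpha>_add:
  "point_continuous_valuation X \<mu> \<Longrightarrow> point_continuous_valuation X \<nu> \<Longrightarrow> \<alpha> (val_add \<mu> \<nu>) = aplus (\<alpha> \<mu>) (\<alpha> \<nu>)"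
  using \<alpha>_lin_dirac[of \<mu> \<nu> 1 1] by simp

lemma \<alpha>_scale:
  assumes "point_continuous_valuation X \<mu>"
  shows "\<alpha> (val_scale r \<mu>) = ascale r (\<alpha> \<mu>)"
proof -
  have "val_add (val_scale r \<mu>) (val_scale 0 \<mu>) = val_scale r \<mu>" for \<mu> :: "'a set \<Rightarrow> ennreal"
    by (simp add: val_add_def val_scale_def)
  then show ?thesis using \<alpha>_lin_dirac[OF assms assms, of r 0] by simp
qed

lemma linear: "linear_on_Vp X aplus ascale \<alpha>"
  unfolding linear_between_def
proof (intro conjI ballI allI impI)
  fix \<mu> \<nu> and r s :: real assume "\<mu> \<in> topspace (Vp X)" "\<nu> \<in> topspace (Vp X)"
  then have \<mu>: "point_continuous_valuation X \<mu>" and \<nu>: "point_continuous_valuation X \<nu>" by auto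
  show "\<alpha> (val_add (val_scale r \<mu>) (val_scale s \<nu>)) = aplus (ascale r (\<alpha> \<mu>)) (ascale s (\<alpha> \<nu>))"
    unfolding \<alpha>_scale[OF \<mu>, symmetric] \<alpha>_scale[OF \<nu>, symmetric]
    by (intro \<alpha>_add point_continuous_valuation_scale \<mu> \<nu>)
qed (use closed in auto)

lemma cone: "abstract_cone (topspace X) aplus (\<alpha> (\<lambda>U. 0)) ascale"
proof -
  note pcv = point_continuous_valuation_dirac point_continuous_valuation_add point_continuous_valuation_scale
  have z: "point_continuous_valuation X (\<lambda>U. 0)"
    using point_continuous_valuation_simple_val[OF weight_zero] by (simp add: simple_val_zero)
  \<comment> \<open>Read from left to right, \<open>add'\<close> and \<open>scale'\<close> move
    \<alpha> outwards, so a cone law reduces to the same law for pointwise operations on valuations;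
    \<open>ex\<close> represents each element as a value of \<alpha>.\<close>
  have add': "aplus (\<alpha> \<mu>) (\<alpha> \<nu>) = \<alpha> (val_add \<mu> \<nu>)"
    if "point_continuous_valuation X \<mu>" "point_continuous_valuation X \<nu>" for \<mu> \<nu>
    using that \<alpha>_add by simp
  have scale': "ascale r (\<alpha> \<mu>) = \<alpha> (val_scale r \<mu>)" if "point_continuous_valuation X \<mu>" for r \<mu>
    using that \<alpha>_scale by simp
  have ex: "\<exists>\<mu>. point_continuous_valuation X \<mu> \<and> x = \<alpha> \<mu>" if "x \<in> topspace X" for x
    using unit[OF that] point_continuous_valuation_dirac[OF that] by metis
  show ?thesis
  proof
    fix x y u assume "x \<in> topspace X" "y \<in> topspace X" "u \<in> topspace X"
    then obtain \<mu> \<nu> \<rho> where *: "point_continuous_valuation X \<mu>" "x = \<alpha> \<mu>"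
      "point_continuous_valuation X \<nu>" "y = \<alpha> \<nu>" "point_continuous_valuation X \<rho>" "u = \<alpha> \<rho>"
      using ex by meson
    then show "aplus (aplus x y) u = aplus x (aplus y u)"
      by (simp add: add' pcv) (simp add: val_add_def add.assoc)
  next
    fix x y assume "x \<in> topspace X" "y \<in> topspace X"
    then show "aplus x y = aplus y x" by (simp add: val_add_def add.commute)
  next
    fix r x y assume "(0::real) \<le> r" "x \<in> topspace X" "y \<in> topspace X"
    then obtain \<mu> \<nu> where "point_continuous_valuation X \<mu>" "x = \<alpha> \<mu>"
      "point_continuous_valuation X \<nu>" "y = \<alpha> \<nu>"
      using ex by meson
    then show "ascale r (aplus x y) = aplus (ascale r x) (ascale r y)"
      by (simp add: add' scale' pcv) (simp add: val_add_def val_scale_def distrib_left)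
  next
    fix r s :: real and x assume "0 \<le> r" "0 \<le> s" "x \<in> topspace X"
    then show "ascale (r + s) x = aplus (ascale r x) (ascale s x)" "ascale (r * s) x = ascale r (ascale s x)"
      by (simp_all add: add' scale' pcv) (simp_all add: val_add_def val_scale_def distrib_right ennreal_mult mult.assoc)
  next
    fix x assume "x \<in> topspace X"
    then obtain \<mu> where "point_continuous_valuation X \<mu>" "x = \<alpha> \<mu>" using ex by meson
    then show "aplus (\<alpha> (\<lambda>U. 0)) x = x" "ascale 1 x = x" "ascale 0 x = \<alpha> (\<lambda>U. 0)"
      by (simp_all add: add' scale' z unit closed) (simp_all add: val_add_def val_scale_def)
  next
    fix r :: real
    show "ascale r (\<alpha> (\<lambda>U. 0)) = \<alpha> (\<lambda>U. 0)" by (simp add: scale' z) (simp add: val_scale_def)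
  qed (auto intro!: closed pcv z)
qed

lemma topological: "topological_cone X aplus (\<alpha> (\<lambda>U. 0)) ascale"
proof -
  have lsc_dirac: "lsc X (\<lambda>x. dirac X x U)" for U
  proof -
    have "{x \<in> topspace X. ennreal r < dirac X x U} = (if openin X U \<and> r < 1 then U else {})" if "0 \<le> r" for r
      using that openin_subset[of X U] by (auto simp: dirac_def ennreal_less_one_iff)
    then show ?thesis by (auto simp: continuous_map_scott_ennreal_iff)
  qed
  have "continuous_map (prod_topology X X) (Vp X) (\<lambda>p. val_add (dirac X (fst p)) (dirac X (snd p)))"
  proof (rule continuous_map_into_Vp)
    fix U
    have "lsc (prod_topology X X) (\<lambda>p. dirac X (fst p) U)" "lsc (prod_topology X X) (\<lambda>p. dirac X (snd p) U)"
      using continuous_map_compose[OF continuous_map_fst lsc_dirac]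
        continuous_map_compose[OF continuous_map_snd lsc_dirac] by (auto simp: o_def)
    then show "lsc (prod_topology X X) (\<lambda>p. val_add (dirac X (fst p)) (dirac X (snd p)) U)"
      unfolding val_add_def by (rule lsc_add)
  qed (auto intro!: point_continuous_valuation_add point_continuous_valuation_dirac)
  from continuous_map_compose[OF this cont]
  have plus: "continuous_map (prod_topology X X) X (\<lambda>(x, y). aplus x y)"
    by (simp add: o_def case_prod_unfold)
  have "continuous_map (prod_topology scott_nnreal X) (Vp X) (\<lambda>p. val_scale (fst p) (dirac X (snd p)))"
  proof (rule continuous_map_into_Vp)
    fix U assume U: "openin X U"
    show "lsc (prod_topology scott_nnreal X) (\<lambda>p. val_scale (fst p) (dirac X (snd p)) U)"
      unfolding continuous_map_scott_ennreal_iff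
    proof (intro allI impI)
      fix r :: real assume r: "0 \<le> r"
      \<comment> \<open>For nonnegative \<open>r\<close>, the multiple by t of a Dirac mass at x
        exceeds \<open>r\<close> on \<open>U\<close> exactly when t > r and x \<in> U; the
        superlevel set is thus an open box.\<close>
      have "{p \<in> topspace (prod_topology scott_nnreal X). ennreal r < val_scale (fst p) (dirac X (snd p)) U} = {r<..} \<times> U"
        using r openin_subset[OF U] by (auto simp: val_scale_def dirac_def U ennreal_less_iff split: if_splits)
      moreover have "openin scott_nnreal {r<..}" using r by (auto simp: openin_scott_nnreal)
      ultimately show "openin (prod_topology scott_nnreal X)
          {p \<in> topspace (prod_topology scott_nnreal X). ennreal r < val_scale (fst p) (dirac X (snd p)) U}"
        using U by (simp add: openin_prod_Times_iff)
    qed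
  qed (auto intro!: point_continuous_valuation_scale point_continuous_valuation_dirac)
  from continuous_map_compose[OF this cont]
  have times: "continuous_map (prod_topology scott_nnreal X) X (\<lambda>(r, x). ascale r x)"
    by (simp add: o_def case_prod_unfold)
  show ?thesis unfolding topological_cone_def using cone t0 plus times by blast
qed

text \<open>A basic neighbourhood of the Dirac mass of a point is convex, being cut out by strict
  lower bounds, and so is its image under the linear map \<alpha>. The image is not claimed to be
  open; it contains an open set of points whose Dirac masses lie in the neighbourhood, which is why
  local convexity comes out in its weak form.\<close>

lemma wlc: "weakly_locally_convex X aplus ascale"
  unfolding weakly_locally_convex_def
proof (intro allI impI, elim conjE)
  fix x U assume U: "openin X U" "x \<in> U"
  then have x: "x \<in> topspace X" using openin_subset by blast
  have op: "openin (Vp X) {\<mu> \<in> topspace (Vp X). \<alpha> \<mu> \<in> U}" using cont U(1) by (auto simp: continuous_map_def)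
  have "dirac X x \<in> {\<mu> \<in> topspace (Vp X). \<alpha> \<mu> \<in> U}" using dirac_in_Vp[OF x] unit[OF x] U by simp
  from Vp_nhd[OF op this] obtain P where P: "finite P"
    "\<forall>(U, r)\<in>P. openin X U \<and> 0 \<le> r \<and> ennreal r < dirac X x U"
    "\<forall>\<mu>. point_continuous_valuation X \<mu> \<and> (\<forall>(U, r)\<in>P. ennreal r < \<mu> U) \<longrightarrow>
      \<mu> \<in> {\<mu> \<in> topspace (Vp X). \<alpha> \<mu> \<in> U}" by blast
  define W where "W = {\<mu>. point_continuous_valuation X \<mu> \<and> (\<forall>(U, r)\<in>P. ennreal r < \<mu> U)}"
  \<comment> \<open>Each condition (A, r) in \<open>P\<close> gives r < 1 and x \<in> A, so it also
    holds for the Dirac mass at any other point of A.\<close>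
  define V where "V = topspace X \<inter> (\<Inter>(U, r)\<in>P. U)"
  have less_convex: "ennreal r < ennreal t * a + ennreal (1 - t) * b"
    if "ennreal r < a" "ennreal r < b" "0 \<le> t" "t \<le> 1" for r t a b
  proof -
    have "ennreal r < min a b" using that by simp
    also have "\<dots> = (ennreal t + ennreal (1 - t)) * min a b" using that by (simp flip: ennreal_plus)
    also have "\<dots> \<le> ennreal t * a + ennreal (1 - t) * b"
      unfolding distrib_right by (intro add_mono mult_left_mono) auto
    finally show ?thesis .
  qed
  have "cone_convex aplus ascale (\<alpha> ` W)"
    unfolding cone_convex_def
  proof (intro ballI)
    fix a b and t :: real assume ab: "a \<in> \<alpha> ` W" "b \<in> \<alpha> ` W" and t: "t \<in> {0..1}"
    then obtain \<mu> \<nu> where *: "\<mu> \<in> W" "a = \<alpha> \<mu>" "\<nu> \<in> W" "b = \<alpha> \<nu>" by blast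
    let ?\<rho> = "val_add (val_scale t \<mu>) (val_scale (1 - t) \<nu>)"
    have "point_continuous_valuation X ?\<rho>" using * by (auto simp: W_def intro: point_continuous_valuation_lin)
    then have "?\<rho> \<in> W" using * t less_convex unfolding W_def
      by (auto simp: val_add_def val_scale_def split_beta)
    moreover have "\<alpha> ?\<rho> = aplus (ascale t a) (ascale (1 - t) b)"
      using linear_betweenD[OF linear, of \<mu> \<nu> t "1 - t"] * t by (simp add: W_def)
    ultimately show "aplus (ascale t a) (ascale (1 - t) b) \<in> \<alpha> ` W" by (metis imageI)
  qed
  moreover have "openin X V"
  proof -
    have "V = \<Inter>(insert (topspace X) (fst ` P))" by (auto simp: V_def)
    moreover have "openin X (\<Inter>(insert (topspace X) (fst ` P)))" using P(1,2) by (intro openin_Inter) auto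
    ultimately show ?thesis by simp
  qed
  moreover have "x \<in> V" using P(2) x by (auto simp: V_def dirac_def split: if_splits)
  moreover have "V \<subseteq> \<alpha> ` W"
  proof
    fix y assume y: "y \<in> V"
    have yX: "y \<in> topspace X" using y by (simp add: V_def)
    have "ennreal r < dirac X y A" if "(A, r) \<in> P" for A r
    proof -
      have "y \<in> A" "openin X A" "ennreal r < dirac X x A" using y P(2) that by (auto simp: V_def)
      then show ?thesis by (auto simp: dirac_def split: if_splits intro: le_less_trans)
    qed
    then have "dirac X y \<in> W" using point_continuous_valuation_dirac[OF yX] by (auto simp: W_def)
    then show "y \<in> \<alpha> ` W" using unit[OF yX] by (metis imageI)
  qed
  moreover have "\<alpha> ` W \<subseteq> U" using P(3) by (auto simp: W_def)
  ultimately show "\<exists>A V. cone_convex aplus ascale A \<and> openin X V \<and> x \<in> V \<and> V \<subseteq> A \<and> A \<subseteq> U" by blast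
qed

text \<open>An irreducible closed set \<open>F\<close> defines a \<open>{0,1}\<close>-valued valuation, and \<open>\<alpha>\<close> maps it to the
  generic point of \<open>F\<close>.\<close>

lemma sober: "sober_space X"
  unfolding sober_space_def
proof (intro allI impI)
  fix F assume "irreducible_closed X F"
  then have F: "closedin X F" "F \<noteq> {}"
    and irr: "\<And>A B. closedin X A \<Longrightarrow> closedin X B \<Longrightarrow> F \<subseteq> A \<union> B \<Longrightarrow> F \<subseteq> A \<or> F \<subseteq> B"
    unfolding irreducible_closed_def by blast+
  have FX: "F \<subseteq> topspace X" using F closedin_subset by blast
  have meet: "U \<inter> V \<inter> F \<noteq> {}" if "openin X U" "openin X V" "U \<inter> F \<noteq> {}" "V \<inter> F \<noteq> {}" for U V
    using irr[of "topspace X - U" "topspace X - V"] that FX by blast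
  define \<nu> :: "'a set \<Rightarrow> ennreal" where "\<nu> U = (if openin X U \<and> U \<inter> F \<noteq> {} then 1 else 0)" for U
  have "valuation X \<nu>" unfolding valuation_def
  proof (intro conjI allI impI; (elim conjE)?)
    fix U V assume UV: "openin X U" "openin X V"
    show "\<nu> U + \<nu> V = \<nu> (U \<union> V) + \<nu> (U \<inter> V)"
    proof (cases "U \<inter> F \<noteq> {} \<and> V \<inter> F \<noteq> {}")
      case True
      then have "(U \<union> V) \<inter> F \<noteq> {}" "U \<inter> V \<inter> F \<noteq> {}" using meet[OF UV] by blast+
      then show ?thesis using True UV by (simp add: \<nu>_def openin_Un openin_Int)
    next
      case False
      then have "U \<inter> V \<inter> F = {}" "(U \<union> V) \<inter> F \<noteq> {} \<longleftrightarrow> U \<inter> F \<noteq> {} \<or> V \<inter> F \<noteq> {}" by blast+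
      then show ?thesis using False UV by (auto simp: \<nu>_def openin_Un openin_Int)
    qed
  next
    fix U V assume "openin X U" "openin X V" "U \<subseteq> V"
    then show "\<nu> U \<le> \<nu> V" by (auto simp: \<nu>_def)
  qed (auto simp: \<nu>_def)
  moreover have "lsc (point_topology X) \<nu>" unfolding continuous_map_point_topology_iff
  proof (intro allI impI, elim conjE)
    fix U r assume U: "openin X U" "0 \<le> r" "ennreal r < \<nu> U"
    then obtain x where x: "x \<in> U" "x \<in> F" by (auto simp: \<nu>_def split: if_splits)
    have "ennreal r < 1" using U by (auto simp: \<nu>_def split: if_splits)
    then show "\<exists>F. finite F \<and> F \<subseteq> U \<and> (\<forall>V. openin X V \<and> F \<subseteq> V \<longrightarrow> ennreal r < \<nu> V)"
      using x by (intro exI[of _ "{x}"]) (auto simp: \<nu>_def)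
  qed
  ultimately have \<nu>: "point_continuous_valuation X \<nu>" by (simp add: point_continuous_valuation_def)
  define x where "x = \<alpha> \<nu>"
  have x: "x \<in> topspace X" unfolding x_def by (rule closed[OF \<nu>])
  have iff: "x \<in> U \<longleftrightarrow> U \<inter> F \<noteq> {}" if U: "openin X U" for U
  proof -
    have op: "openin (Vp X) {\<mu> \<in> topspace (Vp X). \<alpha> \<mu> \<in> U}" using cont U by (auto simp: continuous_map_def)
    show ?thesis
    proof
      assume "x \<in> U"
      then have "\<nu> \<in> {\<mu> \<in> topspace (Vp X). \<alpha> \<mu> \<in> U}" using \<nu> by (simp add: x_def)
      from Vp_nhd[OF op this] obtain P where P: "finite P"
        "\<forall>(U, r)\<in>P. openin X U \<and> 0 \<le> r \<and> ennreal r < \<nu> U"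
        "\<forall>\<mu>. point_continuous_valuation X \<mu> \<and> (\<forall>(U, r)\<in>P. ennreal r < \<mu> U) \<longrightarrow>
          \<mu> \<in> {\<mu> \<in> topspace (Vp X). \<alpha> \<mu> \<in> U}" by blast
      \<comment> \<open>Irreducibility, iterated over finitely many open sets meeting
        \<open>F\<close>, yields a common point in \<open>F\<close>. Its Dirac mass satisfies all
        conditions in \<open>P\<close>, so \<alpha> sends it, and this is the point itself, into
        \<open>U\<close>. The subsets \<open>Q\<close> carry the induction.\<close>
      have "\<exists>y\<in>F. \<forall>(A, r)\<in>Q. y \<in> A" if "Q \<subseteq> P" for Q
      proof -
        have "finite Q" using that P(1) finite_subset by blast
        then have "openin X (topspace X \<inter> (\<Inter>(A, r)\<in>Q. A)) \<and> (topspace X \<inter> (\<Inter>(A, r)\<in>Q. A)) \<inter> F \<noteq> {}"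
          using that
        proof (induction Q)
          case empty
          then show ?case using F FX by auto
        next
          case (insert q Q)
          obtain A r where q: "q = (A, r)" by (cases q)
          have A: "openin X A" "A \<inter> F \<noteq> {}" using insert.prems P(2) q by (auto simp: \<nu>_def split: if_splits)
          have eq: "topspace X \<inter> (\<Inter>(A, r)\<in>insert q Q. A) = A \<inter> (topspace X \<inter> (\<Inter>(A, r)\<in>Q. A))"
            using q by auto
          show ?case unfolding eq using meet[OF A(1) _ A(2)] insert A(1) by (auto intro!: openin_Int)
        qed
        then show ?thesis by blast
      qed
      then obtain y where y: "y \<in> F" "\<forall>(A, r)\<in>P. y \<in> A" by blast
      have yX: "y \<in> topspace X" using y FX by blast
      have "ennreal r < dirac X y A" if "(A, r) \<in> P" for A r
        using P(2) y(2) that by (auto simp: dirac_def \<nu>_def split: if_splits)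
      then have "dirac X y \<in> {\<mu> \<in> topspace (Vp X). \<alpha> \<mu> \<in> U}"
        using P(3) point_continuous_valuation_dirac[OF yX] by blast
      then show "U \<inter> F \<noteq> {}" using unit[OF yX] y by auto
    next
      assume "U \<inter> F \<noteq> {}"
      then obtain y where y: "y \<in> U" "y \<in> F" by blast
      have yX: "y \<in> topspace X" using y FX by blast
      have "dirac X y \<in> {\<mu> \<in> topspace (Vp X). \<alpha> \<mu> \<in> U}"
        using dirac_in_Vp[OF yX] unit[OF yX] y by simp
      \<comment> \<open>Every open set containing a point of \<open>F\<close> has \<nu>-value 1, so
        \<nu> dominates the Dirac masses of \<open>F\<close> and inherits their membership in open
        sets.\<close>
      moreover have "dirac X y \<le> \<nu>" using y by (auto simp: le_fun_def dirac_def \<nu>_def)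
      ultimately show "x \<in> U" using Vp_upward_closed[OF op] \<nu> by (auto simp: x_def)
    qed
  qed
  have "F = X closure_of {x}"
  proof
    show "F \<subseteq> X closure_of {x}" using iff FX by (auto simp: in_closure_of)
    show "X closure_of {x} \<subseteq> F"
      using iff[of "topspace X - F"] F x by (intro closure_of_minimal) auto
  qed
  moreover have "y = x" if "y \<in> topspace X" "F = X closure_of {y}" for y
    using t0 that x \<open>F = X closure_of {x}\<close> by (simp add: t0_space_closure_of_sing)
  ultimately show "\<exists>!x. x \<in> topspace X \<and> F = X closure_of {x}" using x by blast
qed

text \<open>Both the composite of \<Lambda> with \<alpha> and integration of \<Lambda> are linear
  and continuous on \<open>Vp X\<close>, and both send the Dirac mass at a point x to
  \<Lambda>(x).\<close>

lemma barycentre: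
  assumes \<nu>: "point_continuous_valuation X \<nu>"
  shows "barycentre X aplus ascale \<nu> (\<alpha> \<nu>)"
  unfolding barycentre_def
proof (intro conjI allI impI; (elim conjE)?)
  show "\<alpha> \<nu> \<in> topspace X" by (rule closed[OF \<nu>])
  fix \<Lambda> assume lin: "linear_functional (topspace X) aplus ascale \<Lambda>" and lsc: "lsc X \<Lambda>"
  show "\<Lambda> (\<alpha> \<nu>) = val_integral X \<Lambda> \<nu>"
  proof (rule linear_continuous_unique[where X = X and Y = scott_ennreal and f = "\<lambda>\<nu>. \<Lambda> (\<alpha> \<nu>)" and g = "val_integral X \<Lambda>"])
    show "linear_between (topspace (Vp X)) val_add val_scale UNIV (+) (\<lambda>r t. ennreal r * t) (\<lambda>\<nu>. \<Lambda> (\<alpha> \<nu>))"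
      unfolding linear_between_def[of "topspace (Vp X)"]
      using linear_betweenD[OF linear] linear_betweenD[OF lin] closed by auto
    show "lsc (Vp X) (\<lambda>\<nu>. \<Lambda> (\<alpha> \<nu>))" using continuous_map_compose[OF cont lsc] by (simp add: o_def)
    show "topspace X \<noteq> {}" using closed[OF \<nu>] by blast
  qed (use linear_val_integral[OF lsc] lsc_val_integral[OF lsc] t0_space_scott_ennreal \<nu> in
      \<open>auto simp: unit val_integral_dirac[OF lsc]\<close>)
qed

end

section \<open>A transportation lemma\<close>

text \<open>The fractional form of Hall's marriage theorem. The pairs of \<open>R\<close> are treated one after
  another, and each carries as much as the Hall condition for the remaining problem permits.\<close>

lemma transport:
  fixes d :: "'i \<Rightarrow> real" and s :: "'j \<Rightarrow> real"
  assumes "finite R" and I: "finite I" and J: "finite J" and "R \<subseteq> I \<times> J"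
    and "\<And>i. i \<in> I \<Longrightarrow> 0 \<le> d i" "\<And>j. j \<in> J \<Longrightarrow> 0 \<le> s j"
    and "\<And>A. A \<subseteq> I \<Longrightarrow> sum d A \<le> sum s (R `` A)"
  shows "\<exists>t. (\<forall>i j. 0 \<le> t i j) \<and> (\<forall>i j. (i, j) \<notin> R \<longrightarrow> t i j = 0) \<and>
    (\<forall>i\<in>I. (\<Sum>j\<in>J. t i j) = d i) \<and> (\<forall>j\<in>J. (\<Sum>i\<in>I. t i j) \<le> s j)"
  using assms(1,4-)
proof (induction R arbitrary: d s)
  case empty
  have "sum d I = 0" using empty(2) empty(4)[of I] sum_nonneg[of I d] by auto
  then have "\<forall>i\<in>I. d i = 0" using I empty(2) by (simp add: sum_nonneg_eq_0_iff)
  then show ?case using empty by (intro exI[of _ "\<lambda>i j. 0"]) auto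
next
  case (insert p R)
  obtain i j where p: "p = (i, j)" by (cases p)
  have R: "R \<subseteq> I \<times> J" and i: "i \<in> I" and j: "j \<in> J" and ij: "(i, j) \<notin> R"
    using insert.prems(1) insert.hyps p by auto
  note d0 = insert.prems(2) and s0 = insert.prems(3)
  have hall: "sum d A \<le> sum s (insert (i, j) R `` A)" if "A \<subseteq> I" for A
    using insert.prems(4)[OF that] p by simp
  have N: "insert (i, j) R `` A = (if i \<in> A then insert j (R `` A) else R `` A)" for A by auto
  have NJ: "R `` A \<subseteq> J" for A using R by auto
  have finN: "finite (R `` A)" for A using NJ J finite_subset by blast
  \<comment> \<open>With \<open>d\<close> as demand and \<open>s\<close> as capacity: for these
    sets, sending an amount along (i, j) consumes capacity in the neighbourhood without reducing
    demand. Their slack therefore limits the amount, as do \<open>d i\<close> and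
    \<open>s j\<close>.\<close>
  define \<T> where "\<T> = {A. A \<subseteq> I \<and> i \<notin> A \<and> j \<in> R `` A}"
  define E where "E = {d i, s j} \<union> (\<lambda>A. sum s (R `` A) - sum d A) ` \<T>"
  have "finite \<T>" unfolding \<T>_def using I by simp
  then have E: "finite E" "E \<noteq> {}" unfolding E_def by auto
  have E0: "0 \<le> e" if "e \<in> E" for e
  proof -
    have "0 \<le> sum s (R `` A) - sum d A" if "A \<in> \<T>" for A
      using that hall[of A] N[of A] by (simp add: \<T>_def)
    then show ?thesis using that d0[OF i] s0[OF j] unfolding E_def by blast
  qed
  define e where "e = Min E"
  have "e \<in> E" unfolding e_def by (rule Min_in[OF E])
  have e_le: "e \<le> x" if "x \<in> E" for x unfolding e_def by (rule Min_le[OF E(1) that])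
  have e0: "0 \<le> e" by (rule E0[OF \<open>e \<in> E\<close>])
  have ed: "e \<le> d i" and es: "e \<le> s j" by (rule e_le, simp add: E_def)+
  have eT: "e \<le> sum s (R `` A) - sum d A" if "A \<in> \<T>" for A
    by (rule e_le) (use that in \<open>simp add: E_def\<close>)
  define d' where "d' = d(i := d i - e)"
  define s' where "s' = s(j := s j - e)"
  have sd': "sum d' A = sum d A - (if i \<in> A then e else 0)" if "A \<subseteq> I" for A
  proof -
    have "finite A" using that I finite_subset by blast
    then show ?thesis unfolding d'_def by (cases "i \<in> A") (auto simp: sum.remove intro!: sum.cong)
  qed
  have ss': "sum s' B = sum s B - (if j \<in> B then e else 0)" if "finite B" for B
    using that unfolding s'_def by (cases "j \<in> B") (auto simp: sum.remove intro!: sum.cong)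
  have smono: "sum s B \<le> sum s B'" if "B \<subseteq> B'" "B' \<subseteq> J" for B B'
    using that s0 J by (intro sum_mono2) (auto intro: finite_subset)
  have hall': "sum d' A \<le> sum s' (R `` A)" if A: "A \<subseteq> I" for A
  proof (cases "i \<in> A")
    case False
    then have "j \<in> R `` A \<Longrightarrow> e \<le> sum s (R `` A) - sum d A" using eT[of A] A by (simp add: \<T>_def)
    then show ?thesis using hall[OF A] N[of A] False
      unfolding sd'[OF A] ss'[OF finN] by (cases "j \<in> R `` A") (simp_all del: Image_iff)
  next
    case True
    show ?thesis
    proof (cases "j \<in> R `` A")
      case True
      then show ?thesis using hall[OF A] N[of A] \<open>i \<in> A\<close>
        by (simp add: sd'[OF A] ss'[OF finN] insert_absorb)
    next
      case False
      \<comment> \<open>Dropping the pair (i, j) loses \<open>j\<close> as a neighbour of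
        \<open>A\<close>. The case distinction follows the bound at which the minimum
        \<open>e\<close> is attained: either \<open>i\<close> is served completely, or
        \<open>j\<close> is exhausted, or some set \<open>B\<close> becomes tight.\<close>
      have "sum d A - e \<le> sum s (R `` A)"
        using \<open>e \<in> E\<close> unfolding E_def
      proof (elim UnE)
        assume "e \<in> {d i, s j}"
        then show ?thesis
        proof (elim insertE)
          assume "e = d i"
          then have "sum d A - e = sum d (A - {i})"
            using True A I by (simp add: sum.remove[of A i] finite_subset)
          also have "\<dots> \<le> sum s (R `` (A - {i}))" using hall[of "A - {i}"] N[of "A - {i}"] A by auto
          also have "\<dots> \<le> sum s (R `` A)" by (intro smono NJ) auto
          finally show ?thesis .
        next
          assume "e = s j"
          then show ?thesis using hall[OF A] N[of A] True False finN by simp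
        qed simp
      next
        assume "e \<in> (\<lambda>A. sum s (R `` A) - sum d A) ` \<T>"
        then obtain B where B: "B \<subseteq> I" "i \<notin> B" "j \<in> R `` B" "e = sum s (R `` B) - sum d B"
          unfolding \<T>_def by auto
        have fin: "finite A" "finite B" using A B I finite_subset by blast+
        \<comment> \<open>Uncrossing: Hall's condition for the union and the intersection, together
          with submodularity of the neighbourhood function, transfers tightness of \<open>B\<close>
          to the bound for \<open>A\<close>. In the union, \<open>j\<close> is already a neighbour
          through \<open>B\<close>; the intersection does not contain \<open>i\<close>.\<close>
        have "sum d A + sum d B = sum d (A \<union> B) + sum d (A \<inter> B)"
          using sum.union_inter[OF fin, of d] by simp
        also have "sum d (A \<union> B) \<le> sum s (R `` A \<union> R `` B)"
          using hall[of "A \<union> B"] N[of "A \<union> B"] A B True by (auto simp: Image_Un insert_absorb)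
        also have "sum d (A \<inter> B) \<le> sum s (R `` (A \<inter> B))"
          using hall[of "A \<inter> B"] N[of "A \<inter> B"] A B by auto
        also have "\<dots> \<le> sum s (R `` A \<inter> R `` B)" using NJ by (intro smono) auto
        also have "sum s (R `` A \<union> R `` B) + sum s (R `` A \<inter> R `` B) = sum s (R `` A) + sum s (R `` B)"
          using sum.union_inter[OF finN finN, of s] by simp
        finally show ?thesis using B(4) by simp
      qed
      then show ?thesis using True False by (simp add: sd'[OF A] ss'[OF finN])
    qed
  qed
  have "\<exists>t. (\<forall>i j. 0 \<le> t i j) \<and> (\<forall>i j. (i, j) \<notin> R \<longrightarrow> t i j = 0) \<and>
    (\<forall>i\<in>I. (\<Sum>j\<in>J. t i j) = d' i) \<and> (\<forall>j\<in>J. (\<Sum>i\<in>I. t i j) \<le> s' j)"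
    by (rule insert.IH[OF R _ _ hall']) (use d0 s0 ed es in \<open>auto simp: d'_def s'_def\<close>)
  then obtain t where t: "\<forall>i j. 0 \<le> t i j" "\<forall>i j. (i, j) \<notin> R \<longrightarrow> t i j = 0"
    "\<forall>i\<in>I. (\<Sum>j\<in>J. t i j) = d' i" "\<forall>j\<in>J. (\<Sum>i\<in>I. t i j) \<le> s' j" by blast
  define u where "u x y = t x y + (if x = i \<and> y = j then e else 0)" for x y
  have "(\<Sum>y\<in>J. u x y) = (\<Sum>y\<in>J. t x y) + (if x = i then e else 0)" for x
    using j J by (cases "x = i") (simp_all add: u_def sum.distrib)
  moreover have "(\<Sum>x\<in>I. u x y) = (\<Sum>x\<in>I. t x y) + (if y = j then e else 0)" for y
    using i I by (cases "y = j") (simp_all add: u_def sum.distrib)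
  ultimately have "\<forall>x\<in>I. (\<Sum>y\<in>J. u x y) = d x" "\<forall>y\<in>J. (\<Sum>x\<in>I. u x y) \<le> s y"
    using t(3,4) by (auto simp: d'_def s'_def split: if_splits)
  moreover have "\<forall>x y. 0 \<le> u x y" "\<forall>x y. (x, y) \<notin> insert p R \<longrightarrow> u x y = 0"
    using t(1,2) e0 p by (auto simp: u_def)
  ultimately show ?case by blast
qed

section \<open>Finite sums in a cone\<close>

context abstract_cone
begin

text \<open>The laws of \<open>add\<close> hold only on the carrier; the guard makes the folded
  function commute for all arguments. Terms outside the carrier are skipped.\<close>

definition csum :: "('i \<Rightarrow> 'a) \<Rightarrow> 'i set \<Rightarrow> 'a" where
  "csum f A = Finite_Set.fold (\<lambda>i a. if a \<in> C \<and> f i \<in> C then add (f i) a else a) zero A"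

lemma add_left_commute:
  "x \<in> C \<Longrightarrow> y \<in> C \<Longrightarrow> z \<in> C \<Longrightarrow> add x (add y z) = add y (add x z)"
  using add_assoc add_commute by metis

lemma add_interchange:
  assumes "a \<in> C" "b \<in> C" "c \<in> C" "d \<in> C"
  shows "add (add a b) (add c d) = add (add a c) (add b d)"
  using assms add_left_commute[of b c d] by (metis add_assoc add_closed)

lemma csum_empty [simp]: "csum f {} = zero"
  by (simp add: csum_def)

lemma csum_insert_raw:
  assumes "finite A" "x \<notin> A"
  shows "csum f (insert x A) = (if csum f A \<in> C \<and> f x \<in> C then add (f x) (csum f A) else csum f A)"
proof -
  interpret comp_fun_commute "\<lambda>i a. if a \<in> C \<and> f i \<in> C then add (f i) a else a"
    by standard (auto simp: fun_eq_iff add_closed add_left_commute)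
  show ?thesis unfolding csum_def using fold_insert[OF assms] by simp
qed

lemma csum_closed: "csum f A \<in> C"
proof (cases "finite A")
  case True
  then show ?thesis by induction (auto simp: csum_insert_raw zero_closed add_closed)
qed (simp add: csum_def zero_closed)

lemma csum_insert:
  "finite A \<Longrightarrow> x \<notin> A \<Longrightarrow> f x \<in> C \<Longrightarrow> csum f (insert x A) = add (f x) (csum f A)"
  by (simp add: csum_insert_raw csum_closed)

lemma add_zero_right: "x \<in> C \<Longrightarrow> add x zero = x"
  using add_zero add_commute zero_closed by metis

lemma csum_cong:
  assumes "\<And>x. x \<in> A \<Longrightarrow> f x = g x"
  shows "csum f A = csum g A"
proof (cases "finite A")
  case True
  then show ?thesis using assms by induction (auto simp: csum_insert_raw)
qed (simp add: csum_def)

lemma csum_zero: "csum (\<lambda>x. zero) A = zero"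
proof (cases "finite A")
  case True
  then show ?thesis by induction (auto simp: csum_insert add_zero zero_closed)
qed (simp add: csum_def)

lemma csum_add:
  assumes "finite A" "\<And>x. x \<in> A \<Longrightarrow> f x \<in> C" "\<And>x. x \<in> A \<Longrightarrow> g x \<in> C"
  shows "csum (\<lambda>x. add (f x) (g x)) A = add (csum f A) (csum g A)"
  using assms
proof (induction A)
  case (insert x A)
  then have c: "f x \<in> C" "g x \<in> C" by auto
  have "add (add (f x) (g x)) (add (csum f A) (csum g A)) = add (add (f x) (csum f A)) (add (g x) (csum g A))"
    by (intro add_interchange c csum_closed)
  then show ?case using insert c by (simp add: csum_insert add_closed)
qed (simp add: add_zero zero_closed)

lemma csum_smul:
  assumes "finite A" "\<And>x. x \<in> A \<Longrightarrow> f x \<in> C" "0 \<le> r"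
  shows "smul r (csum f A) = csum (\<lambda>x. smul r (f x)) A"
  using assms by (induction A) (auto simp: smul_zero_right csum_insert smul_closed smul_add_right csum_closed)

lemma csum_swap:
  assumes "finite A" "finite B" "\<And>x y. x \<in> A \<Longrightarrow> y \<in> B \<Longrightarrow> h x y \<in> C"
  shows "csum (\<lambda>x. csum (h x) B) A = csum (\<lambda>y. csum (\<lambda>x. h x y) A) B"
  using assms(1,3)
proof (induction A)
  case empty
  then show ?case by (simp add: csum_zero)
next
  case (insert x A)
  have "csum (\<lambda>y. csum (\<lambda>x. h x y) (insert x A)) B = csum (\<lambda>y. add (h x y) (csum (\<lambda>x. h x y) A)) B"
    using insert by (intro csum_cong csum_insert) auto
  also have "\<dots> = add (csum (h x) B) (csum (\<lambda>y. csum (\<lambda>x. h x y) A) B)"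
    using insert assms(2) by (intro csum_add) (auto simp: csum_closed)
  finally show ?case using insert by (simp add: csum_insert csum_closed)
qed

lemma csum_weights:
  assumes "finite A" "\<And>x. x \<in> A \<Longrightarrow> 0 \<le> t x" "y \<in> C"
  shows "csum (\<lambda>x. smul (t x) y) A = smul (sum t A) y"
  using assms by (induction A) (auto simp: smul_zero_left csum_insert smul_closed smul_add_left sum_nonneg)

lemma csum_superset:
  assumes "finite B" "A \<subseteq> B" "\<And>x. x \<in> A \<Longrightarrow> f x \<in> C" "\<And>x. x \<in> B - A \<Longrightarrow> f x = zero"
  shows "csum f B = csum f A"
proof -
  have "csum f (A \<union> D) = csum f A" if "finite D" "D \<subseteq> B - A" for D
    using that
  proof (induction D)
    case (insert x D)
    then have "f x = zero" "x \<notin> A \<union> D" "finite (A \<union> D)" using assms finite_subset by auto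
    then show ?case using insert by (simp add: csum_insert zero_closed add_zero csum_closed)
  qed simp
  from this[of "B - A"] show ?thesis using assms by (simp add: Un_absorb1)
qed

text \<open>The sum is expressed as a multiple of its normalised barycentre, so that the total
  weight need not be 1. Points of weight 0 may lie outside \<open>K\<close>, as happens for points
  that receive no transported mass.\<close>

lemma csum_convex:
  assumes K: "cone_convex add smul K" "K \<subseteq> C" and "finite G" "G \<subseteq> C"
    and "\<And>y. y \<in> G \<Longrightarrow> 0 \<le> t y" "\<And>y. y \<in> G \<Longrightarrow> t y \<noteq> 0 \<Longrightarrow> y \<in> K" and "0 < sum t G"
  shows "\<exists>k\<in>K. csum (\<lambda>y. smul (t y) y) G = smul (sum t G) k"
  using assms(3-)
proof (induction G)
  case (insert y G)
  have y: "y \<in> C" "0 \<le> t y" using insert.prems by auto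
  have s: "csum (\<lambda>y. smul (t y) y) (insert y G) = add (smul (t y) y) (csum (\<lambda>y. smul (t y) y) G)"
    using insert.hyps y by (simp add: csum_insert smul_closed)
  have G0: "0 \<le> sum t G" using insert.prems by (intro sum_nonneg) auto
  \<comment> \<open>The induction hypothesis asks for positive total weight on \<open>G\<close>, and
    a point of weight 0 need not lie in \<open>K\<close>; the degenerate cases are therefore split
    off before normalising.\<close>
  consider "t y = 0" | "t y \<noteq> 0" "sum t G = 0" | "0 < t y" "0 < sum t G" using y G0 by force
  then show ?case
  proof cases
    case 1
    then show ?thesis using insert s y by (simp add: smul_zero_left add_zero csum_closed)
  next
    case 2
    then have "\<forall>z\<in>G. t z = 0" using insert by (simp add: sum_nonneg_eq_0_iff)
    then have "csum (\<lambda>y. smul (t y) y) G = csum (\<lambda>y. zero) G"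
      using insert.prems by (intro csum_cong) (auto simp: smul_zero_left)
    then show ?thesis using 2 insert s y by (auto simp: csum_zero add_zero_right smul_closed)
  next
    case 3
    then obtain k where k: "k \<in> K" "csum (\<lambda>y. smul (t y) y) G = smul (sum t G) k"
      using insert by auto
    define T where "T = sum t (insert y G)"
    have T: "0 < T" "T = t y + sum t G" using 3 insert by (auto simp: T_def)
    let ?k = "add (smul (t y / T) y) (smul (1 - t y / T) k)"
    have "?k \<in> K"
      using K(1) k(1) insert.prems 3 T unfolding cone_convex_def by auto
    moreover have "smul T ?k = add (smul (t y) y) (smul (sum t G) k)"
    proof -
      have kC: "k \<in> C" using k K by blast
      have T1: "1 - t y / T = sum t G / T" using T by (simp add: field_simps)
      have "smul T ?k = add (smul T (smul (t y / T) y)) (smul T (smul (sum t G / T) k))"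
        unfolding T1 using T y kC G0 by (intro smul_add_right smul_closed) auto
      also have "\<dots> = add (smul (T * (t y / T)) y) (smul (T * (sum t G / T)) k)"
        using T y kC G0 by (subst (1 2) smul_smul) auto
      finally show ?thesis using T by simp
    qed
    ultimately show ?thesis using s k by (metis T_def)
  qed
qed simp

definition bary :: "('a \<Rightarrow> real) \<Rightarrow> 'a" where
  "bary w = csum (\<lambda>x. smul (w x) x) {x. w x \<noteq> 0}"

lemma bary_superset:
  assumes "finite G" "{x. w x \<noteq> 0} \<subseteq> G" "G \<subseteq> C" "\<And>x. 0 \<le> w x"
  shows "bary w = csum (\<lambda>x. smul (w x) x) G"
  unfolding bary_def
  by (rule csum_superset[symmetric]) (use assms in \<open>auto simp: smul_closed smul_zero_left\<close>)

lemma bary_point: "x \<in> C \<Longrightarrow> bary (\<lambda>y. if y = x then 1 else 0) = x"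
  by (subst bary_superset[of "{x}"]) (auto simp: csum_insert smul_one add_zero_right)

lemma bary_lin:
  assumes "finite {x. w x \<noteq> 0}" "{x. w x \<noteq> 0} \<subseteq> C" "\<And>x. 0 \<le> w x"
    and "finite {x. v x \<noteq> 0}" "{x. v x \<noteq> 0} \<subseteq> C" "\<And>x. 0 \<le> v x" and "0 \<le> r" "0 \<le> s"
  shows "bary (\<lambda>x. r * w x + s * v x) = add (smul r (bary w)) (smul s (bary v))"
proof -
  let ?G = "{x. w x \<noteq> 0} \<union> {x. v x \<noteq> 0}"
  have G: "finite ?G" "?G \<subseteq> C" using assms by auto
  have "bary (\<lambda>x. r * w x + s * v x) = csum (\<lambda>x. smul (r * w x + s * v x) x) ?G"
    using G assms by (intro bary_superset) auto
  also have "\<dots> = csum (\<lambda>x. add (smul r (smul (w x) x)) (smul s (smul (v x) x))) ?G"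
    using G assms by (intro csum_cong) (auto simp: smul_add_left smul_smul subset_iff)
  also have "\<dots> = add (csum (\<lambda>x. smul r (smul (w x) x)) ?G) (csum (\<lambda>x. smul s (smul (v x) x)) ?G)"
    using G assms by (intro csum_add) (auto intro!: smul_closed)
  also have "csum (\<lambda>x. smul r (smul (w x) x)) ?G = smul r (csum (\<lambda>x. smul (w x) x) ?G)"
    using G assms by (intro csum_smul[symmetric]) (auto intro!: smul_closed)
  also have "csum (\<lambda>x. smul (w x) x) ?G = bary w"
    using G assms by (intro bary_superset[symmetric]) auto
  also have "csum (\<lambda>x. smul s (smul (v x) x)) ?G = smul s (csum (\<lambda>x. smul (v x) x) ?G)"
    using G assms by (intro csum_smul[symmetric]) (auto intro!: smul_closed)
  also have "csum (\<lambda>x. smul (v x) x) ?G = bary v"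
    using G assms by (intro bary_superset[symmetric]) auto
  finally show ?thesis .
qed

end

section \<open>From cones to algebras\<close>

locale wlc_sober_cone =
  fixes C :: "'a topology" and add :: "'a \<Rightarrow> 'a \<Rightarrow> 'a" and zero :: 'a and smul :: "real \<Rightarrow> 'a \<Rightarrow> 'a"
  assumes wlc_sober: "wlc_sober_topological_cone C add zero smul"

sublocale wlc_sober_cone \<subseteq> abstract_cone "topspace C" add zero smul
  using wlc_sober by (simp add: wlc_sober_topological_cone_def topological_cone_def)

context wlc_sober_cone
begin

lemma t0: "t0_space C"
  and add_cont: "continuous_map (prod_topology C C) C (\<lambda>(x, y). add x y)"
  and smul_cont: "continuous_map (prod_topology scott_nnreal C) C (\<lambda>(r, x). smul r x)"
  and wlc: "weakly_locally_convex C add smul"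
  and sober: "sober_space C"
  using wlc_sober by (simp_all add: wlc_sober_topological_cone_def topological_cone_def)

section \<open>Continuity of finite weighted sums\<close>

lemma continuous_map_add:
  assumes "continuous_map Y C f" "continuous_map Y C g"
  shows "continuous_map Y C (\<lambda>y. add (f y) (g y))"
  using continuous_map_compose[OF continuous_map_pairedI[OF assms] add_cont] by (simp add: o_def)

lemma continuous_map_smul:
  assumes "continuous_map Y scott_nnreal f" "continuous_map Y C g"
  shows "continuous_map Y C (\<lambda>y. smul (f y) (g y))"
  using continuous_map_compose[OF continuous_map_pairedI[OF assms] smul_cont] by (simp add: o_def)

text \<open>Scott continuity of \<open>r \<mapsto> a + r c\<close> makes every open neighbourhood of \<open>a = a + 0 c\<close> contain
  \<open>a + c\<close>.\<close>

lemma add_in_open: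
  assumes W: "openin C W" "a \<in> W" and c: "c \<in> topspace C"
  shows "add a c \<in> W"
proof -
  have a: "a \<in> topspace C" using W openin_subset by blast
  have "continuous_map scott_nnreal C (\<lambda>r. add a (smul r c))"
    using a c by (intro continuous_map_add continuous_map_smul) (auto simp: continuous_map_const)
  then have *: "openin scott_nnreal {r \<in> {0..}. add a (smul r c) \<in> W}" (is "openin _ ?S")
    using W(1) unfolding continuous_map_def by auto
  have "0 \<in> ?S" using a c W by (simp add: smul_zero_left add_zero_right)
  moreover have "1 \<in> S" if "openin scott_nnreal S" "0 \<in> S" for S
    using that unfolding openin_scott_nnreal by auto
  ultimately have "1 \<in> ?S" using * by blast
  then show ?thesis using c by (simp add: smul_one)
qed

text \<open>Joint continuity of addition and scaling is peeled off one summand at a time. A Scott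
  open set containing a positive \<open>r x\<close> also contains smaller positive scalars, and the
  resulting gap \<open>d x < r x\<close> later makes Hall's condition strict.\<close>

lemma csum_box:
  assumes "finite F" "openin C W" "\<And>x. x \<in> F \<Longrightarrow> 0 < r x \<and> x \<in> topspace C"
    and "csum (\<lambda>x. smul (r x) x) F \<in> W"
  shows "\<exists>d U. (\<forall>x\<in>F. 0 < d x \<and> d x < r x \<and> openin C (U x) \<and> x \<in> U x) \<and>
      (\<forall>y. (\<forall>x\<in>F. y x \<in> U x) \<longrightarrow> csum (\<lambda>x. smul (d x) (y x)) F \<in> W)"
  using assms
proof (induction F arbitrary: W)
  case empty
  then show ?case by auto
next
  case (insert x F)
  have x: "0 < r x" "x \<in> topspace C" using insert.prems by auto
  have rx: "smul (r x) x \<in> topspace C" using x by (intro smul_closed) auto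
  have "openin (prod_topology C C) {p \<in> topspace (prod_topology C C). (\<lambda>(x, y). add x y) p \<in> W}"
    using add_cont insert.prems(1) unfolding continuous_map_def by blast
  moreover have "(smul (r x) x, csum (\<lambda>x. smul (r x) x) F) \<in>
      {p \<in> topspace (prod_topology C C). (\<lambda>(x, y). add x y) p \<in> W}"
    using insert rx by (simp add: csum_insert csum_closed)
  ultimately obtain A B where AB: "openin C A" "openin C B" "smul (r x) x \<in> A"
    "csum (\<lambda>x. smul (r x) x) F \<in> B" "A \<times> B \<subseteq> {p \<in> topspace (prod_topology C C). (\<lambda>(x, y). add x y) p \<in> W}"
    unfolding openin_prod_topology_alt by meson
  have "openin (prod_topology scott_nnreal C)
      {p \<in> topspace (prod_topology scott_nnreal C). (\<lambda>(r, x). smul r x) p \<in> A}"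
    using smul_cont AB(1) unfolding continuous_map_def by blast
  moreover have "(r x, x) \<in> {p \<in> topspace (prod_topology scott_nnreal C). (\<lambda>(r, x). smul r x) p \<in> A}"
    using x AB by simp
  ultimately obtain S U where SU: "openin scott_nnreal S" "openin C U" "r x \<in> S" "x \<in> U"
    "S \<times> U \<subseteq> {p \<in> topspace (prod_topology scott_nnreal C). (\<lambda>(r, x). smul r x) p \<in> A}"
    unfolding openin_prod_topology_alt by meson
  have "\<exists>d\<in>S. 0 < d \<and> d < r x"
    using SU(1,3) unfolding openin_scott_nnreal
  proof (elim disjE exE conjE)
    assume "S = {0..}"
    then show ?thesis using x by (intro bexI[of _ "r x / 2"]) auto
  next
    fix s assume "0 \<le> s" "S = {s<..}"
    then show ?thesis using x SU(3) by (intro bexI[of _ "(s + r x) / 2"]) auto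
  qed auto
  then obtain d where d: "d \<in> S" "0 < d" "d < r x" by blast
  have "\<exists>e V. (\<forall>x\<in>F. 0 < e x \<and> e x < r x \<and> openin C (V x) \<and> x \<in> V x) \<and>
      (\<forall>y. (\<forall>x\<in>F. y x \<in> V x) \<longrightarrow> csum (\<lambda>x. smul (e x) (y x)) F \<in> B)"
    using insert.prems AB by (intro insert.IH) auto
  then obtain e V where eV: "\<forall>x\<in>F. 0 < e x \<and> e x < r x \<and> openin C (V x) \<and> x \<in> V x"
    "\<forall>y. (\<forall>x\<in>F. y x \<in> V x) \<longrightarrow> csum (\<lambda>x. smul (e x) (y x)) F \<in> B" by blast
  let ?d = "e(x := d)" and ?U = "V(x := U)"
  have "csum (\<lambda>x. smul (?d x) (y x)) (insert x F) \<in> W" if y: "\<forall>z\<in>insert x F. y z \<in> ?U z" for y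
  proof -
    have yx: "y x \<in> U" "\<forall>z\<in>F. y z \<in> V z" using y insert.hyps by (auto split: if_splits)
    have "csum (\<lambda>x. smul (?d x) (y x)) F = csum (\<lambda>x. smul (e x) (y x)) F"
      using insert.hyps by (intro csum_cong) auto
    then have "csum (\<lambda>x. smul (?d x) (y x)) F \<in> B" using eV(2) yx by simp
    moreover have "smul d (y x) \<in> A" using SU(5) d yx by auto
    ultimately have "add (smul d (y x)) (csum (\<lambda>x. smul (?d x) (y x)) F) \<in> W" using AB(5) by auto
    moreover have "y x \<in> topspace C" using yx SU openin_subset by blast
    ultimately show ?thesis using insert.hyps d by (simp add: csum_insert smul_closed)
  qed
  moreover have "\<forall>z\<in>insert x F. 0 < ?d z \<and> ?d z < r z \<and> openin C (?U z) \<and> z \<in> ?U z"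
    using eV(1) d SU insert.hyps by auto
  ultimately show ?case by blast
qed

text \<open>By transportation, a simple valuation close to \<open>w\<close> dominates a sum of simple valuations of
  mass \<open>d x\<close> concentrated near \<open>x\<close>; weak local convexity keeps their normalised barycentres near \<open>x\<close>.\<close>

lemma bary_continuous:
  assumes w: "weight C w" and W: "openin C W" "bary w \<in> W"
  shows "\<exists>N. openin (Vp C) N \<and> simple_val C w \<in> N \<and> (\<forall>v. weight C v \<and> simple_val C v \<in> N \<longrightarrow> bary v \<in> W)"
proof -
  define F where "F = {x. w x \<noteq> 0}"
  have F: "finite F" "F \<subseteq> topspace C" "\<And>x. x \<in> F \<Longrightarrow> 0 < w x"
    using w by (auto simp: weight_def F_def less_le)
  have "csum (\<lambda>x. smul (w x) x) F \<in> W" using W by (simp add: bary_def F_def)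
  then obtain d U where d: "\<forall>x\<in>F. 0 < d x \<and> d x < w x \<and> openin C (U x) \<and> x \<in> U x"
    and dU: "\<forall>y. (\<forall>x\<in>F. y x \<in> U x) \<longrightarrow> csum (\<lambda>x. smul (d x) (y x)) F \<in> W"
    using csum_box[OF F(1) W(1), of w] F by blast
  have "\<forall>x\<in>F. \<exists>K V. cone_convex add smul K \<and> openin C V \<and> x \<in> V \<and> V \<subseteq> K \<and> K \<subseteq> U x"
    using wlc d unfolding weakly_locally_convex_def by blast
  then obtain K V where KV: "\<forall>x\<in>F. cone_convex add smul (K x) \<and> openin C (V x) \<and> x \<in> V x \<and> V x \<subseteq> K x \<and> K x \<subseteq> U x"
    by metis
  \<comment> \<open>One strict condition for every nonempty subset of \<open>F\<close>: together
    they are Hall's condition for demands \<open>d\<close> and capacities given by a weight. The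
    empty set is excluded because it would demand 0 < 0.\<close>
  define P where "P = (\<lambda>A. (\<Union>x\<in>A. V x, sum d A)) ` {A. A \<subseteq> F \<and> A \<noteq> {}}"
  define N where "N = {\<mu>. point_continuous_valuation C \<mu> \<and> (\<forall>(U, r)\<in>P. ennreal r < \<mu> U)}"
  have VA: "openin C (\<Union>x\<in>A. V x)" "0 \<le> sum d A" if "A \<subseteq> F" for A
  proof -
    show "openin C (\<Union>x\<in>A. V x)" using that KV by (intro openin_Union) auto
    show "0 \<le> sum d A" using that d by (intro sum_nonneg less_imp_le) auto
  qed
  have "finite P" unfolding P_def using F(1) by simp
  then have "openin (Vp C) N" unfolding N_def
    using VA by (intro openin_Vp_finite) (auto simp: P_def)
  moreover have "simple_val C w \<in> N"
  proof -
    have "ennreal (sum d A) < simple_val C w (\<Union>x\<in>A. V x)" if A: "A \<subseteq> F" "A \<noteq> {}" for A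
    proof -
      have "sum d A < sum w A" using A d F(1) finite_subset by (intro sum_strict_mono) auto
      also have "\<dots> \<le> mass w (\<Union>x\<in>A. V x)"
        unfolding mass_def using A KV w F by (intro sum_mono2) (auto simp: F_def weight_def)
      finally show ?thesis using VA[OF A(1)] by (simp add: simple_val_def ennreal_less_iff)
    qed
    then show ?thesis unfolding N_def P_def using point_continuous_valuation_simple_val[OF w] by auto
  qed
  moreover have "bary v \<in> W" if v: "weight C v" and vN: "simple_val C v \<in> N" for v
  proof -
    define G where "G = {y. v y \<noteq> 0}"
    have G: "finite G" "G \<subseteq> topspace C" and v0: "\<And>y. 0 \<le> v y" using v by (auto simp: weight_def G_def)
    define R where "R = {(x, y). x \<in> F \<and> y \<in> G \<and> y \<in> V x}"
    have hall: "sum d A \<le> sum v (R `` A)" if A: "A \<subseteq> F" for A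
    proof (cases "A = {}")
      case False
      then have "ennreal (sum d A) < simple_val C v (\<Union>x\<in>A. V x)"
        using vN A unfolding N_def P_def by auto
      then have "sum d A < mass v (\<Union>x\<in>A. V x)"
        using VA[OF A] by (simp add: simple_val_def ennreal_less_iff)
      moreover have "{y \<in> \<Union>x\<in>A. V x. v y \<noteq> 0} = R `` A" using A by (auto simp: R_def G_def)
      ultimately show ?thesis by (simp add: mass_def)
    qed simp
    have "R \<subseteq> F \<times> G" by (auto simp: R_def)
    moreover have "finite R" using \<open>R \<subseteq> F \<times> G\<close> F(1) G(1) finite_subset by blast
    ultimately obtain t where t: "\<forall>x y. 0 \<le> t x y" "\<forall>x y. (x, y) \<notin> R \<longrightarrow> t x y = 0"
      "\<forall>x\<in>F. (\<Sum>y\<in>G. t x y) = d x" "\<forall>y\<in>G. (\<Sum>x\<in>F. t x y) \<le> v y"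
      using transport[of R F G d v] F(1) G(1) d v0 hall by (metis less_imp_le)
    have "\<exists>k\<in>K x. csum (\<lambda>y. smul (t x y) y) G = smul (sum (t x) G) k" if x: "x \<in> F" for x
    proof (rule csum_convex[OF _ _ G])
      show "K x \<subseteq> topspace C" using KV d x openin_subset by blast
      show "y \<in> K x" if "y \<in> G" "t x y \<noteq> 0" for y using t(2) that KV x by (auto simp: R_def)
    qed (use KV x t d in auto)
    then have "\<forall>x\<in>F. \<exists>k\<in>K x. csum (\<lambda>y. smul (t x y) y) G = smul (d x) k" using t(3) by simp
    then obtain k where k: "\<forall>x\<in>F. k x \<in> K x \<and> csum (\<lambda>y. smul (t x y) y) G = smul (d x) (k x)"
      by metis
    let ?s = "\<lambda>y. \<Sum>x\<in>F. t x y"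
    have s: "0 \<le> ?s y" for y using t(1) by (simp add: sum_nonneg)
    \<comment> \<open>The weight \<open>v\<close> splits into the transported part \<open>?s\<close>
      and an excess. The former has its weighted sum in \<open>W\<close> by the choice of the sets
      \<open>U x\<close>, and adding the excess cannot leave \<open>W\<close>.\<close>
    have "bary v = csum (\<lambda>y. add (smul (?s y) y) (smul (v y - ?s y) y)) G"
    proof -
      have "smul (v y) y = add (smul (?s y) y) (smul (v y - ?s y) y)" if "y \<in> G" for y
        using smul_add_left[of "?s y" "v y - ?s y" y] that s t(4) G by auto
      then show ?thesis unfolding bary_def G_def[symmetric] by (intro csum_cong)
    qed
    also have "\<dots> = add (csum (\<lambda>y. smul (?s y) y) G) (csum (\<lambda>y. smul (v y - ?s y) y) G)"
      using G s t(4) by (intro csum_add smul_closed) auto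
    also have "\<dots> \<in> W"
    proof (rule add_in_open[OF W(1)])
      have "csum (\<lambda>y. smul (?s y) y) G = csum (\<lambda>y. csum (\<lambda>x. smul (t x y) y) F) G"
        using G t(1) F(1) by (intro csum_cong csum_weights[symmetric]) auto
      also have "\<dots> = csum (\<lambda>x. csum (\<lambda>y. smul (t x y) y) G) F"
        using G t(1) F(1) by (intro csum_swap smul_closed) auto
      also have "\<dots> = csum (\<lambda>x. smul (d x) (k x)) F"
        using k by (intro csum_cong) auto
      also have "\<dots> \<in> W" using dU k KV by blast
      finally show "csum (\<lambda>y. smul (?s y) y) G \<in> W" .
    qed (rule csum_closed)
    finally show ?thesis .
  qed
  ultimately show ?thesis by blast
qed

section \<open>The barycentre map\<close>

lemma bary_closed: "bary w \<in> topspace C"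
  unfolding bary_def by (rule csum_closed)

lemma ex_barycentre:
  assumes \<nu>: "point_continuous_valuation C \<nu>"
  shows "\<exists>b\<in>topspace C. \<forall>W. openin C W \<longrightarrow>
    (b \<in> W \<longleftrightarrow> (\<exists>w. weight C w \<and> simple_val C w \<le> \<nu> \<and> bary w \<in> W))"
proof -
  let ?S = "{bary w | w. weight C w \<and> simple_val C w \<le> \<nu>}"
  have "\<exists>b\<in>topspace C. \<forall>W. openin C W \<longrightarrow> (b \<in> W \<longleftrightarrow> W \<inter> ?S \<noteq> {})"
  proof (rule generic_point[OF sober])
    show "?S \<subseteq> topspace C" using bary_closed by auto
    have "bary (\<lambda>x. 0) \<in> ?S" using weight_zero[of C] by (auto simp: simple_val_zero le_fun_def intro!: exI[of _ "\<lambda>x. 0"])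
    then show "?S \<noteq> {}" by blast
    fix U V assume UV: "openin C U" "openin C V" "U \<inter> ?S \<noteq> {}" "V \<inter> ?S \<noteq> {}"
    then obtain u v where u: "weight C u" "simple_val C u \<le> \<nu>" "bary u \<in> U"
      and v: "weight C v" "simple_val C v \<le> \<nu>" "bary v \<in> V" by auto
    obtain M where M: "openin (Vp C) M" "simple_val C u \<in> M"
      "\<forall>v. weight C v \<and> simple_val C v \<in> M \<longrightarrow> bary v \<in> U"
      using bary_continuous[OF u(1) UV(1) u(3)] by blast
    obtain N where N: "openin (Vp C) N" "simple_val C v \<in> N"
      "\<forall>w. weight C w \<and> simple_val C w \<in> N \<longrightarrow> bary w \<in> V"
      using bary_continuous[OF v(1) UV(2) v(3)] by blast
    \<comment> \<open>Both neighbourhoods are upward closed, so \<nu> belongs to their intersection,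
      and density supplies a single simple valuation below \<nu> in it. This gives irreducibility of
      the set of barycentres without a common upper bound of \<open>u\<close> and
      \<open>v\<close>.\<close>
    have "\<nu> \<in> M \<inter> N"
      using Vp_upward_closed[OF M(1,2) u(2) \<nu>] Vp_upward_closed[OF N(1,2) v(2) \<nu>] by blast
    then obtain w where "weight C w" "simple_val C w \<le> \<nu>" "simple_val C w \<in> M \<inter> N"
      using simple_below_in_open[OF openin_Int[OF M(1) N(1)]] by blast
    then show "U \<inter> V \<inter> ?S \<noteq> {}" using M(3) N(3) by blast
  qed
  then show ?thesis by blast
qed

text \<open>For point-continuous \<nu> the open sets containing the point are prescribed, so it is
  unique in the T0 space \<open>C\<close>; the choice operator merely makes the map total.\<close>

definition bc :: "('a set \<Rightarrow> ennreal) \<Rightarrow> 'a" where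
  "bc \<nu> = (SOME b. b \<in> topspace C \<and> (\<forall>W. openin C W \<longrightarrow>
    (b \<in> W \<longleftrightarrow> (\<exists>w. weight C w \<and> simple_val C w \<le> \<nu> \<and> bary w \<in> W))))"

lemma bc:
  assumes "point_continuous_valuation C \<nu>"
  shows "bc \<nu> \<in> topspace C"
    and "openin C W \<Longrightarrow> bc \<nu> \<in> W \<longleftrightarrow> (\<exists>w. weight C w \<and> simple_val C w \<le> \<nu> \<and> bary w \<in> W)"
proof -
  have "\<exists>b. b \<in> topspace C \<and> (\<forall>W. openin C W \<longrightarrow>
    (b \<in> W \<longleftrightarrow> (\<exists>w. weight C w \<and> simple_val C w \<le> \<nu> \<and> bary w \<in> W)))"
    using ex_barycentre[OF assms] by blast
  then have *: "bc \<nu> \<in> topspace C \<and> (\<forall>W. openin C W \<longrightarrow>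
    (bc \<nu> \<in> W \<longleftrightarrow> (\<exists>w. weight C w \<and> simple_val C w \<le> \<nu> \<and> bary w \<in> W)))"
    unfolding bc_def by (rule someI_ex)
  from conjunct1[OF *] show "bc \<nu> \<in> topspace C" .
  from conjunct2[OF *, rule_format, of W]
  show "openin C W \<Longrightarrow> bc \<nu> \<in> W \<longleftrightarrow> (\<exists>w. weight C w \<and> simple_val C w \<le> \<nu> \<and> bary w \<in> W)" .
qed

text \<open>The neighbourhood obtained at a simple valuation below \<nu> also serves at \<nu>: it
  contains \<nu> by upward closure, and each of its members has, by density, a simple valuation
  below it in the same neighbourhood, whose barycentre lies in \<open>W\<close>.\<close>

lemma continuous_map_bc: "continuous_map (Vp C) C bc"
  unfolding continuous_map_def
proof (intro conjI allI impI)
  fix W assume W: "openin C W"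
  have "\<exists>T. openin (Vp C) T \<and> \<nu> \<in> T \<and> T \<subseteq> {\<nu> \<in> topspace (Vp C). bc \<nu> \<in> W}"
    if "\<nu> \<in> {\<nu> \<in> topspace (Vp C). bc \<nu> \<in> W}" for \<nu>
  proof -
    have \<nu>: "point_continuous_valuation C \<nu>" "bc \<nu> \<in> W" using that by auto
    then obtain w where w: "weight C w" "simple_val C w \<le> \<nu>" "bary w \<in> W" using bc(2)[OF \<nu>(1) W] by blast
    obtain N where N: "openin (Vp C) N" "simple_val C w \<in> N"
      "\<forall>v. weight C v \<and> simple_val C v \<in> N \<longrightarrow> bary v \<in> W"
      using bary_continuous[OF w(1) W w(3)] by blast
    have "bc \<mu> \<in> W \<and> \<mu> \<in> topspace (Vp C)" if \<mu>N: "\<mu> \<in> N" for \<mu>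
    proof -
      have \<mu>: "point_continuous_valuation C \<mu>" using \<mu>N openin_subset[OF N(1)] by auto
      obtain v where "weight C v" "simple_val C v \<le> \<mu>" "simple_val C v \<in> N"
        using simple_below_in_open[OF N(1) \<mu>N] by blast
      then show ?thesis using N(3) bc(2)[OF \<mu> W] \<mu> by auto
    qed
    moreover have "\<nu> \<in> N" by (rule Vp_upward_closed[OF N(1,2) w(2) \<nu>(1)])
    ultimately show ?thesis using N(1) by blast
  qed
  then show "openin (Vp C) {\<nu> \<in> topspace (Vp C). bc \<nu> \<in> W}" using openin_subopen by blast
qed (use bc(1) in auto)

text \<open>\<open>bary\<close> is monotone for the specialisation order: if
  \<open>simple_val C v \<le> simple_val C w\<close>, every open set containing
  \<open>bary v\<close> contains \<open>bary w\<close>. Hence, among the simple valuations below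
  \<open>simple_val C w\<close>, the weight \<open>w\<close> itself has the largest
  barycentre.\<close>

lemma bc_simple:
  assumes w: "weight C w"
  shows "bc (simple_val C w) = bary w"
proof (rule t0_space_eqI[OF t0])
  note pcv = point_continuous_valuation_simple_val[OF w]
  show "bc (simple_val C w) \<in> topspace C" "bary w \<in> topspace C" using bc(1)[OF pcv] bary_closed by auto
  fix W assume W: "openin C W"
  show "bc (simple_val C w) \<in> W \<longleftrightarrow> bary w \<in> W"
  proof
    assume "bc (simple_val C w) \<in> W"
    then obtain v where v: "weight C v" "simple_val C v \<le> simple_val C w" "bary v \<in> W"
      using bc(2)[OF pcv W] by blast
    obtain N where N: "openin (Vp C) N" "simple_val C v \<in> N"
      "\<forall>u. weight C u \<and> simple_val C u \<in> N \<longrightarrow> bary u \<in> W"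
      using bary_continuous[OF v(1) W v(3)] by blast
    then show "bary w \<in> W" using Vp_upward_closed[OF N(1,2) v(2) pcv] w by blast
  next
    assume "bary w \<in> W"
    then show "bc (simple_val C w) \<in> W" using bc(2)[OF pcv W] w by blast
  qed
qed

lemma bc_dirac: "x \<in> topspace C \<Longrightarrow> bc (dirac C x) = x"
  using bc_simple[OF weight_point, of x 1] by (simp add: simple_val_point bary_point)

text \<open>Linearity being the goal, only the agreement principle for continuous maps is available,
  and it handles one variable at a time: the second argument is fixed and simple while the first
  varies, then the first is fixed while the second varies. On pairs of simple valuations the
  identity is the linearity of \<open>bary\<close>.\<close>

lemma bc_lin:
  assumes \<mu>: "point_continuous_valuation C \<mu>" and \<nu>: "point_continuous_valuation C \<nu>" and "0 \<le> r" "0 \<le> s"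
  shows "bc (val_add (val_scale r \<mu>) (val_scale s \<nu>)) = add (smul r (bc \<mu>)) (smul s (bc \<nu>))"
proof -
  have smul: "continuous_map Y C (\<lambda>y. smul a (f y))" if "0 \<le> a" "continuous_map Y C f"
    for a f and Y :: "('a set \<Rightarrow> ennreal) topology"
    using that by (intro continuous_map_smul) (auto simp: continuous_map_const)
  have const: "continuous_map Y C (\<lambda>y. smul a (bc \<rho>))" if "0 \<le> a" "point_continuous_valuation C \<rho>"
    for a \<rho> and Y :: "('a set \<Rightarrow> ennreal) topology"
    using that bc(1) smul_closed by (auto simp: continuous_map_const)
  have cont1: "continuous_map (Vp C) C (\<lambda>\<mu>. bc (val_add (val_scale r \<mu>) (val_scale s \<rho>)))"
    if \<rho>: "point_continuous_valuation C \<rho>" for \<rho>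
  proof -
    have "continuous_map (Vp C) (Vp C) (\<lambda>\<mu>. val_add (val_scale r \<mu>) (val_scale s \<rho>))"
    proof (rule continuous_map_into_Vp)
      fix U assume "openin C U"
      then show "lsc (Vp C) (\<lambda>\<mu>. val_add (val_scale r \<mu>) (val_scale s \<rho>) U)"
        unfolding val_add_def val_scale_def by (intro lsc_add lsc_cmult lsc_eval lsc_const)
    qed (use \<rho> in \<open>auto intro: point_continuous_valuation_lin\<close>)
    from continuous_map_compose[OF this continuous_map_bc] show ?thesis by (simp add: o_def)
  qed
  have cont2: "continuous_map (Vp C) C (\<lambda>\<nu>. bc (val_add (val_scale r \<mu>) (val_scale s \<nu>)))"
  proof -
    have "continuous_map (Vp C) (Vp C) (\<lambda>\<nu>. val_add (val_scale r \<mu>) (val_scale s \<nu>))"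
    proof (rule continuous_map_into_Vp)
      fix U assume "openin C U"
      then show "lsc (Vp C) (\<lambda>\<nu>. val_add (val_scale r \<mu>) (val_scale s \<nu>) U)"
        unfolding val_add_def val_scale_def by (intro lsc_add lsc_cmult lsc_eval lsc_const)
    qed (use \<mu> in \<open>auto intro: point_continuous_valuation_lin\<close>)
    from continuous_map_compose[OF this continuous_map_bc] show ?thesis by (simp add: o_def)
  qed
  have simple: "bc (val_add (val_scale r (simple_val C w)) (val_scale s (simple_val C v)))
      = add (smul r (bc (simple_val C w))) (smul s (bc (simple_val C v)))"
    if "weight C w" "weight C v" for w v
  proof -
    have "bc (val_add (val_scale r (simple_val C w)) (val_scale s (simple_val C v)))
        = bc (simple_val C (\<lambda>x. r * w x + s * v x))"
      using that assms by (simp add: simple_val_lin)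
    also have "\<dots> = bary (\<lambda>x. r * w x + s * v x)"
      using that assms by (intro bc_simple weight_lin) auto
    also have "\<dots> = add (smul r (bary w)) (smul s (bary v))"
      using that assms by (intro bary_lin) (auto simp: weight_def)
    finally show ?thesis using that by (simp add: bc_simple)
  qed
  have left: "bc (val_add (val_scale r \<mu>) (val_scale s (simple_val C v)))
      = add (smul r (bc \<mu>)) (smul s (bc (simple_val C v)))" if v: "weight C v" for v
    using assms v simple[OF _ v] point_continuous_valuation_simple_val[OF v]
    by (intro eq_on_simple_imp_eq[OF cont1 continuous_map_add[OF smul[OF _ continuous_map_bc] const] t0 _ \<mu>]) auto
  show ?thesis
    using assms left
    by (intro eq_on_simple_imp_eq[OF cont2 continuous_map_add[OF const smul[OF _ continuous_map_bc]] t0 _ \<nu>]) auto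
qed

lemma linear_bc: "linear_on_Vp C add smul bc"
  unfolding linear_between_def using bc(1) bc_lin by auto

end

theorem theorem5p11:
  fixes X :: "'a topology" and \<alpha> :: "('a set \<Rightarrow> ennreal) \<Rightarrow> 'a"
    and C :: "'b topology" and add :: "'b \<Rightarrow> 'b \<Rightarrow> 'b" and zero :: 'b
    and smul :: "real \<Rightarrow> 'b \<Rightarrow> 'b"
  shows
    "(t0_space X \<and> \<alpha> \<in> topspace (Vp X) \<rightarrow> topspace X \<and> Vp_algebra X \<alpha> \<longrightarrow>
       (let plus = (\<lambda>x y. \<alpha> (val_add (dirac X x) (dirac X y)));
            times = (\<lambda>r x. \<alpha> (val_scale r (dirac X x)))
        in (\<exists>z. wlc_sober_topological_cone X plus z times) \<and>
           linear_on_Vp X plus times \<alpha> \<and>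
           continuous_map (Vp X) X \<alpha> \<and>
           (\<forall>\<nu>\<in>topspace (Vp X). barycentre X plus times \<nu> (\<alpha> \<nu>)) \<and>
           (\<forall>x\<in>topspace X. \<alpha> (dirac X x) = x)))
     \<and>
     (wlc_sober_topological_cone C add zero smul \<longrightarrow>
       (let P = (\<lambda>\<beta>. continuous_map (Vp C) C \<beta> \<and> linear_on_Vp C add smul \<beta> \<and>
                     (\<forall>x\<in>topspace C. \<beta> (dirac C x) = x))
        in (\<exists>\<beta>. P \<beta>) \<and>
           (\<forall>\<beta> \<gamma>. P \<beta> \<and> P \<gamma> \<longrightarrow> (\<forall>\<nu>\<in>topspace (Vp C). \<beta> \<nu> = \<gamma> \<nu>)) \<and>
           (\<forall>\<beta>. P \<beta> \<longrightarrow> Vp_algebra C \<beta>)))"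
proof (intro conjI impI; (elim conjE)?)
  assume "Vp_algebra X \<alpha>"
  then interpret Vp_algebra_loc X \<alpha> by unfold_locales
  show "let plus = (\<lambda>x y. \<alpha> (val_add (dirac X x) (dirac X y)));
            times = (\<lambda>r x. \<alpha> (val_scale r (dirac X x)))
        in (\<exists>z. wlc_sober_topological_cone X plus z times) \<and>
           linear_on_Vp X plus times \<alpha> \<and>
           continuous_map (Vp X) X \<alpha> \<and>
           (\<forall>\<nu>\<in>topspace (Vp X). barycentre X plus times \<nu> (\<alpha> \<nu>)) \<and>
           (\<forall>x\<in>topspace X. \<alpha> (dirac X x) = x)"
    unfolding Let_def wlc_sober_topological_cone_def
    using topological wlc sober linear cont barycentre unit by auto
next
  assume "wlc_sober_topological_cone C add zero smul"
  then interpret wlc_sober_cone C add zero smul by unfold_locales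
  \<comment> \<open>Uniqueness uses some Dirac mass to reach the zero valuation; the zero of the
    cone provides the point.\<close>
  have ne: "topspace C \<noteq> {}" using zero_closed by blast
  show "let P = (\<lambda>\<beta>. continuous_map (Vp C) C \<beta> \<and> linear_on_Vp C add smul \<beta> \<and>
                     (\<forall>x\<in>topspace C. \<beta> (dirac C x) = x))
        in (\<exists>\<beta>. P \<beta>) \<and>
           (\<forall>\<beta> \<gamma>. P \<beta> \<and> P \<gamma> \<longrightarrow> (\<forall>\<nu>\<in>topspace (Vp C). \<beta> \<nu> = \<gamma> \<nu>)) \<and>
           (\<forall>\<beta>. P \<beta> \<longrightarrow> Vp_algebra C \<beta>)"
    unfolding Let_def
  proof (intro conjI allI impI ballI; (elim conjE)?)
    show "\<exists>\<beta>. continuous_map (Vp C) C \<beta> \<and> linear_on_Vp C add smul \<beta> \<and> (\<forall>x\<in>topspace C. \<beta> (dirac C x) = x)"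
      using continuous_map_bc linear_bc bc_dirac by blast
  next
    fix \<beta> \<gamma> \<nu>
    assume "\<nu> \<in> topspace (Vp C)" "continuous_map (Vp C) C \<beta>" "linear_on_Vp C add smul \<beta>"
      "\<forall>x\<in>topspace C. \<beta> (dirac C x) = x" "continuous_map (Vp C) C \<gamma>" "linear_on_Vp C add smul \<gamma>"
      "\<forall>x\<in>topspace C. \<gamma> (dirac C x) = x"
    then show "\<beta> \<nu> = \<gamma> \<nu>"
      using linear_continuous_unique[of C "topspace C" add smul \<beta> \<gamma> C \<nu>] t0 ne by simp
  next
    fix \<beta>
    assume "continuous_map (Vp C) C \<beta>" "linear_on_Vp C add smul \<beta>" "\<forall>x\<in>topspace C. \<beta> (dirac C x) = x"
    then show "Vp_algebra C \<beta>" using linear_retraction_algebra[OF t0] by blast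
  qed
qed

end
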